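(* Let $q$ be a prime power, $n\ge1$, $d=\lceil 2\log_q n\rceil$, $m=q^{\lceil\log_q n\rceil}$ and $t=\lfloor\log_d n\rfloor$. Let $g,h\in\mathbb{F}_q[X]$ be coprime with $\deg g,\deg h\le d$, and suppose $f=g/h$ has degree at least $2$, is not a monomial, is not a binomial of the form $aX^{p^{\ell}}+b$ ($p$ the characteristic of $\mathbb{F}_q$, $a\ne0$, $\ell\ge0$), is not linearly conjugate to $1/X^{\deg f}$, and satisfies: $\deg g\ne\deg h$, or $f$ is separable, or $f$ is not of the form $L(X^{p^{\ell}})$ with $L\in\mathbb{F}_q(X)$ of degree $1$ and $\ell\ge1$. Suppose $\alpha\in\mathbb{F}_{q^n}$ has degree $n$ over $\mathbb{F}_q$ and is a root of $X^m h(X)-g(X)$. Then the multiplicative order of $\alpha$ in $\mathbb{F}_{q^n}^*$ is at least $$\binom{n+t-1}{t}\prod_{i=0}^{t-1}\frac{1}{d^i}.$$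
   Context: Rational functions are in lowest terms, $\deg(g/h)=\max\{\deg g,\deg h\}$. Linear conjugacy means $\phi'=\psi^{-1}\circ\phi\circ\psi$ with $\psi$ of degree one; $f$ is separable if $f'\ne0$. Iterates $f^{(k)}$ are $k$-fold compositions of $f$. *)

theory Defs
  imports "HOL-Computational_Algebra.Polynomial" "HOL-Computational_Algebra.Fraction_Field"
          "HOL-Number_Theory.Prime_Powers"
begin

definition ratf :: "'a::field poly \<Rightarrow> 'a poly \<Rightarrow> 'a poly fract" where
  "ratf g h = Fract g h"

definition rconst :: "'a::field \<Rightarrow> 'a poly fract" where
  "rconst c = Fract [:c:] 1"

definition rX :: "'a::field poly fract" where
  "rX = Fract [:0, 1:] 1"

definition moeb :: "'a::field \<Rightarrow> 'a \<Rightarrow> 'a \<Rightarrow> 'a \<Rightarrow> 'a poly fract \<Rightarrow> 'a poly fract" where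
  "moeb a b c e y = (rconst a * y + rconst b) / (rconst c * y + rconst e)"

definition is_monomial_rat :: "'a::field set \<Rightarrow> 'a poly \<Rightarrow> 'a poly \<Rightarrow> bool" where
  "is_monomial_rat F g h \<longleftrightarrow>
     (\<exists>c\<in>F. \<exists>k::int. c \<noteq> 0 \<and> ratf g h = rconst c * rX powi k)"

definition is_frob_binomial :: "'a::field set \<Rightarrow> 'a poly \<Rightarrow> 'a poly \<Rightarrow> bool" where
  "is_frob_binomial F g h \<longleftrightarrow>
     (\<exists>a\<in>F. \<exists>b\<in>F. \<exists>l::nat. a \<noteq> 0 \<and>
        ratf g h = rconst a * rX ^ (CHAR('a) ^ l) + rconst b)"

text \<open>f is linearly conjugate to 1/X^D: f = psi^{-1} o (1/X^D) o psi for some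
psi = (aX+b)/(cX+e) of degree one with coefficients in F (ae - bc \<noteq> 0);
psi^{-1} = (eX - b)/(-cX + a).\<close>
definition lin_conj_inv_power :: "'a::field set \<Rightarrow> 'a poly \<Rightarrow> 'a poly \<Rightarrow> nat \<Rightarrow> bool" where
  "lin_conj_inv_power F g h D \<longleftrightarrow>
     (\<exists>a\<in>F. \<exists>b\<in>F. \<exists>c\<in>F. \<exists>e\<in>F. a * e - b * c \<noteq> 0 \<and>
        ratf g h = moeb e (- b) (- c) a (inverse ((moeb a b c e rX) ^ D)))"

text \<open>f = g/h is separable: f' \<noteq> 0, i.e. the numerator of the quotient rule is nonzero.\<close>
definition separable_rat :: "'a::field poly \<Rightarrow> 'a poly \<Rightarrow> bool" where
  "separable_rat g h \<longleftrightarrow> pderiv g * h - g * pderiv h \<noteq> 0"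

definition is_L_of_frob :: "'a::field set \<Rightarrow> 'a poly \<Rightarrow> 'a poly \<Rightarrow> bool" where
  "is_L_of_frob F g h \<longleftrightarrow>
     (\<exists>a\<in>F. \<exists>b\<in>F. \<exists>c\<in>F. \<exists>e\<in>F. \<exists>l::nat. l \<ge> 1 \<and> a * e - b * c \<noteq> 0 \<and>
        ratf g h = moeb a b c e (rX ^ (CHAR('a) ^ l)))"

definition alg_degree :: "'a::field set \<Rightarrow> 'a \<Rightarrow> nat" where
  "alg_degree F x = (LEAST k. \<exists>p. p \<noteq> 0 \<and> (\<forall>i. coeff p i \<in> F) \<and> degree p = k \<and> poly p x = 0)"

definition mult_order :: "'a::field \<Rightarrow> nat" where
  "mult_order x = (LEAST k. 0 < k \<and> x ^ k = 1)"

end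

theory Submission
  imports "HOL-Algebra.Algebraic_Closure_Type" Defs
begin

text \<open>
  Let r be the order of alpha, f = g/h and D = deg f. As m is a power of q, alpha^(m^j) = f_j(alpha) for the
  j-th iterate f_j. A multiplicative relation between the f_j(alpha) whose degree is below n is therefore a
  relation between the rational functions f_j.

  If f is not of the form (a X^(p^l) + b) / (c X^(p^l) + e), the f_j are multiplicatively independent:
  a relation X^k u(f) = 1 makes f totally ramified over the zero and over the pole of u, so f is a fractional
  linear image of X^D, and pulling back a second time, a nontrivial D-th root of unity leaves only monomials.
  Hence the lattice of all k with r | k_0 + k_1 m + k_2 m^2 + ... contains no nonzero vector of weighted norm
  |k_0| + D |k_1| + D^2 |k_2| + ... below n, and r is at least the number of integer points in a ball of
  diameter n - 1. (The simplex k_0 + D k_1 + ... < n, k_j >= 0, has twice this diameter and cannot be used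
  unless f is a polynomial.) The number of points exceeds the bound, except for t = 2 with n close to
  [d^2, 2 d^2] and three pairs (d, n) with t = 3; as d is about 2 log_q n, only finitely many (q, n) are left,
  and there every r below the bound is excluded by a short vector or by q^n = 1 mod r.

  The hypotheses leave f = a / (X^(p^l) + b). Here the numerators of suitable products of iterates are powers of X
  and their poles are the points of the backward orbit of infinity, so that the simplex is available unless
  infinity is periodic with a period P at most t. In that case n divides P s with m = p^s D, which is possible only
  for finitely many n and q.
\<close>

section \<open>Lattices without short vectors\<close>

text \<open>In t coordinates the weighted ball of diameter n has volume
  \<open>vol D t * n^t\<close>. For D = d this is only the leading term of the bound, whose
  remaining factor is the product of 1 + j/n over j < t, about 1 + t^2/(2n). For t \<ge> 2 a
  second-order term therefore has to be won. Counting the ball layer by layer is trapezoidal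
  summation. For t = 2 the layers grow linearly and nothing is gained. For t \<ge> 3 convexity
  yields a relative excess of order t (d^(t-1)/n)^2, and as n < d^(t+1), this beats t^2/(2n) for t
  \<ge> 4. For t = 3 it does so up to n near (2/3) d^4. In the ranges left over, one more iterate is
  used, since independence holds for any number of them: the layers where the new coordinate is 1 or
  -1 pay for the deficit once n is clearly above 2 d^t. For t = 2 and smaller n these layers are
  empty or too thin, which is where the exceptions come from. If D < d, the ratios (d/D)^i of the
  volumes cover the whole factor.\<close>

definition lattice_min :: "nat \<Rightarrow> nat \<Rightarrow> nat \<Rightarrow> nat \<Rightarrow> nat \<Rightarrow> bool" where
  "lattice_min D m r n T \<longleftrightarrow> (\<forall>k :: nat \<Rightarrow> int.
     (\<Sum>j<T. \<bar>k j\<bar> * int D ^ j) < int n \<longrightarrow> int r dvd (\<Sum>j<T. k j * int m ^ j) \<longrightarrow> (\<forall>j<T. k j = 0))"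

text \<open>Here y is the remaining diameter, so one step along the coordinate of weight
  \<open>D ^ Suc T\<close> costs \<open>2 * D ^ Suc T\<close>; the factor 2 before the sum counts
  both signs. Truncated subtraction makes all layers beyond the boundary empty, so the range of j
  only has to be long enough.\<close>

primrec ball_count :: "nat \<Rightarrow> nat \<Rightarrow> nat \<Rightarrow> nat" where
  "ball_count D 0 y = y"
| "ball_count D (Suc T) y = ball_count D T y + 2 * (\<Sum>j=1..y. ball_count D T (y - 2 * D ^ Suc T * j))"

text \<open>The weighted L1-ball of diameter y - 1. Its centre is shifted by 1/2 in the coordinate of weight 1
  according to the parity of y, so that no point is wasted there.\<close>
definition wball :: "nat \<Rightarrow> nat \<Rightarrow> nat \<Rightarrow> int \<Rightarrow> (nat \<Rightarrow> int) set" where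
  "wball D T y c = {k. (\<forall>i>T. k i = 0) \<and> \<bar>2 * k 0 - c\<bar> + 2 * (\<Sum>i=1..T. \<bar>k i\<bar> * int D ^ i) < int y}"

lemma sum_int_symmetric:
  fixes f :: "nat \<Rightarrow> nat"
  shows "(\<Sum>j\<in>{- int y..int y}. f (nat \<bar>j\<bar>)) = f 0 + 2 * (\<Sum>j=1..y. f j)"
proof -
  have "{- int y..int y} = {0} \<union> ({1..int y} \<union> {- int y..-1})" by auto
  then have "(\<Sum>j\<in>{- int y..int y}. f (nat \<bar>j\<bar>))
      = f 0 + ((\<Sum>j\<in>{1..int y}. f (nat \<bar>j\<bar>)) + (\<Sum>j\<in>{- int y..-1}. f (nat \<bar>j\<bar>)))"
    by (subst sum.union_disjoint[symmetric]) (auto simp flip: sum.union_disjoint simp: sum.union_disjoint)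
  also have "(\<Sum>j\<in>{1..int y}. f (nat \<bar>j\<bar>)) = (\<Sum>j=1..y. f j)"
    by (rule sum.reindex_bij_witness[of _ int nat]) auto
  also have "(\<Sum>j\<in>{- int y..-1}. f (nat \<bar>j\<bar>)) = (\<Sum>j=1..y. f j)"
    by (rule sum.reindex_bij_witness[of _ "\<lambda>j. - int j" "\<lambda>j. nat (- j)"]) auto
  finally show ?thesis by simp
qed

text \<open>On the axis of weight 1 there are exactly y points if y - 1 + c is even, and only y - 1
  otherwise. The other coordinates use up even amounts and preserve this parity; y = 0 is allowed
  separately because truncated subtraction may end there.\<close>

lemma card_wball:
  assumes "y = 0 \<or> even (int y - 1 + c)" "D \<ge> 1"
  shows "finite (wball D T y c) \<and> card (wball D T y c) = ball_count D T y"
  using assms(1)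
proof (induction T arbitrary: y)
  case 0
  show ?case
  proof (cases "y = 0")
    case True
    then have "wball D 0 y c = {}" by (auto simp: wball_def)
    with True show ?thesis by simp
  next
    case False
    with 0 have "even (int y - 1 + c)" by blast
    then obtain u where u: "int y - 1 + c = 2 * u" by (rule evenE)
    have "bij_betw (\<lambda>x i. if i = 0 then x else 0) {u - (int y - 1)..u} (wball D 0 y c)"
      by (rule bij_betw_byWitness[where f' = "\<lambda>k. k 0"]) (use u in \<open>auto simp: wball_def fun_eq_iff\<close>)
    then have "finite (wball D 0 y c)" "card (wball D 0 y c) = card {u - (int y - 1)..u}"
      using bij_betw_finite bij_betw_same_card by (metis finite_atLeastAtMost_int)+
    then show ?thesis by simp
  qed
next
  case (Suc T)
  define W where "W = D ^ Suc T"
  have W: "W \<ge> 1" using assms(2) by (simp add: W_def)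
  let ?y = "\<lambda>j::int. y - 2 * W * nat \<bar>j\<bar>"
  have par: "?y j = 0 \<or> even (int (?y j) - 1 + c)" for j
  proof (cases "2 * W * nat \<bar>j\<bar> \<le> y")
    case True
    then show ?thesis using Suc.prems by (auto simp: of_nat_diff algebra_simps)
  qed auto
  have eq: "wball D (Suc T) y c = (\<Union>j\<in>{- int y..int y}. (\<lambda>k. k(Suc T := j)) ` wball D T (?y j) c)"
  proof (intro equalityI subsetI)
    fix k assume "k \<in> wball D (Suc T) y c"
    then have k: "\<And>i. i > Suc T \<Longrightarrow> k i = 0"
      "\<bar>2 * k 0 - c\<bar> + 2 * (\<Sum>i=1..T. \<bar>k i\<bar> * int D ^ i) + 2 * (\<bar>k (Suc T)\<bar> * int W) < int y"
      by (auto simp: wball_def W_def)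
    have nn: "(\<Sum>i=1..T. \<bar>k i\<bar> * int D ^ i) \<ge> 0" by (intro sum_nonneg) auto
    have "\<bar>k (Suc T)\<bar> * 1 \<le> \<bar>k (Suc T)\<bar> * int W" using W by (intro mult_left_mono) auto
    then have "k (Suc T) \<in> {- int y..int y}" using k(2) nn by auto
    moreover have "k(Suc T := 0) \<in> wball D T (?y (k (Suc T))) c"
    proof -
      have "(\<Sum>i=1..T. \<bar>(k(Suc T := 0)) i\<bar> * int D ^ i) = (\<Sum>i=1..T. \<bar>k i\<bar> * int D ^ i)"
        by (intro sum.cong) auto
      moreover have "int (?y (k (Suc T))) = int y - 2 * (\<bar>k (Suc T)\<bar> * int W)"
      proof -
        have "int (2 * W * nat \<bar>k (Suc T)\<bar>) = 2 * (\<bar>k (Suc T)\<bar> * int W)" by simp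
        moreover from this have "2 * W * nat \<bar>k (Suc T)\<bar> \<le> y" using k(2) nn by linarith
        ultimately show ?thesis by (simp add: of_nat_diff)
      qed
      ultimately show ?thesis using k by (auto simp: wball_def)
    qed
    moreover have "k = (k(Suc T := 0))(Suc T := k (Suc T))" by simp
    ultimately show "k \<in> (\<Union>j\<in>{- int y..int y}. (\<lambda>k. k(Suc T := j)) ` wball D T (?y j) c)" by blast
  next
    fix k assume "k \<in> (\<Union>j\<in>{- int y..int y}. (\<lambda>k. k(Suc T := j)) ` wball D T (?y j) c)"
    then obtain j k' where k: "k = k'(Suc T := j)" and k': "k' \<in> wball D T (?y j) c" by auto
    have s: "(\<Sum>i=1..T. \<bar>k i\<bar> * int D ^ i) = (\<Sum>i=1..T. \<bar>k' i\<bar> * int D ^ i)"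
      unfolding k by (intro sum.cong) auto
    have nn: "(\<Sum>i=1..T. \<bar>k' i\<bar> * int D ^ i) \<ge> 0" by (intro sum_nonneg) auto
    have lt: "\<bar>2 * k' 0 - c\<bar> + 2 * (\<Sum>i=1..T. \<bar>k' i\<bar> * int D ^ i) < int (?y j)"
      using k' by (simp add: wball_def)
    then have "2 * W * nat \<bar>j\<bar> \<le> y" using nn by linarith
    then have "int (?y j) = int y - 2 * (\<bar>j\<bar> * int W)" by (simp add: of_nat_diff)
    with lt s have "\<bar>2 * k 0 - c\<bar> + 2 * (\<Sum>i=1..Suc T. \<bar>k i\<bar> * int D ^ i) < int y"
      by (simp add: k W_def)
    moreover have "\<forall>i>Suc T. k i = 0" using k' by (auto simp: k wball_def)
    ultimately show "k \<in> wball D (Suc T) y c" by (simp add: wball_def)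
  qed
  have inj: "inj_on (\<lambda>k. k(Suc T := j)) (wball D T (?y j) c)" for j
    by (rule inj_onI) (metis (mono_tags, lifting) fun_upd_triv fun_upd_upd lessI mem_Collect_eq wball_def)
  have fin: "finite ((\<lambda>k. k(Suc T := j)) ` wball D T (?y j) c)" for j
    using Suc.IH[OF par] by auto
  have "card (wball D (Suc T) y c) = (\<Sum>j\<in>{- int y..int y}. card ((\<lambda>k. k(Suc T := j)) ` wball D T (?y j) c))"
    unfolding eq by (rule card_UN_disjoint) (use fin in \<open>auto simp: fun_eq_iff\<close>, metis)
  also have "\<dots> = (\<Sum>j\<in>{- int y..int y}. ball_count D T (y - 2 * W * nat \<bar>j\<bar>))"
    using Suc.IH[OF par] by (simp add: card_image[OF inj])
  also have "\<dots> = ball_count D (Suc T) y"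
    using sum_int_symmetric[of "\<lambda>j. ball_count D T (y - 2 * W * j)" y] by (simp add: W_def)
  finally show ?case using fin unfolding eq by auto
qed

text \<open>Pigeonhole: two points of the ball with the same residue modulo r differ by a lattice
  vector of norm below n. The ball has the coordinates 0 to T, hence \<open>Suc T\<close> in the
  hypothesis.\<close>

lemma ball_count_le:
  assumes "lattice_min D m r n (Suc T)" "D \<ge> 1" "r > 0" "n \<ge> 1"
  shows "ball_count D T n \<le> r"
proof -
  define c :: int where "c = (if even n then 1 else 0)"
  have par: "n = 0 \<or> even (int n - 1 + c)" by (simp add: c_def)
  have card: "finite (wball D T n c)" "card (wball D T n c) = ball_count D T n"
    using card_wball[OF par assms(2), of T] by blast+
  let ?f = "\<lambda>k :: nat \<Rightarrow> int. (\<Sum>j<Suc T. k j * int m ^ j) mod int r"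
  have "inj_on ?f (wball D T n c)"
  proof (rule inj_onI)
    fix k k' assume k: "k \<in> wball D T n c" "k' \<in> wball D T n c" and eq: "?f k = ?f k'"
    define l where "l = (\<lambda>j. k j - k' j)"
    have "int r dvd (\<Sum>j<Suc T. l j * int m ^ j)"
      using eq by (simp only: l_def left_diff_distrib sum_subtractf mod_eq_dvd_iff)
    moreover have "2 * (\<Sum>j<Suc T. \<bar>l j\<bar> * int D ^ j) < 2 * int n"
    proof -
      have split: "(\<Sum>j<Suc T. f j) = f 0 + (\<Sum>i=1..T. f i)" for f :: "nat \<Rightarrow> int"
        by (subst sum.lessThan_Suc_shift) (simp add: sum.atLeast1_atMost_eq)
      have "(\<Sum>i=1..T. \<bar>l i\<bar> * int D ^ i) \<le> (\<Sum>i=1..T. \<bar>k i\<bar> * int D ^ i) + (\<Sum>i=1..T. \<bar>k' i\<bar> * int D ^ i)"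
        unfolding l_def sum.distrib[symmetric] distrib_right[symmetric]
        by (intro sum_mono mult_right_mono) auto
      moreover have "2 * \<bar>l 0\<bar> \<le> \<bar>2 * k 0 - c\<bar> + \<bar>2 * k' 0 - c\<bar>" unfolding l_def by (smt (verit))
      ultimately show ?thesis using k unfolding split by (simp add: wball_def)
    qed
    ultimately have z: "l j = 0" if "j < Suc T" for j
      using assms(1) that unfolding lattice_min_def by (metis mult_less_cancel_left_pos zero_less_numeral)
    show "k = k'"
    proof
      fix i show "k i = k' i"
      proof (cases "i < Suc T")
        case True then show ?thesis using z[of i] by (simp add: l_def)
      next
        case False then show ?thesis using k by (simp add: wball_def)
      qed
    qed
  qed
  moreover have "?f ` wball D T n c \<subseteq> {0..<int r}" using assms(3) by auto
  ultimately have "card (wball D T n c) \<le> card {0..<int r}"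
    by (rule card_inj_on_le) auto
  then show ?thesis using card by simp
qed

section \<open>Lower bounds for the number of points in a ball by trapezoidal summation\<close>

definition layer :: "(nat \<Rightarrow> nat) \<Rightarrow> nat \<Rightarrow> nat \<Rightarrow> nat" where
  "layer f w y = f y + 2 * (\<Sum>j=1..y. f (y - w * j))"

lemma ball_count_layer: "ball_count D (Suc T) y = layer (ball_count D T) (2 * D ^ Suc T) y"
  by (simp add: layer_def)

lemma ball_count_0 [simp]: "ball_count D T 0 = 0"
  by (induction T) auto

lemma layer_small:
  assumes "f 0 = 0" "y < w" shows "layer f w y = f y"
proof -
  have "f (y - w * j) = 0" if "j \<in> {1..y}" for j
  proof -
    have "w * 1 \<le> w * j" using that by (intro mult_le_mono2) simp
    then have "y \<le> w * j" using assms(2) by linarith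
    then have "y - w * j = 0" by simp
    then show ?thesis using assms(1) by simp
  qed
  then have "(\<Sum>j=1..y. f (y - w * j)) = 0" by (intro sum.neutral) blast
  then show ?thesis unfolding layer_def by simp
qed

text \<open>Each step of length w adds the two end values of one cell, so \<open>layer\<close> is a
  trapezoidal sum.\<close>

lemma layer_rec:
  assumes "f 0 = 0" "w \<ge> 1" "y \<ge> w"
  shows "layer f w y = layer f w (y - w) + f y + f (y - w)"
proof -
  have "(\<Sum>j=1..y. f (y - w * j)) = f (y - w) + (\<Sum>j=2..y. f (y - w * j))"
    using assms by (subst sum.atLeast_Suc_atMost) (auto simp: numeral_2_eq_2)
  also have "(\<Sum>j=2..y. f (y - w * j)) = (\<Sum>j=1..y - 1. f (y - w - w * j))"
    by (rule sum.reindex_bij_witness[of _ Suc "\<lambda>j. j - 1"]) (auto simp: diff_mult_distrib2)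
  also have "\<dots> = (\<Sum>j=1..y - w. f (y - w - w * j))"
  proof (rule sum.mono_neutral_right)
    show "\<forall>j\<in>{1..y - 1} - {1..y - w}. f (y - w - w * j) = 0"
    proof
      fix j assume "j \<in> {1..y - 1} - {1..y - w}"
      then have "y - w \<le> 1 * j" by auto
      also have "\<dots> \<le> w * j" using assms(2) by (intro mult_le_mono1)
      finally show "f (y - w - w * j) = 0" using assms(1) by simp
    qed
  qed (use assms in auto)
  finally show ?thesis by (simp add: layer_def)
qed

text \<open>Telescoping: a candidate \<Phi> is tested on one initial window of length w and
  afterwards cell by cell.\<close>

lemma layer_lower:
  assumes "f 0 = 0" "w \<ge> 1"
    and base: "\<And>y. ys \<le> y \<Longrightarrow> y < ys + w \<Longrightarrow> \<Phi> y \<le> real (layer f w y)"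
    and step: "\<And>y. ys + w \<le> y \<Longrightarrow> \<Phi> y - \<Phi> (y - w) \<le> real (f y) + real (f (y - w))"
  shows "ys \<le> y \<Longrightarrow> \<Phi> y \<le> real (layer f w y)"
proof (induction y rule: less_induct)
  case (less y)
  show ?case
  proof (cases "y < ys + w")
    case False
    then have "\<Phi> (y - w) \<le> real (layer f w (y - w))" using less assms(2) by auto
    from False have "ys + w \<le> y" by simp
    from step[OF this] show ?thesis using \<open>\<Phi> (y - w) \<le> _\<close> layer_rec[of f w y] assms(1,2) False by auto
  qed (use base less.prems in auto)
qed

text \<open>The parameter c weighs the next Euler-Maclaurin term.\<close>
lemma trapezoid_gain:
  fixes B c :: real
  assumes "J \<ge> 3" "B \<ge> 0" "0 \<le> c" "c \<le> 1/2"
  shows "(B + 1) ^ J + B ^ J - 2 * ((B + 1) ^ Suc J - B ^ Suc J) / real (Suc J)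
      - c * ((B + 1) ^ (J - 1) - B ^ (J - 1)) \<ge> 0"
  using assms(1,2)
proof (induction J arbitrary: B rule: dec_induct)
  case base
  have "(B + 1) ^ 3 + B ^ 3 - 2 * ((B + 1) ^ 4 - B ^ 4) / 4 - c * ((B + 1) ^ 2 - B ^ 2) = (1/2 - c) * (2 * B + 1)"
    by (simp add: algebra_simps add_divide_distrib diff_divide_distrib power2_eq_square power3_eq_cube power4_eq_xxxx)
  moreover have "(1/2 - c) * (2 * B + 1) \<ge> 0" using assms base by (intro mult_nonneg_nonneg) auto
  ultimately show ?case by (simp add: eval_nat_numeral)
next
  case (step J)
  \<comment> \<open>E is the claimed difference for exponent \<open>Suc J\<close> as a function of
    B. Its derivative is \<open>Suc J\<close> times the difference for exponent J plus a nonnegative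
    rest, so the induction on J is an integration starting at 0.\<close>
  define a where "a = 2 / real (Suc (Suc J))"
  define E where "E = (\<lambda>B::real. (B + 1) ^ Suc J + B ^ Suc J - a * ((B + 1) ^ Suc (Suc J) - B ^ Suc (Suc J))
      - c * ((B + 1) ^ J - B ^ J))"
  define E' where "E' = (\<lambda>B::real. real (Suc J) * (B + 1) ^ J + real (Suc J) * B ^ J - 2 * ((B + 1) ^ Suc J - B ^ Suc J)
      - c * (real J * (B + 1) ^ (J - 1) - real J * B ^ (J - 1)))"
  have a: "a * (real (Suc (Suc J)) * P - real (Suc (Suc J)) * Q) = 2 * (P - Q)" for P Q
    by (simp add: a_def field_simps)
  have deriv: "(E has_real_derivative E' x) (at x)" for x
    unfolding E_def E'_def a[symmetric]
    by (rule derivative_eq_intros refl | simp only: One_nat_def diff_Suc_Suc)+ simp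
  have nonneg: "E' x \<ge> 0" if "x \<ge> 0" for x
  proof -
    have "E' x = real (Suc J) * ((x + 1) ^ J + x ^ J - 2 * ((x + 1) ^ Suc J - x ^ Suc J) / real (Suc J)
      - c * ((x + 1) ^ (J - 1) - x ^ (J - 1))) + c * ((x + 1) ^ (J - 1) - x ^ (J - 1))"
    proof -
      have "real (Suc J) * U - 2 * V - c * (real J * Y - real J * Z)
        = real (Suc J) * (U - 2 * V / real (Suc J) - c * (Y - Z)) + c * (Y - Z)" for U V Y Z
        by (simp add: right_diff_distrib) (simp add: algebra_simps)
      then show ?thesis unfolding E'_def distrib_left[symmetric] .
    qed
    moreover have "(x + 1) ^ (J - 1) - x ^ (J - 1) \<ge> 0" using that by (simp add: power_mono)
    ultimately show ?thesis using step.IH[OF that] assms(3) by simp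
  qed
  have "E 0 \<le> E B"
    by (rule DERIV_nonneg_imp_nondecreasing[OF \<open>0 \<le> B\<close>]) (use deriv nonneg in blast)
  moreover have "E 0 \<ge> 0"
  proof -
    have "E 0 = 1 - 2 / (2 + real J) - c" using step by (simp add: E_def a_def power_0_left)
    moreover have "2 / (2 + real J) \<le> 1 / 2" using step by (simp add: field_simps)
    ultimately show ?thesis using assms(4) by linarith
  qed
  ultimately show ?case by (simp add: E_def a_def)
qed

lemma trapezoid:
  fixes B :: real
  assumes "J \<ge> 1" "B \<ge> 0"
  shows "2 * ((B + 1) ^ Suc J - B ^ Suc J) / real (Suc J) \<le> (B + 1) ^ J + B ^ J"
proof -
  consider "J = 1" | "J = 2" | "J \<ge> 3" using assms(1) by linarith
  then show ?thesis
  proof cases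
    case 3
    then show ?thesis using trapezoid_gain[OF 3 assms(2), of 0] by simp
  qed (auto simp: field_simps power2_eq_square power3_eq_cube eval_nat_numeral)
qed

text \<open>The volume of the simplex with weights D^i and size 1, and equally of the weighted
  L1-ball of diameter 1: there are 2^t orthants, but half the radius.\<close>

definition vol :: "nat \<Rightarrow> nat \<Rightarrow> real" where
  "vol D t = 1 / (fact t * (\<Prod>i<t. real D ^ i))"

lemma vol_pos: "D \<ge> 1 \<Longrightarrow> vol D t > 0"
  unfolding vol_def by (intro divide_pos_pos mult_pos_pos prod_pos) auto

lemma vol_Suc: "vol D (Suc t) = vol D t / (real (Suc t) * real D ^ t)"
  by (simp add: vol_def)

lemma scaled_power:
  assumes "w \<noteq> (0::real)"
  shows "w ^ k * (x / w) ^ Suc k = x ^ Suc k / w" "w ^ Suc k * (x / w) ^ k = w * x ^ k"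
  using assms by (simp_all add: power_divide)

text \<open>In the variable x = y/w the cells have length 1, and \<phi> does not depend on C. As
  \<open>ys \<le> w\<close>, the initial window lies below 2 w, where at most the layers j = 1 and j
  = -1 are present besides the central one; hence the two terms in the condition on \<phi>.\<close>

lemma layer_power_lower:
  assumes f: "f 0 = 0" "\<And>y. C * real y ^ J \<le> real (f y)" and "C \<ge> 0" "w \<ge> 1"
    and phi_base: "\<And>x. real ys / real w \<le> x \<Longrightarrow> x < real ys / real w + 1 \<Longrightarrow>
      \<phi> x \<le> x ^ J + (if x \<ge> 1 then 2 * (x - 1) ^ J else 0)" and "ys \<le> w"
    and phi_step: "\<And>x. x \<ge> real ys / real w + 1 \<Longrightarrow> \<phi> x - \<phi> (x - 1) \<le> x ^ J + (x - 1) ^ J"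
    and "y \<ge> ys"
  shows "C * real w ^ J * \<phi> (real y / real w) \<le> real (layer f w y)"
proof (rule layer_lower[where ys = ys and \<Phi> = "\<lambda>y. C * real w ^ J * \<phi> (real y / real w)"])
  have w: "real w > 0" "real w \<noteq> 0" using assms by auto
  have fl: "C * real w ^ J * (real y / real w) ^ J \<le> real (f y)" for y
    using f(2)[of y] w by (simp add: power_divide)
  have sub: "real (y - w) / real w = real y / real w - 1" if "w \<le> y" for y
    using that w by (simp add: of_nat_diff field_simps)
  have fl': "C * real w ^ J * (real y / real w - 1) ^ J \<le> real (f (y - w))" if "w \<le> y" for y
    using fl[of "y - w"] sub[OF that] by simp
  show "C * real w ^ J * \<phi> (real y / real w) \<le> real (layer f w y)" if y: "ys \<le> y" "y < ys + w" for y
  proof -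
    let ?x = "real y / real w"
    have "real ys / real w \<le> ?x" "?x < real ys / real w + 1"
    proof -
      show "real ys / real w \<le> ?x" using y by (intro divide_right_mono) auto
      have "real y / real w < (real ys + real w) / real w" using y w by (intro divide_strict_right_mono) auto
      then show "?x < real ys / real w + 1" using w by (simp add: add_divide_distrib)
    qed
    from phi_base[OF this] have le: "C * real w ^ J * \<phi> ?x \<le> C * real w ^ J * (?x ^ J + (if ?x \<ge> 1 then 2 * (?x - 1) ^ J else 0))"
      using \<open>C \<ge> 0\<close> by (intro mult_left_mono) auto
    show ?thesis
    proof (cases "y < w")
      case True
      then have "\<not> ?x \<ge> 1" using w by (simp add: field_simps)
      then show ?thesis using le fl[of y] layer_small[of f y w] True f by simp
    next
      case False
      then have "?x \<ge> 1" using w by (simp add: field_simps)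
      moreover have "layer f w y = f y + 2 * f (y - w)"
        using layer_rec[of f w y] layer_small[of f "y - w" w] False y \<open>ys \<le> w\<close> f assms(4) by auto
      ultimately show ?thesis using le fl[of y] fl'[of y] False by (simp add: algebra_simps)
    qed
  qed
  show "C * real w ^ J * \<phi> (real y / real w) - C * real w ^ J * \<phi> (real (y - w) / real w) \<le> real (f y) + real (f (y - w))"
    if y: "ys + w \<le> y" for y
  proof -
    let ?x = "real y / real w"
    have "(real ys + real w) / real w \<le> ?x" using y by (intro divide_right_mono) auto
    then have "?x \<ge> real ys / real w + 1" using w by (simp add: add_divide_distrib)
    from phi_step[OF this] have "C * real w ^ J * (\<phi> ?x - \<phi> (?x - 1)) \<le> C * real w ^ J * (?x ^ J + (?x - 1) ^ J)"
      using \<open>C \<ge> 0\<close> by (intro mult_left_mono) auto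
    moreover have "w \<le> y" using y by simp
    ultimately show ?thesis using fl[of y] fl'[of y] unfolding sub[OF \<open>w \<le> y\<close>] right_diff_distrib distrib_left
      by linarith
  qed
qed (use assms in auto)

text \<open>\<phi> is twice the antiderivative of x^J with J = T + 1; the trapezoidal rule
  overestimates the integral of a convex function.\<close>

lemma ball_count_ge_vol:
  assumes "D \<ge> 1"
  shows "vol D (Suc T) * real y ^ Suc T \<le> real (ball_count D T y)"
proof (induction T arbitrary: y)
  case 0
  then show ?case by (simp add: vol_def)
next
  case (Suc T)
  define w where "w = 2 * D ^ Suc T"
  have w: "w \<ge> 1" using assms by (simp add: w_def Suc_le_eq)
  have "vol D (Suc T) * real w ^ Suc T * (2 * (real y / real w) ^ Suc (Suc T) / real (Suc (Suc T)))
      \<le> real (layer (ball_count D T) w y)"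
  proof (rule layer_power_lower[where ys = 0 and \<phi> = "\<lambda>x. 2 * x ^ Suc (Suc T) / real (Suc (Suc T))"])
    fix x :: real
    show "2 * x ^ Suc (Suc T) / real (Suc (Suc T)) \<le> x ^ Suc T + (if x \<ge> 1 then 2 * (x - 1) ^ Suc T else 0)"
      if "real 0 / real w \<le> x" "x < real 0 / real w + 1"
    proof -
      have x: "0 \<le> x" "x < 1" using that by auto
      have "2 * x ^ Suc (Suc T) / real (Suc (Suc T)) = x ^ Suc T * (2 * x / real (Suc (Suc T)))" by simp
      also have "\<dots> \<le> x ^ Suc T * 1"
        using x by (intro mult_left_mono) (auto simp: field_simps)
      finally show ?thesis using x by simp
    qed
    show "2 * x ^ Suc (Suc T) / real (Suc (Suc T)) - 2 * (x - 1) ^ Suc (Suc T) / real (Suc (Suc T)) \<le> x ^ Suc T + (x - 1) ^ Suc T"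
      if "x \<ge> real 0 / real w + 1"
      using trapezoid[of "Suc T" "x - 1"] that by (simp add: diff_divide_distrib right_diff_distrib)
  qed (use Suc w vol_pos[OF assms] in \<open>auto intro: less_imp_le\<close>)
  moreover have "vol D (Suc T) * real w ^ Suc T * (2 * (real y / real w) ^ Suc (Suc T) / real (Suc (Suc T)))
      = vol D (Suc (Suc T)) * real y ^ Suc (Suc T)"
  proof -
    have "vol D (Suc T) * real w ^ Suc T * (2 * (real y / real w) ^ Suc (Suc T) / real (Suc (Suc T)))
       = vol D (Suc T) * (2 * (real w ^ Suc T * (real y / real w) ^ Suc (Suc T)) / real (Suc (Suc T)))"
      by (simp only: mult_ac times_divide_eq_right)
    also have "\<dots> = vol D (Suc T) * (2 * (real y ^ Suc (Suc T) / real w) / real (Suc (Suc T)))"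
      using w by (subst scaled_power) auto
    also have "\<dots> = vol D (Suc T) / (real (Suc (Suc T)) * real D ^ Suc T) * real y ^ Suc (Suc T)"
      by (simp add: w_def del: power_Suc of_nat_Suc)
    finally show ?thesis unfolding vol_Suc[of D "Suc T"] .
  qed
  ultimately show ?case unfolding ball_count_layer w_def by simp
qed

text \<open>The weight 2/5 of the correction lies below the limit 1/2 of
  \<open>trapezoid_gain\<close>, because the first cell has to be served too: for T \<ge> 3 it is
  enough there that 2 x^2/5 + 2/5 \<le> x, which holds precisely for 1/2 \<le> x \<le> 2. Scaling
  back turns 2/5 into 4/5.\<close>

lemma ball_count_gain:
  assumes "D \<ge> 1" "T \<ge> 2" "y \<ge> 2 * D ^ Suc T"
  shows "vol D (Suc (Suc T)) * real y ^ Suc (Suc T) * (1 + 4/5 * real (Suc (Suc T)) * (real D ^ Suc T / real y) ^ 2)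
    \<le> real (ball_count D (Suc T) y)"
proof -
  define w where "w = 2 * D ^ Suc T"
  have w: "w \<ge> 1" using assms by (simp add: w_def Suc_le_eq)
  have y: "y \<ge> w" using assms w_def by auto
  with w have "y > 0" by simp
  note y = y this
  let ?J = "Suc T"
  let ?\<phi> = "\<lambda>x::real. 2 * x ^ Suc ?J / real (Suc ?J) + 2/5 * x ^ T"
  have "vol D ?J * real w ^ ?J * ?\<phi> (real y / real w) \<le> real (layer (ball_count D T) w y)"
  proof (rule layer_power_lower[where ys = w and \<phi> = ?\<phi>])
    fix x :: real
    show "?\<phi> x \<le> x ^ ?J + (if x \<ge> 1 then 2 * (x - 1) ^ ?J else 0)"
      if "real w / real w \<le> x" "x < real w / real w + 1"
    proof -
      have x: "1 \<le> x" "x < 2" using that w by auto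
      show ?thesis
      proof (cases "T = 2")
        case True
        define u where "u = x - 1"
        have u: "0 \<le> u" "u \<le> 1" "x = 1 + u" using x by (auto simp: u_def)
        have "x ^ 3 + 2 * (x - 1) ^ 3 - (2 * x ^ 4 / 4 + 2/5 * x ^ 2)
            = 1/10 + (1/5 * u * (1 - u) ^ 2 + 3/10 * u ^ 3 + 1/2 * u ^ 3 * (1 - u))"
          unfolding u(3) by (simp add: algebra_simps add_divide_distrib diff_divide_distrib power2_eq_square power3_eq_cube power4_eq_xxxx)
        also have "\<dots> \<ge> 0" using u by (intro add_nonneg_nonneg mult_nonneg_nonneg) auto
        finally show ?thesis using x True by (simp add: eval_nat_numeral)
      next
        case False
        then have T: "T \<ge> 3" using assms by simp
        have "2 * x ^ Suc ?J / real (Suc ?J) + 2/5 * x ^ T = x ^ T * (2 * x ^ 2 / real (Suc ?J) + 2/5)"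
          by (simp add: algebra_simps power2_eq_square)
        also have "\<dots> \<le> x ^ T * x"
        proof (rule mult_left_mono)
          have "2 * x ^ 2 / real (Suc ?J) \<le> 2 * x ^ 2 / 5" using T by (intro divide_left_mono) auto
          moreover have "x - 2/5 * x ^ 2 - 2/5 = 2/5 * (x - 1/2) * (2 - x)" by (simp add: field_simps power2_eq_square)
          moreover have "2/5 * (x - 1/2) * (2 - x) \<ge> 0" using x by (intro mult_nonneg_nonneg) auto
          ultimately show "2 * x ^ 2 / real (Suc ?J) + 2/5 \<le> x" by linarith
        qed (use x in auto)
        also have "\<dots> \<le> x ^ ?J + 2 * (x - 1) ^ ?J" using x by (simp add: mult.commute)
        finally show ?thesis using x by simp
      qed
    qed
    show "?\<phi> x - ?\<phi> (x - 1) \<le> x ^ ?J + (x - 1) ^ ?J" if "x \<ge> real w / real w + 1"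
      using trapezoid_gain[of ?J "x - 1" "2/5"] that assms(2) w
      by (simp add: diff_divide_distrib right_diff_distrib)
  qed (use w y vol_pos[OF assms(1), of ?J] ball_count_ge_vol[OF assms(1)] in \<open>auto intro: less_imp_le\<close>)
  moreover have "vol D ?J * real w ^ ?J * ?\<phi> (real y / real w)
      = vol D (Suc ?J) * real y ^ Suc ?J * (1 + 4/5 * real (Suc ?J) * (real D ^ ?J / real y) ^ 2)"
  proof -
    have W: "real w = 2 * real D ^ ?J" by (simp add: w_def)
    define W where "W = real D ^ ?J"
    have "W > 0" using assms(1) by (simp add: W_def)
    have w0: "real w \<noteq> 0" using w by simp
    have "real w ^ ?J * (2 * (real y / real w) ^ Suc ?J / real (Suc ?J)) = 2 * (real w ^ ?J * (real y / real w) ^ Suc ?J) / real (Suc ?J)"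
      by (simp only: mult_ac times_divide_eq_right)
    also have "\<dots> = real y ^ Suc ?J / (real (Suc ?J) * W)"
      unfolding scaled_power(1)[OF w0] unfolding W W_def by (simp del: power_Suc of_nat_Suc)
    finally have 1: "real w ^ ?J * (2 * (real y / real w) ^ Suc ?J / real (Suc ?J)) = real y ^ Suc ?J / (real (Suc ?J) * W)" .
    have "real w ^ ?J * (2/5 * (real y / real w) ^ T) = 2/5 * (real w ^ ?J * (real y / real w) ^ T)"
      by (simp only: mult_ac)
    also have "\<dots> = 4/5 * W * real y ^ T"
      unfolding scaled_power(2)[OF w0] unfolding W W_def by simp
    finally have 2: "real w ^ ?J * (2/5 * (real y / real w) ^ T) = 4/5 * W * real y ^ T" .
    have "vol D ?J * real w ^ ?J * ?\<phi> (real y / real w)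
       = vol D ?J * (real y ^ Suc ?J / (real (Suc ?J) * W) + 4/5 * W * real y ^ T)"
      unfolding 1[symmetric] 2[symmetric] by (simp only: distrib_left mult.assoc)
    also have "\<dots> = vol D ?J / (real (Suc ?J) * W) * real y ^ Suc ?J * (1 + 4/5 * real (Suc ?J) * (W / real y) ^ 2)"
    proof -
      have "V * (real y * real y * Y / (s * W) + 4/5 * W * Y) = V / (s * W) * (real y * real y * Y) * (1 + 4/5 * s * (W / real y) ^ 2)"
        if "s > 0" for V Y s
        using \<open>W > 0\<close> \<open>y > 0\<close> that by (simp add: field_simps power2_eq_square)
      from this[of "real (Suc ?J)" "vol D ?J" "real y ^ T"] show ?thesis by (simp add: mult.assoc)
    qed
    finally show ?thesis unfolding vol_Suc[of D ?J] W_def .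
  qed
  ultimately show ?thesis unfolding ball_count_layer w_def by simp
qed

text \<open>For quadratic layers the correction is exact,
  \<open>\<phi> x - \<phi> (x - 1) = x^2 + (x - 1)^2\<close>. The constant -1/30 is needed only on
  [0, 1), where x^2 - 2 x^3/3 - x/3 drops to about -0.032.\<close>

lemma ball_count_2_gain:
  assumes "D \<ge> 1" "y \<ge> 1"
  shows "vol D 3 * (real y ^ 3 + 2 * real D ^ 4 * real y - 2/5 * real D ^ 6) \<le> real (ball_count D 2 y)"
proof -
  define w where "w = 2 * D ^ 2"
  have w: "w \<ge> 1" using assms by (simp add: w_def Suc_le_eq)
  let ?\<phi> = "\<lambda>x::real. 2 * x ^ 3 / 3 + x / 3 - 1 / 30"
  have vol: "vol D 2 * real y ^ 2 \<le> real (ball_count D 1 y)" for y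
    using ball_count_ge_vol[OF assms(1), of 1 y] by (simp add: numeral_2_eq_2)
  have "vol D 2 * real w ^ 2 * ?\<phi> (real y / real w) \<le> real (layer (ball_count D 1) w y)"
  proof (rule layer_power_lower[where ys = 0 and \<phi> = ?\<phi>])
    fix x :: real
    show "?\<phi> x \<le> x ^ 2 + (if x \<ge> 1 then 2 * (x - 1) ^ 2 else 0)"
      if "real 0 / real w \<le> x" "x < real 0 / real w + 1"
    proof -
      have x: "0 \<le> x" "x < 1" using that by auto
      \<comment> \<open>The minimum lies at (1 - 1/sqrt 3)/2, which is close to 53/250; this is the
        expansion around that point, with every summand nonnegative on [0, 1).\<close>
      have "x ^ 2 - ?\<phi> x = (x - 53/250) ^ 2 * (1 - 106/375 + 2/3 * (1 - x) - 2/3)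
          + (2 * (53/250) * (1 - 106/375) + (2/3) * (53/250)^2 - 1/3) * x + (1/30 - (53/250)^2 * (1 - 106/375))"
        by (simp add: field_simps power2_eq_square power3_eq_cube)
      also have "\<dots> \<ge> 0"
        using x by (intro add_nonneg_nonneg mult_nonneg_nonneg) (auto simp: power2_eq_square)
      finally show ?thesis using x by simp
    qed
    show "?\<phi> x - ?\<phi> (x - 1) \<le> x ^ 2 + (x - 1) ^ 2"
      by (simp add: field_simps power2_eq_square power3_eq_cube)
  qed (use w vol vol_pos[OF assms(1), of 2] in \<open>auto intro: less_imp_le\<close>)
  moreover have "vol D 2 * real w ^ 2 * ?\<phi> (real y / real w)
      = vol D 3 * (real y ^ 3 + 2 * real D ^ 4 * real y - 2/5 * real D ^ 6)"
  proof -
    have v3: "vol D 3 = vol D 2 / (3 * real D ^ 2)" using vol_Suc[of D 2] by (simp add: eval_nat_numeral)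
    have W: "real w = 2 * real D ^ 2" by (simp add: w_def)
    define W where "W = real D ^ 2"
    have "W > 0" using assms(1) by (simp add: W_def)
    have p: "real D ^ 4 = W ^ 2" "real D ^ 6 = W ^ 3" by (simp_all add: W_def flip: power_mult)
    show ?thesis unfolding v3 p W W_def[symmetric]
      using \<open>W > 0\<close> by (simp add: field_simps power2_eq_square power3_eq_cube)
  qed
  ultimately show ?thesis using ball_count_layer[of D 1 y] by (simp add: w_def numeral_2_eq_2)
qed

text \<open>Only the layers 1 and -1 of the new coordinate are kept.\<close>

lemma ball_count_Suc_ge2:
  assumes "D \<ge> 1" "y > 2 * D ^ Suc T"
  shows "ball_count D T y + 2 * ball_count D T (y - 2 * D ^ Suc T) \<le> ball_count D (Suc T) y"
  using member_le_sum[of 1 "{1..y}" "\<lambda>j. ball_count D T (y - 2 * D ^ Suc T * j)"] assms by simp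

section \<open>Comparison with the bound\<close>

definition order_bound :: "nat \<Rightarrow> nat \<Rightarrow> nat \<Rightarrow> real" where
  "order_bound n t d = real (n + t - 1 choose t) * (\<Prod>i<t. 1 / real d ^ i)"

lemma fact_times_binomial:
  assumes "n \<ge> 1"
  shows "fact t * (n + t - 1 choose t) = (\<Prod>j<t. n + j)"
proof (induction t)
  case (Suc t)
  obtain N where N: "n = Suc N" using assms by (cases n) auto
  have "(n + t) * (n + t - 1 choose t) = (n + Suc t - 1 choose Suc t) * Suc t"
    using Suc_times_binomial_eq[of "N + t" t] by (simp only: N add_Suc add_Suc_right diff_Suc_1)
  then have "fact (Suc t) * (n + Suc t - 1 choose Suc t) = fact t * ((n + t) * (n + t - 1 choose t))"
    by (simp only: fact_Suc of_nat_id mult_ac)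
  then show ?case using Suc by (simp add: algebra_simps)
qed simp

lemma order_bound_eq:
  assumes "n \<ge> 1"
  shows "order_bound n t d = vol d t * (\<Prod>j<t. real (n + j))"
proof -
  have "(\<Prod>j<t. real (n + j)) = fact t * real (n + t - 1 choose t)"
    using fact_times_binomial[OF assms, of t] by (metis of_nat_fact of_nat_mult of_nat_prod)
  then show ?thesis by (simp add: order_bound_def vol_def prod_dividef)
qed

lemma order_bound_eq':
  assumes "n \<ge> 1"
  shows "order_bound n t d = vol d t * real n ^ t * (\<Prod>j<t. 1 + real j / real n)"
proof -
  have "real n ^ t * (\<Prod>j<t. 1 + real j / real n) = (\<Prod>j<t. real n * (1 + real j / real n))"
    by (simp add: prod.distrib)
  also have "\<dots> = (\<Prod>j<t. real (n + j))"
    using assms by (intro prod.cong) (auto simp: field_simps)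
  finally show ?thesis unfolding order_bound_eq[OF assms] by (simp add: mult.assoc)
qed

text \<open>The factor 1 + i/n is at most (1 + 1/n)^i by Bernoulli, and D < d \<le> n gives 1 + 1/n
  \<le> d/D. So lowering the degree by one already outweighs the entire rising factorial.\<close>

lemma order_bound_smaller_degree:
  assumes "1 \<le> D" "D < d" "d \<le> n"
  shows "order_bound n t d \<le> vol D t * real n ^ t"
proof -
  have "(\<Prod>j<t. 1 + real j / real n) * (\<Prod>i<t. real D ^ i) \<le> (\<Prod>i<t. real d ^ i)"
    unfolding prod.distrib[symmetric]
  proof (rule prod_mono)
    fix i
    have "1 + real i / real n \<le> (1 + 1 / real n) ^ i"
    proof -
      have "- 1 \<le> 1 / real n" by (rule order_trans[of _ 0]) auto
      from Bernoulli_inequality[OF this, of i] show ?thesis by simp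
    qed
    also have "\<dots> \<le> (real d / real D) ^ i"
    proof (rule power_mono)
      have "real D * (1 + 1 / real n) \<le> real D + 1" using assms by (simp add: distrib_left)
      also have "\<dots> \<le> real d" using assms by simp
      finally show "1 + 1 / real n \<le> real d / real D" using assms by (simp add: pos_le_divide_eq mult.commute)
    qed simp
    finally have "(1 + real i / real n) * real D ^ i \<le> (real d / real D) ^ i * real D ^ i"
      by (rule mult_right_mono) simp
    also have "\<dots> = real d ^ i" using assms by (simp add: power_divide)
    finally show "0 \<le> (1 + real i / real n) * real D ^ i \<and> (1 + real i / real n) * real D ^ i \<le> real d ^ i"
      by simp
  qed
  moreover have "(\<Prod>i<t. real D ^ i) > 0" "(\<Prod>i<t. real d ^ i) > 0" using assms by (auto intro!: prod_pos)
  ultimately have "vol d t * (\<Prod>j<t. 1 + real j / real n) \<le> vol D t"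
    unfolding vol_def by (simp add: field_simps)
  from mult_right_mono[OF this, of "real n ^ t"] show ?thesis
    using order_bound_eq'[of n t d] assms by (simp add: mult_ac)
qed

lemma prod_one_plus_le:
  assumes "n \<ge> 1" "3 * (t * (t - 1)) \<le> 2 * n"
  shows "(\<Prod>j<t. 1 + real j / real n) \<le> 1 + 4/3 * (real t * real (t - 1) / (2 * real n))"
proof -
  define u where "u = real t * real (t - 1) / (2 * real n)"
  have "(\<Prod>j<t. 1 + real j / real n) \<le> (\<Prod>j<t. exp (real j / real n))"
    by (intro prod_mono conjI exp_ge_add_one_self) auto
  also have "\<dots> = exp (\<Sum>j<t. real j / real n)" by (simp add: exp_sum)
  also have "(\<Sum>j<t. real j / real n) = u"
  proof -
    have "2 * (\<Sum>j<t. real j) = real t * real (t - 1)"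
    proof (induction t)
      case (Suc k)
      then show ?case by (cases k) (auto simp: algebra_simps)
    qed simp
    then show ?thesis using assms by (simp add: u_def field_simps flip: sum_divide_distrib)
  qed
  also have "exp u \<le> 1 + u + u ^ 2"
  proof (rule exp_bound)
    show "0 \<le> u" by (simp add: u_def)
    have "3 * (real t * real (t - 1)) \<le> 2 * real n"
      using assms(2) by (metis of_nat_le_iff of_nat_mult of_nat_numeral)
    then have u3: "u \<le> 1/3" using assms(1) by (simp add: u_def field_simps)
    then show "u \<le> 1" by simp
  qed
  also have "\<dots> \<le> 1 + 4/3 * u"
  proof -
    have "3 * (real t * real (t - 1)) \<le> 2 * real n"
      using assms(2) by (metis of_nat_le_iff of_nat_mult of_nat_numeral)
    then have u3: "u \<le> 1/3" using assms(1) by (simp add: u_def field_simps)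
    have "u * u \<le> 1/3 * u" using u3 by (intro mult_right_mono) (simp_all add: u_def)
    then show ?thesis by (simp add: power2_eq_square)
  qed
  finally show ?thesis by (simp add: u_def)
qed

text \<open>With W = d^(t-1), an excess of about t (t - 1)/(2n) has to be covered by (4/5) t
  (W/n)^2. As n < d^(t+1), the quotient W^2/n is larger than d^(t-3), which suffices for t \<ge>
  5.\<close>

lemma order_bound_ge_4:
  assumes "d \<ge> 2" "t \<ge> 4" "d ^ t \<le> n" "n < d ^ (t + 1)"
  shows "order_bound n t d \<le> real (ball_count d (t - 1) n)"
proof -
  define W where "W = real d ^ (t - 1)"
  have n1: "n \<ge> 1" using assms by (metis One_nat_def Suc_leI le_trans less_le_trans pos2 zero_less_power)
  have W: "W \<ge> 1" using assms by (simp add: W_def)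
  have "(\<Prod>j<t. 1 + real j / real n) \<le> 1 + 4/5 * real t * (W / real n) ^ 2"
  \<comment> \<open>For t = 4 and d = 2 the estimate through the exponential function is too coarse,
    so the product is multiplied out.\<close>
  proof (cases "t = 4")
    case True
    have "n + 1 \<le> d ^ 5" using assms True by simp
    then have nd: "real n + 1 \<le> real d ^ 5" by (metis of_nat_1 of_nat_add of_nat_le_iff of_nat_power)
    have n16: "real n \<ge> 16"
    proof -
      have "(2::nat) ^ 4 \<le> d ^ 4" using assms by (intro power_mono) auto
      then show ?thesis using assms True by simp
    qed
    have "real d ^ 6 = real d * real d ^ 5" by (simp add: eval_nat_numeral)
    moreover have "2 * real d ^ 5 \<le> real d * real d ^ 5" using assms by (intro mult_right_mono) auto
    ultimately have "real d ^ 6 \<ge> 2 * real d ^ 5" by simp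
    moreover have "real d ^ 5 \<ge> 32"
    proof -
      have "(2::real) ^ 5 \<le> real d ^ 5" using assms by (intro power_mono) auto
      then show ?thesis by simp
    qed
    ultimately have key: "16/5 * real d ^ 6 \<ge> 6 * real n + 12" using nd by linarith
    have "6 / real n \<le> 1" using n16 by (simp add: field_simps)
    with key have "16/5 * W ^ 2 \<ge> 6 * real n + 11 + 6 / real n"
      unfolding W_def True by (simp flip: power_mult)
    then have "(6 * real n + 11 + 6 / real n) / real n ^ 2 \<le> 16/5 * W ^ 2 / real n ^ 2"
      by (intro divide_right_mono) auto
    moreover have "(\<Prod>j<4. 1 + real j / real n) = 1 + (6 * real n + 11 + 6 / real n) / real n ^ 2"
      using n1 by (simp add: eval_nat_numeral lessThan_Suc algebra_simps add_divide_distrib)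
    ultimately show ?thesis unfolding True by (simp add: power_divide)
  next
    case False
    then have t5: "t \<ge> 5" using assms by simp
    have "3 * (t * (t - 1)) \<le> 2 * 2 ^ t"
      using t5
    proof (induction t rule: dec_induct)
      case (step k)
      have "3 * (Suc k * k) \<le> 2 * (3 * (k * (k - 1)))"
      proof -
        have "5 \<le> k" using step by simp
        then obtain l where "k = 5 + l" using le_Suc_ex by blast
        then show ?thesis by (simp add: algebra_simps)
      qed
      with step.IH show ?case by simp
    qed simp
    moreover have "2 ^ t \<le> d ^ t" using assms by (intro power_mono) auto
    ultimately have "3 * (t * (t - 1)) \<le> 2 * n" using assms(3) by linarith
    from prod_one_plus_le[OF n1 this]
    have "(\<Prod>j<t. 1 + real j / real n) \<le> 1 + 4/3 * (real t * real (t - 1) / (2 * real n))" .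
    also have "\<dots> \<le> 1 + 4/5 * real t * (W / real n) ^ 2"
    proof -
      have "5 * (t - 1) \<le> 6 * 2 ^ (t - 3)"
        using t5
      proof (induction t rule: dec_induct)
        case (step k)
        then have "Suc k - 3 = Suc (k - 3)" "Suc k - 1 = Suc (k - 1)" by auto
        moreover have "k - 1 \<ge> 4" using step by simp
        ultimately show ?case using step.IH by simp
      qed simp
      also have "\<dots> \<le> 6 * d ^ (t - 3)" using assms by (intro mult_le_mono2 power_mono) auto
      finally have "5 * (t - 1) * d ^ (t + 1) \<le> 6 * d ^ (t - 3) * d ^ (t + 1)" by (rule mult_le_mono1)
      also have "\<dots> = 6 * (d ^ (t - 1)) ^ 2"
      proof -
        have "t - 3 + (t + 1) = (t - 1) * 2" using t5 by simp
        then show ?thesis by (metis mult.assoc power_add power_mult)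
      qed
      finally have "5 * (t - 1) * n \<le> 6 * (d ^ (t - 1)) ^ 2"
        using assms(4) by (meson le_trans less_imp_le mult_le_mono2)
      then have "real (5 * (t - 1) * n) \<le> real (6 * (d ^ (t - 1)) ^ 2)" by (rule of_nat_mono)
      then have "5 * real (t - 1) * real n \<le> 6 * W ^ 2" by (simp add: W_def)
      then have "real t / (30 * real n ^ 2) * (5 * real (t - 1) * real n * 4) \<le> real t / (30 * real n ^ 2) * (6 * W ^ 2 * 4)"
        by (intro mult_left_mono mult_right_mono) simp_all
      moreover have "real t / (30 * real n ^ 2) * (5 * real (t - 1) * real n * 4) = 4/3 * (real t * real (t - 1) / (2 * real n))"
        using n1 by (simp add: power2_eq_square)
      moreover have "real t / (30 * real n ^ 2) * (6 * W ^ 2 * 4) = 4/5 * real t * (W / real n) ^ 2"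
        using n1 by (simp add: power_divide)
      ultimately show ?thesis by linarith
    qed
    finally show ?thesis .
  qed
  moreover have "vol d t * real n ^ t \<ge> 0" using vol_pos[of d t] assms by simp
  ultimately have "order_bound n t d \<le> vol d t * real n ^ t * (1 + 4/5 * real t * (W / real n) ^ 2)"
    unfolding order_bound_eq'[OF n1] by (rule mult_left_mono)
  also have "\<dots> \<le> real (ball_count d (t - 1) n)"
  proof -
    obtain T where T: "t = Suc (Suc T)" "T \<ge> 2" using assms(2)
      by (metis add_2_eq_Suc le_add_diff_inverse add_le_cancel_left numeral_Bit0 le_trans nat_le_linear one_add_one add_leD1 numeral_le_iff semiring_norm(71) semiring_norm(76))
    have "2 * d ^ Suc T \<le> d * d ^ Suc T" using assms(1) by (intro mult_le_mono1)
    also have "\<dots> \<le> n" using assms(3) T by simp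
    finally show ?thesis using ball_count_gain[of d T n] T assms(1) by (simp add: W_def)
  qed
  finally show ?thesis .
qed

text \<open>In units of \<open>vol d 3\<close>, the bound exceeds n^3 by 3 n^2 + 2 n, while three
  coordinates gain 2 d^4 n - (2/5) d^6. This settles n up to about (2/3) d^4. For larger n a fourth
  coordinate contributes at least 2 (n - 2 d^3)^3.\<close>

lemma order_bound_3:
  assumes "d \<ge> 4" "d ^ 3 \<le> n" "n < d ^ 4"
  shows "order_bound n 3 d \<le> real (ball_count d 2 n) \<or> order_bound n 3 d \<le> real (ball_count d 3 n)"
proof -
  have n1: "n \<ge> 1" using assms by (metis One_nat_def Suc_leI le_trans less_le_trans zero_less_numeral zero_less_power)
  define x where "x = real n"
  define y where "y = real d"
  have y: "y \<ge> 4" and x: "y ^ 3 \<le> x" "x < y ^ 4" "x \<ge> 1"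
    using assms n1 by (simp_all add: x_def y_def flip: of_nat_power)
  have bound: "order_bound n 3 d = vol d 3 * (x ^ 3 + 3 * x ^ 2 + 2 * x)"
    unfolding order_bound_eq[OF n1] by (simp add: eval_nat_numeral lessThan_Suc x_def algebra_simps)
  have vol: "vol d 3 > 0" using assms by (intro vol_pos) simp
  show ?thesis
  proof (cases "3 * x + 2 + y ^ 2 \<le> 2 * y ^ 4")
    case True
    have "2/5 * y ^ 6 \<le> (2 * y ^ 4 - 3 * x - 2) * x"
    proof (cases "5 * x \<ge> 2 * y ^ 4")
      case True
      have "2/5 * y ^ 6 = y ^ 2 * (2/5 * y ^ 4)" by (simp add: eval_nat_numeral)
      also have "\<dots> \<le> y ^ 2 * x" using True by (intro mult_left_mono) auto
      also have "\<dots> \<le> (2 * y ^ 4 - 3 * x - 2) * x" using \<open>3 * x + 2 + y ^ 2 \<le> 2 * y ^ 4\<close> x by (intro mult_right_mono) auto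
      finally show ?thesis .
    next
      case False
      have "y ^ 4 \<ge> 4 * y ^ 3" using y by (simp add: eval_nat_numeral mult_right_mono)
      moreover have "y ^ 3 \<ge> 64" using power_mono[of 4 y 3] y by simp
      ultimately have "2/5 * y ^ 3 \<le> 2 * y ^ 4 - 3 * x - 2" using False by linarith
      moreover from this have "0 \<le> 2 * y ^ 4 - 3 * x - 2" using \<open>y ^ 3 \<ge> 64\<close> by linarith
      ultimately have "2/5 * y ^ 3 * y ^ 3 \<le> (2 * y ^ 4 - 3 * x - 2) * x" using x(1) y by (intro mult_mono) auto
      then show ?thesis by (simp add: eval_nat_numeral)
    qed
    then have "x ^ 3 + 3 * x ^ 2 + 2 * x \<le> x ^ 3 + 2 * y ^ 4 * x - 2/5 * y ^ 6"
      by (simp add: algebra_simps power2_eq_square)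
    then have "order_bound n 3 d \<le> vol d 3 * (x ^ 3 + 2 * y ^ 4 * x - 2/5 * y ^ 6)"
      unfolding bound using vol by (intro mult_left_mono) auto
    also have "\<dots> \<le> real (ball_count d 2 n)"
      using ball_count_2_gain[of d n] assms n1 unfolding x_def y_def by simp
    finally show ?thesis ..
  next
    case False
    define v where "v = x - 2 * y ^ 3"
    have y3: "y ^ 3 \<ge> 64" using power_mono[of 4 y 3] y by simp
    have y4: "y ^ 4 = y * y ^ 3" by (simp add: eval_nat_numeral)
    have y2: "y ^ 3 = y * y ^ 2" by (simp add: eval_nat_numeral)
    \<comment> \<open>For d \<ge> 5 one has n \<ge> 3 d^3 and thus v \<ge> n/3. For d = 4 only n
      \<ge> 165 is available, and the inequality is checked from there.\<close>
    have key: "3 * x ^ 2 + 2 * x \<le> 2 * v ^ 3 \<and> v > 0"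
    proof (cases "d = 4")
      case True
      then have "x \<ge> 165" using False unfolding y_def x_def by simp
      moreover have "v = x - 128" by (simp add: v_def y_def True)
      ultimately have v: "v \<ge> 37" "x = v + 128" by auto
      have "3 * x ^ 2 + 2 * x = 3 * v ^ 2 + 770 * v + 49408" unfolding v(2) by (simp add: power2_eq_square algebra_simps)
      also have "\<dots> \<le> 2 * v ^ 3"
      proof -
        have "v ^ 2 \<ge> 37 * v" using v(1) by (simp add: power2_eq_square)
        moreover have "v ^ 3 \<ge> 37 * v ^ 2" using v(1) by (simp add: power2_eq_square power3_eq_cube mult_right_mono)
        ultimately show ?thesis using v(1) by linarith
      qed
      finally show ?thesis using v by simp
    next
      case False
      then have y5: "y \<ge> 5" using assms by (simp add: y_def)
      have "y * y ^ 3 \<ge> 5 * y ^ 3" "y * y ^ 2 \<ge> 5 * y ^ 2" using y5 by (auto intro!: mult_right_mono)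
      moreover have "y ^ 2 \<ge> 25" using power_mono[of 5 y 2] y5 by simp
      ultimately have "3 * y ^ 3 \<le> x" using \<open>\<not> 3 * x + 2 + y ^ 2 \<le> 2 * y ^ 4\<close> unfolding y4 y2 by linarith
      then have v: "v \<ge> x / 3" by (simp add: v_def)
      have x45: "x \<ge> 45" using \<open>3 * y ^ 3 \<le> x\<close> y3 by linarith
      have "27 * (3 * x ^ 2 + 2 * x) \<le> 2 * x ^ 3"
      proof -
        have "x ^ 2 \<ge> 45 * x" "x ^ 3 \<ge> 45 * x ^ 2" using x45 by (simp_all add: power2_eq_square power3_eq_cube mult_right_mono)
        then have "81 * x ^ 2 + 54 * x \<le> 2 * x ^ 3" using x45 by linarith
        then show ?thesis by (simp add: distrib_left)
      qed
      also have "2 * x ^ 3 = 54 * (x / 3) ^ 3" by (simp add: power_divide)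
      also have "\<dots> \<le> 54 * v ^ 3" using v x45 by (intro mult_left_mono power_mono) auto
      finally show ?thesis using v x45 by simp
    qed
    then have "real (2 * d ^ 3) < real n" unfolding v_def x_def y_def by simp
    then have lt: "2 * d ^ Suc 2 < n" by (simp only: of_nat_less_iff) simp
    have sub: "real (n - 2 * d ^ Suc 2) = v" using lt by (simp add: of_nat_diff v_def x_def y_def)
    have "order_bound n 3 d \<le> vol d 3 * (x ^ 3 + 2 * v ^ 3)"
      unfolding bound using vol key by (intro mult_left_mono) auto
    also have "\<dots> = vol d (Suc 2) * real n ^ Suc 2 + 2 * (vol d (Suc 2) * real (n - 2 * d ^ Suc 2) ^ Suc 2)"
      unfolding sub by (simp add: x_def algebra_simps)
    also have "\<dots> \<le> real (ball_count d 2 n + 2 * ball_count d 2 (n - 2 * d ^ Suc 2))"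
      using ball_count_ge_vol[of d 2 n] ball_count_ge_vol[of d 2 "n - 2 * d ^ Suc 2"] assms by simp
    also have "\<dots> \<le> real (ball_count d (Suc 2) n)"
      using ball_count_Suc_ge2[OF _ lt] assms by (intro of_nat_mono) simp
    finally show ?thesis by simp
  qed
qed

text \<open>In units of \<open>vol d 2\<close>, the bound exceeds n^2 by n, and the third coordinate
  adds at least 2 (n - 2 d^2)^2. For this to cover n, the distance of n from 2 d^2 must be about
  d.\<close>

lemma order_bound_2:
  assumes "d \<ge> 2" "2 * d ^ 2 + d + 2 \<le> n"
  shows "order_bound n 2 d \<le> real (ball_count d 2 n)"
proof -
  have n1: "n \<ge> 1" using assms by simp
  define x where "x = real n"
  define v where "v = real n - 2 * real d ^ 2"
  have "real (2 * d ^ 2 + d + 2) \<le> real n" using assms by (simp only: of_nat_le_iff)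
  then have v: "v \<ge> real d + 2" by (simp add: v_def)
  have lt: "2 * d ^ Suc 1 < n" using assms by (simp add: power2_eq_square)
  have sub: "real (n - 2 * d ^ Suc 1) = v" using lt by (simp add: of_nat_diff v_def power2_eq_square)
  have key: "x \<le> 2 * v ^ 2"
  proof -
    have "(real d + 2) * (2 * real d + 3) \<le> v * (2 * v - 1)"
      using v by (intro mult_mono) auto
    moreover have "x = v + 2 * (real d * real d)" by (simp add: x_def v_def power2_eq_square)
    moreover have "(real d + 2) * (2 * real d + 3) = 2 * (real d * real d) + 7 * real d + 6"
      "v * (2 * v - 1) = 2 * (v * v) - v" by (simp_all add: algebra_simps)
    moreover have "real d \<ge> 0" by simp
    ultimately show ?thesis unfolding power2_eq_square by linarith
  qed
  have "order_bound n 2 d = vol d 2 * (x ^ 2 + x)"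
    unfolding order_bound_eq[OF n1] by (simp add: eval_nat_numeral lessThan_Suc x_def algebra_simps)
  also have "\<dots> \<le> vol d 2 * (x ^ 2 + 2 * v ^ 2)"
    using key vol_pos[of d 2] assms by (intro mult_left_mono) auto
  also have "\<dots> = vol d (Suc 1) * real n ^ Suc 1 + 2 * (vol d (Suc 1) * real (n - 2 * d ^ Suc 1) ^ Suc 1)"
    unfolding sub by (simp add: x_def algebra_simps eval_nat_numeral)
  also have "\<dots> \<le> real (ball_count d 1 n + 2 * ball_count d 1 (n - 2 * d ^ Suc 1))"
    using ball_count_ge_vol[of d 1 n] ball_count_ge_vol[of d 1 "n - 2 * d ^ Suc 1"] assms by simp
  also have "\<dots> \<le> real (ball_count d (Suc 1) n)"
    using ball_count_Suc_ge2[OF _ lt] assms by (intro of_nat_mono) simp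
  finally show ?thesis by (simp add: numeral_2_eq_2)
qed

lemma lattice_min_mono:
  assumes "lattice_min D m r n T" "T' \<le> T" shows "lattice_min D m r n T'"
  unfolding lattice_min_def
proof (intro allI impI)
  fix k :: "nat \<Rightarrow> int" and j
  assume k: "(\<Sum>j<T'. \<bar>k j\<bar> * int D ^ j) < int n" "int r dvd (\<Sum>j<T'. k j * int m ^ j)" and j: "j < T'"
  define k' where "k' = (\<lambda>j. if j < T' then k j else 0)"
  have "(\<Sum>j<T. \<bar>k' j\<bar> * int D ^ j) = (\<Sum>j<T'. \<bar>k j\<bar> * int D ^ j)"
    "(\<Sum>j<T. k' j * int m ^ j) = (\<Sum>j<T'. k j * int m ^ j)"
    by (rule sum.mono_neutral_cong_right; use assms(2) in \<open>auto simp: k'_def\<close>)+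
  then have "k' j = 0" using assms k j unfolding lattice_min_def by auto
  then show "k j = 0" using j by (simp add: k'_def)
qed

section \<open>Finite verification for t = 2 and t = 3\<close>

definition short_vec :: "int \<Rightarrow> int \<Rightarrow> int \<Rightarrow> int \<Rightarrow> int \<Rightarrow> int \<Rightarrow> bool" where
  "short_vec d n m r b c \<longleftrightarrow>
     (b \<noteq> 0 \<or> c \<noteq> 0) \<and> (let v = (m * b + m * m * c) mod r in min v (r - v) + d * \<bar>b\<bar> + d * d * \<bar>c\<bar> < n)"

lemma lattice_min_no_short_vec:
  assumes "lattice_min d m r n 3" "r > 0"
  shows "\<not> short_vec (int d) (int n) (int m) (int r) b c"
proof
  assume sv: "short_vec (int d) (int n) (int m) (int r) b c"
  define v where "v = (int m * b + int m * int m * c) mod int r"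
  define a where "a = (if v \<le> int r - v then - v else int r - v)"
  define k where "k = (\<lambda>j::nat. if j = 0 then a else if j = 1 then b else c)"
  have v: "0 \<le> v" "v < int r" using assms(2) by (simp_all add: v_def)
  have 3: "(\<Sum>j<3. f j) = f 0 + f 1 + f 2" for f :: "nat \<Rightarrow> int"
    by (simp add: eval_nat_numeral)
  have "(\<Sum>j<3. \<bar>k j\<bar> * int d ^ j) < int n"
    using sv v unfolding 3 k_def short_vec_def v_def[symmetric] Let_def
    by (auto simp: a_def min_def power2_eq_square algebra_simps split: if_splits)
  moreover have "int r dvd (\<Sum>j<3. k j * int m ^ j)"
  proof -
    have "int r dvd (int m * b + int m * int m * c) - v" by (simp add: v_def)
    then have "int r dvd a + (int m * b + int m * int m * c)"
      by (auto simp: a_def algebra_simps)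
    then show ?thesis unfolding 3 by (simp add: k_def power2_eq_square algebra_simps)
  qed
  ultimately have "\<forall>j<3. k j = 0" using assms(1) unfolding lattice_min_def by blast
  then have "k 1 = 0" "k 2 = 0" by auto
  then show False using sv by (simp add: k_def short_vec_def)
qed

text \<open>Once the other coordinate b is fixed, the best choice in the coordinate of weight 1 is
  the residue of least absolute value, so b alone is searched, and only up to sign. A vector with b
  = 0 would be a nonzero multiple of r below n, which r > n rules out.\<close>

definition short_vec_2 :: "int \<Rightarrow> int \<Rightarrow> int \<Rightarrow> int \<Rightarrow> int \<Rightarrow> bool" where
  "short_vec_2 d n m r b \<longleftrightarrow> b > 0 \<and> (let v = (m * b) mod r in min v (r - v) + d * b < n)"

lemma lattice_min_no_short_vec_2:
  assumes "lattice_min d m r n 2" "r > 0"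
  shows "\<not> short_vec_2 (int d) (int n) (int m) (int r) b"
proof
  assume sv: "short_vec_2 (int d) (int n) (int m) (int r) b"
  define v where "v = (int m * b) mod int r"
  define a where "a = (if v \<le> int r - v then - v else int r - v)"
  define k where "k = (\<lambda>j::nat. if j = 0 then a else b)"
  have v: "0 \<le> v" "v < int r" using assms(2) by (simp_all add: v_def)
  have 2: "(\<Sum>j<2. f j) = f 0 + f 1" for f :: "nat \<Rightarrow> int"
    by (simp add: eval_nat_numeral)
  have "(\<Sum>j<2. \<bar>k j\<bar> * int d ^ j) < int n"
    using sv v unfolding 2 k_def short_vec_2_def v_def[symmetric] Let_def
    by (auto simp: a_def min_def algebra_simps split: if_splits)
  moreover have "int r dvd (\<Sum>j<2. k j * int m ^ j)"
  proof -
    have "int r dvd int m * b - v" by (simp add: v_def)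
    then have "int r dvd a + int m * b"
      by (auto simp: a_def algebra_simps)
    then show ?thesis unfolding 2 by (simp add: k_def algebra_simps)
  qed
  ultimately have "\<forall>j<2. k j = 0" using assms(1) unfolding lattice_min_def by blast
  then have "k 1 = 0" by auto
  then show False using sv by (simp add: k_def short_vec_2_def)
qed

text \<open>A candidate order r is ruled out by a vector that the lattice must not contain, or
  because the order divides q^n - 1.\<close>

definition excluded_2 :: "int \<Rightarrow> int \<Rightarrow> int \<Rightarrow> int \<Rightarrow> int \<Rightarrow> bool" where
  "excluded_2 d n q m r \<longleftrightarrow> list_ex (short_vec_2 d n m r) [1..(n - 1) div d] \<or> q ^ nat n mod r \<noteq> 1"

definition excluded_3 :: "int \<Rightarrow> int \<Rightarrow> int \<Rightarrow> int \<Rightarrow> int \<Rightarrow> bool" where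
  "excluded_3 d n q m r \<longleftrightarrow> list_ex (\<lambda>c. list_ex (\<lambda>b. short_vec d n m r b c)
     [- ((n - 1) div d)..(n - 1) div d]) [0..(n - 1) div (d * d)] \<or> q ^ nat n mod r \<noteq> 1"

text \<open>The values of r are those between the lower limits n + 1 and n^2/(2d), the latter being
  the volume of the ball, and the bound n (n + 1)/(2d). The arguments d and d' are meant to be one
  number, as exponent and as integer, and q runs through all integers, not only prime
  powers.\<close>

definition check_2 :: "nat \<Rightarrow> int \<Rightarrow> int \<Rightarrow> bool" where
  "check_2 d d' Q \<longleftrightarrow> list_all (\<lambda>n. n \<ge> d' ^ 3 \<or>
     list_all (\<lambda>q. q ^ (d - 1) \<ge> n * n \<or> n * n > q ^ d \<or>
       list_all (\<lambda>r. excluded_2 d' n q (q ^ ((d + 1) div 2)) r)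
         [max (n + 1) ((n * n + 2 * d' - 1) div (2 * d'))..(n * (n + 1) - 1) div (2 * d')])
       [2..Q]) [d' * d'..2 * d' * d' + d' + 1]"

text \<open>In an entry (d, d, Q), Q bounds the q with q^(d - 1) < n^2 for all n checked.\<close>
definition q_bounds :: "(nat \<times> int \<times> int) list" where
  "q_bounds = [(2, 2, 49), (3, 3, 21), (4, 4, 11), (5, 5, 7), (6, 6, 5), (7, 7, 4), (8, 8, 4), (9, 9, 3),
     (10, 10, 3), (11, 11, 3), (12, 12, 2), (13, 13, 2), (14, 14, 2), (15, 15, 2), (16, 16, 2), (17, 17, 2),
     (18, 18, 2), (19, 19, 2), (20, 20, 2)]"

lemma q_bounds_mem: "2 \<le> d \<Longrightarrow> d \<le> 20 \<Longrightarrow> \<exists>Q. (d, int d, Q) \<in> set q_bounds"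
  unfolding q_bounds_def by (simp, presburger)

text \<open>For d = 2 the condition n < d^3 leaves n \<le> 7, hence 49; for the other d, n is at
  most 2 d^2 + d + 1.\<close>

lemma q_bounds_sufficient:
  "list_all (\<lambda>(d, d', Q). (Q + 1) ^ (d - 1) \<ge> (if d = 2 then 49 else (2 * d' * d' + d' + 1) ^ 2)) q_bounds"
  by code_simp


lemma check_2_all: "list_all (\<lambda>(d, d', Q). check_2 d d' Q) q_bounds"
  by code_simp

lemma not_excluded_2:
  assumes "lattice_min d m r n 2" "r > 0" "q ^ n mod r = 1"
  shows "\<not> excluded_2 (int d) (int n) (int q) (int m) (int r)"
proof -
  have "int q ^ n mod int r = 1" using assms(3) by (metis of_nat_1 of_nat_mod of_nat_power)
  then show ?thesis
    using lattice_min_no_short_vec_2[OF assms(1,2)] by (auto simp: excluded_2_def list_ex_iff)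
qed

lemma not_excluded_3:
  assumes "lattice_min d m r n 3" "r > 0" "q ^ n mod r = 1"
  shows "\<not> excluded_3 (int d) (int n) (int q) (int m) (int r)"
proof -
  have "int q ^ n mod int r = 1" using assms(3) by (metis of_nat_1 of_nat_mod of_nat_power)
  then show ?thesis
    using lattice_min_no_short_vec[OF assms(1,2)] by (auto simp: excluded_3_def list_ex_iff)
qed

lemma order_bound_2_eq:
  assumes "n \<ge> 1" "d \<ge> 1"
  shows "order_bound n 2 d \<le> real r \<longleftrightarrow> n * (n + 1) \<le> 2 * d * r"
proof -
  have "order_bound n 2 d = real (n * (n + 1)) / real (2 * d)"
    unfolding order_bound_eq[OF assms(1)] vol_def by (simp add: eval_nat_numeral lessThan_Suc algebra_simps)
  also have "\<dots> \<le> real r \<longleftrightarrow> real (n * (n + 1)) \<le> real (2 * d * r)"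
    using assms(2) by (simp add: field_simps)
  finally show ?thesis by (simp only: of_nat_le_iff)
qed

lemma order_bound_2_small:
  assumes d: "2 \<le> d" "d \<le> 20" and n: "d ^ 2 \<le> n" "n < d ^ 3" "n \<le> 2 * d ^ 2 + d + 1"
    and q: "2 \<le> q" "q ^ (d - 1) < n ^ 2" "n ^ 2 \<le> q ^ d" and m: "m = q ^ ((d + 1) div 2)"
    and r: "lattice_min d m r n 2" "r \<ge> n + 1" "q ^ n mod r = 1"
  shows "order_bound n 2 d \<le> real r"
proof (rule ccontr)
  assume "\<not> ?thesis"
  moreover have n1: "n \<ge> 1" using n d by (metis One_nat_def Suc_leI le_trans less_le_trans pos2 zero_less_power)
  ultimately have hi: "2 * d * r < n * (n + 1)" using order_bound_2_eq[of n d r] d by simp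
  have "ball_count d 1 n \<le> r" using ball_count_le[of d m r n 1] r n1 d by (simp add: numeral_2_eq_2)
  moreover have "vol d 2 * real n ^ 2 \<le> real (ball_count d 1 n)"
    using ball_count_ge_vol[of d 1 n] d by (simp only: numeral_2_eq_2 One_nat_def)
  ultimately have "vol d 2 * real n ^ 2 \<le> real r" by linarith
  then have "real (n * n) \<le> real (2 * d * r)"
    using d by (simp add: vol_def eval_nat_numeral lessThan_Suc field_simps)
  then have lo: "n * n \<le> 2 * d * r" by (simp only: of_nat_le_iff)
  obtain Q where Q: "(d, int d, Q) \<in> set q_bounds" using q_bounds_mem d by blast
  have ck: "check_2 d (int d) Q" using check_2_all Q by (auto simp: list_all_iff)
  have qQ: "int q \<le> Q"
  proof (rule ccontr)
    assume "\<not> int q \<le> Q"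
    moreover have "0 \<le> Q" using Q by (auto simp: q_bounds_def)
    ultimately have "(Q + 1) ^ (d - 1) \<le> int q ^ (d - 1)" by (intro power_mono) auto
    also have "\<dots> < int n ^ 2" using q(2) by (metis of_nat_less_iff of_nat_power)
    finally have lt: "(Q + 1) ^ (d - 1) < int n ^ 2" .
    have suff: "(if d = 2 then 49 else (2 * int d * int d + int d + 1) ^ 2) \<le> (Q + 1) ^ (d - 1)"
      using q_bounds_sufficient Q by (auto simp: list_all_iff)
    show False
    proof (cases "d = 2")
      case True
      then have "int n \<le> 7" using n by simp
      then have "int n ^ 2 \<le> 7 ^ 2" by (intro power_mono) auto
      with lt suff True show False by simp
    next
      case False
      have "int n \<le> int (2 * d ^ 2 + d + 1)" using n(3) by (simp only: of_nat_le_iff)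
      then have "int n ^ 2 \<le> (2 * int d * int d + int d + 1) ^ 2"
        by (intro power_mono) (simp_all add: power2_eq_square)
      with lt suff False show False by simp
    qed
  qed
  have "int n \<in> set [int d * int d..2 * int d * int d + int d + 1]"
  proof -
    have "int (d ^ 2) \<le> int n" "int n \<le> int (2 * d ^ 2 + d + 1)" using n by (simp_all only: of_nat_le_iff)
    then show ?thesis by (simp add: power2_eq_square)
  qed
  moreover have "\<not> int n \<ge> int d ^ 3" using n(2) by (metis of_nat_le_iff of_nat_power linorder_not_le)
  ultimately have ck1: "list_all (\<lambda>q. q ^ (d - 1) \<ge> int n * int n \<or> int n * int n > q ^ d \<or>
       list_all (\<lambda>r. excluded_2 (int d) (int n) q (q ^ ((d + 1) div 2)) r)
         [max (int n + 1) ((int n * int n + 2 * int d - 1) div (2 * int d))..(int n * (int n + 1) - 1) div (2 * int d)]) [2..Q]"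
    using ck unfolding check_2_def list_all_iff by blast
  have "int q \<in> set [2..Q]" using q qQ by simp
  moreover have "\<not> int q ^ (d - 1) \<ge> int n * int n"
    using q(2) by (metis of_nat_less_iff of_nat_mult of_nat_power linorder_not_le power2_eq_square)
  moreover have "\<not> int n * int n > int q ^ d"
    using q(3) by (metis of_nat_less_iff of_nat_mult of_nat_power linorder_not_le power2_eq_square)
  ultimately have ck2: "list_all (\<lambda>r. excluded_2 (int d) (int n) (int q) (int q ^ ((d + 1) div 2)) r)
         [max (int n + 1) ((int n * int n + 2 * int d - 1) div (2 * int d))..(int n * (int n + 1) - 1) div (2 * int d)]"
    using ck1 unfolding list_all_iff by blast
  have "int r \<in> set [max (int n + 1) ((int n * int n + 2 * int d - 1) div (2 * int d))..(int n * (int n + 1) - 1) div (2 * int d)]"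
  proof -
    have lo': "int n * int n \<le> 2 * int d * int r" using lo by (metis of_nat_le_iff of_nat_mult of_nat_numeral)
    have hi': "2 * int d * int r < int n * (int n + 1)" using hi
      by (metis of_nat_1 of_nat_add of_nat_less_iff of_nat_mult of_nat_numeral)
    have "(int n * int n + 2 * int d - 1) div (2 * int d) \<le> (2 * int d - 1 + int r * (2 * int d)) div (2 * int d)"
      using lo' d by (intro zdiv_mono1) (auto simp: mult.commute)
    also have "\<dots> = int r" using d by simp
    finally have "(int n * int n + 2 * int d - 1) div (2 * int d) \<le> int r" .
    moreover have "int r \<le> (int n * (int n + 1) - 1) div (2 * int d)"
    proof -
      have "int r = (2 * int d * int r) div (2 * int d)" using d by simp
      also have "\<dots> \<le> (int n * (int n + 1) - 1) div (2 * int d)" using hi' d by (intro zdiv_mono1) auto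
      finally show ?thesis .
    qed
    moreover have "int n + 1 \<le> int r" using r(2) by simp
    ultimately show ?thesis by simp
  qed
  then have "excluded_2 (int d) (int n) (int q) (int m) (int r)"
    using ck2 unfolding list_all_iff m by simp
  moreover have "r > 0" using r by simp
  ultimately show False using not_excluded_2[OF r(1) _ r(3)] by blast
qed

text \<open>A copy of \<open>ball_count\<close> for evaluation, in which the sum stops at the last
  nonempty layer.\<close>

primrec ball_count_int :: "int \<Rightarrow> nat \<Rightarrow> int \<Rightarrow> int" where
  "ball_count_int D 0 y = y"
| "ball_count_int D (Suc T) y = ball_count_int D T y +
     2 * sum_list (map (\<lambda>j. ball_count_int D T (y - 2 * D ^ Suc T * j)) [1..(y - 1) div (2 * D ^ Suc T)])"

lemma ball_count_int_eq:
  assumes "D \<ge> 1"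
  shows "int (ball_count D T y) = ball_count_int (int D) T (int y)"
proof (induction T arbitrary: y)
  case (Suc T)
  define w where "w = 2 * D ^ Suc T"
  have w: "w \<ge> 1" using assms by (simp add: w_def Suc_le_eq)
  define K where "K = (int y - 1) div int w"
  have K: "K * int w \<le> int y - 1" "int y - 1 < (K + 1) * int w"
    using w div_mult_mod_eq[of "int y - 1" "int w"] pos_mod_bound[of "int w" "int y - 1"] pos_mod_sign[of "int w" "int y - 1"]
    unfolding K_def distrib_right by linarith+
  have lt: "w * j < y" if "int j \<le> K" for j
  proof -
    have "int j * int w \<le> K * int w" using that by (intro mult_right_mono) auto
    with K(1) have "int (w * j) < int y" by (simp add: mult.commute)
    then show ?thesis by (simp only: of_nat_less_iff)
  qed
  have ge: "y \<le> w * j" if "\<not> int j \<le> K" for j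
  proof -
    have "(K + 1) * int w \<le> int j * int w" using that by (intro mult_right_mono) auto
    with K(2) have "int y \<le> int (w * j)" by (simp add: mult.commute)
    then show ?thesis by (simp only: of_nat_le_iff)
  qed
  have "(\<Sum>j=1..y. ball_count D T (y - w * j)) = (\<Sum>j=1..nat K. ball_count D T (y - w * j))"
  proof (rule sum.mono_neutral_right)
    show "{1..nat K} \<subseteq> {1..y}"
    proof
      fix j assume j: "j \<in> {1..nat K}"
      then have "int j \<le> K" by auto
      from lt[OF this] have "1 * j < y" using w by (meson le_less_trans mult_le_mono1)
      with j show "j \<in> {1..y}" by simp
    qed
    show "\<forall>j\<in>{1..y} - {1..nat K}. ball_count D T (y - w * j) = 0"
    proof
      fix j assume "j \<in> {1..y} - {1..nat K}"
      then have "\<not> int j \<le> K" by auto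
      from ge[OF this] show "ball_count D T (y - w * j) = 0" by simp
    qed
  qed simp
  then have "int (\<Sum>j=1..y. ball_count D T (y - w * j)) = (\<Sum>j=1..nat K. ball_count_int (int D) T (int (y - w * j)))"
    by (simp add: Suc)
  also have "\<dots> = (\<Sum>j\<in>{1..K}. ball_count_int (int D) T (int y - int w * j))"
  proof (rule sum.reindex_bij_witness[of _ nat int])
    fix j assume "j \<in> {1..nat K}"
    then have "int j \<le> K" by auto
    from lt[OF this] show "ball_count_int (int D) T (int y - int w * int j) = ball_count_int (int D) T (int (y - w * j))"
      by (simp add: of_nat_diff)
  qed auto
  also have "\<dots> = sum_list (map (\<lambda>j. ball_count_int (int D) T (int y - int w * j)) [1..K])"
    by (simp add: interv_sum_list_conv_sum_set_int)
  finally show ?case using Suc[of y] by (simp add: w_def K_def)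
qed simp

lemma order_bound_3_eq:
  assumes "n \<ge> 1" "d \<ge> 1"
  shows "order_bound n 3 d \<le> real r \<longleftrightarrow> n * (n + 1) * (n + 2) \<le> 6 * d ^ 3 * r"
proof -
  have "order_bound n 3 d = real (n * (n + 1) * (n + 2)) / real (6 * d ^ 3)"
    unfolding order_bound_eq[OF assms(1)] vol_def
    using assms(2) by (simp add: eval_nat_numeral lessThan_Suc field_simps)
  also have "\<dots> \<le> real r \<longleftrightarrow> real (n * (n + 1) * (n + 2)) \<le> real (6 * d ^ 3 * r)"
    using assms(2) by (simp add: field_simps)
  finally show ?thesis by (simp only: of_nat_le_iff)
qed

definition check_3 :: "int \<Rightarrow> int \<Rightarrow> bool" where
  "check_3 d n \<longleftrightarrow> n * (n + 1) * (n + 2) \<le> 6 * d ^ 3 * ball_count_int d 3 n"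

lemma check_3_all:
  "list_all (check_3 2) [8, 9, 10, 11, 13, 14]" "list_all (\<lambda>n. n = 54 \<or> check_3 3 n) [27..80]"
  by code_simp+

text \<open>In the remaining cases the count of lattice points falls short of the bound by one or two.\<close>
lemma check_3_exceptions:
  "ball_count_int 2 3 12 \<ge> 44" "ball_count_int 2 3 15 \<ge> 83" "ball_count_int 3 3 54 \<ge> 1026"
  "list_all (\<lambda>q. excluded_3 2 12 q q 44 \<and> excluded_3 2 12 q q 45) [12..143]"
  "list_all (\<lambda>q. excluded_3 2 15 q q 83 \<and> excluded_3 2 15 q q 84) [15..224]"
  "list_all (\<lambda>q. excluded_3 3 54 q (q * q) 1026) [15..53]"
  by code_simp+

lemma order_bound_3_small:
  assumes d: "d = 2 \<or> d = 3" and n: "d ^ 3 \<le> n" "n < d ^ 4"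
    and q: "q ^ (d - 1) < n ^ 2" "n ^ 2 \<le> q ^ d" and m: "m = q ^ ((d + 1) div 2)"
    and r: "lattice_min d m r n 4" "r > 0" "q ^ n mod r = 1"
  shows "order_bound n 3 d \<le> real r"
proof -
  have n1: "n \<ge> 1" using n d by (metis One_nat_def Suc_leI le_trans less_le_trans pos2 zero_less_power zero_less_numeral)
  have d1: "d \<ge> 1" using d by auto
  have "lattice_min d m r n (Suc 3)" using r(1) by simp
  from ball_count_le[OF this d1 r(2) n1] have "int (ball_count d 3 n) \<le> int r" by simp
  then have le: "ball_count_int (int d) 3 (int n) \<le> int r" by (simp add: ball_count_int_eq[OF d1])
  have lm: "lattice_min d m r n 3" using lattice_min_mono[OF r(1)] by simp
  note ex = not_excluded_3[OF lm r(2,3)]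
  have goal: ?thesis if "check_3 (int d) (int n)"
  proof -
    have "int n * (int n + 1) * (int n + 2) \<le> 6 * int d ^ 3 * ball_count_int (int d) 3 (int n)"
      using that unfolding check_3_def .
    also have "\<dots> \<le> 6 * int d ^ 3 * int r" using le by (intro mult_left_mono) auto
    finally have "int (n * (n + 1) * (n + 2)) \<le> int (6 * d ^ 3 * r)"
      by (simp only: of_nat_mult of_nat_add of_nat_power of_nat_1 of_nat_numeral)
    then show ?thesis unfolding order_bound_3_eq[OF n1 d1] by (simp only: of_nat_le_iff)
  qed
  \<comment> \<open>In the exceptional cases the bound is 45.5, 85 and about 1026.7. Between the
    point count and the bound there remain r = 44, 45, then r = 83, 84, and then r = 1026. The
    ranges of q in the check come from q^(d-1) < n^2 \<le> q^d.\<close>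
  consider "d = 2" "n \<in> {8, 9, 10, 11, 13, 14}" | "d = 2" "n = 12" | "d = 2" "n = 15"
    | "d = 3" "n \<noteq> 54" | "d = 3" "n = 54"
    using d n by force
  then show ?thesis
  proof cases
    case 1
    then have "check_3 2 (int n)" using check_3_all(1) by auto
    then show ?thesis using goal 1 by simp
  next
    case 2
    then have "q \<in> {12..143}" using q power_mono_iff[of 12 q 2] by auto
    then have "int q \<in> set [12..143]" unfolding set_upto by simp
    with check_3_exceptions(4) have "excluded_3 2 12 (int q) (int q) 44" "excluded_3 2 12 (int q) (int q) 45"
      unfolding list_all_iff by blast+
    with ex 2 m have "int r \<noteq> 44" "int r \<noteq> 45" by auto
    moreover have "int r \<ge> 44" using le check_3_exceptions(1) 2 by simp
    ultimately show ?thesis unfolding order_bound_3_eq[OF n1 d1] by (simp add: 2)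
  next
    case 3
    then have "q \<in> {15..224}" using q power_mono_iff[of 15 q 2] by auto
    then have "int q \<in> set [15..224]" unfolding set_upto by simp
    with check_3_exceptions(5) have "excluded_3 2 15 (int q) (int q) 83" "excluded_3 2 15 (int q) (int q) 84"
      unfolding list_all_iff by blast+
    with ex 3 m have "int r \<noteq> 83" "int r \<noteq> 84" by auto
    moreover have "int r \<ge> 83" using le check_3_exceptions(2) 3 by simp
    ultimately show ?thesis unfolding order_bound_3_eq[OF n1 d1] by (simp add: 3)
  next
    case 4
    then have "int n \<in> set [27..80]" using n unfolding set_upto by simp
    then have "int n = 54 \<or> check_3 3 (int n)" using check_3_all(2) unfolding list_all_iff by blast
    then have "check_3 3 (int n)" using 4 by simp
    then show ?thesis using goal 4 by simp
  next
    case 5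
    have "15 \<le> q"
    proof (rule ccontr)
      assume "\<not> 15 \<le> q"
      then have "q ^ 3 \<le> 14 ^ 3" by (intro power_mono) auto
      then show False using q 5 by simp
    qed
    moreover have "q < 54"
    proof (rule ccontr)
      assume "\<not> q < 54"
      then have "54 ^ 2 \<le> q ^ 2" by (intro power_mono) auto
      then show False using q 5 by simp
    qed
    ultimately have "int q \<in> set [15..53]" unfolding set_upto by simp
    with check_3_exceptions(6) have "excluded_3 3 54 (int q) (int q * int q) 1026"
      unfolding list_all_iff by blast
    with ex 5 m have "int r \<noteq> 1026" by (auto simp: power2_eq_square)
    moreover have "int r \<ge> 1026" using le check_3_exceptions(3) 5 by simp
    ultimately show ?thesis unfolding order_bound_3_eq[OF n1 d1] by (simp add: 5)
  qed
qed

section \<open>Counting points in a simplex\<close>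

primrec simplex_count :: "nat \<Rightarrow> nat \<Rightarrow> nat \<Rightarrow> nat" where
  "simplex_count D 0 y = y"
| "simplex_count D (Suc T) y = (\<Sum>j\<le>y. simplex_count D T (y - D ^ Suc T * j))"

definition simplex :: "nat \<Rightarrow> nat \<Rightarrow> nat \<Rightarrow> (nat \<Rightarrow> nat) set" where
  "simplex D T y = {e. (\<forall>i>T. e i = 0) \<and> (\<Sum>i\<le>T. e i * D ^ i) < y}"

lemma simplex_count_0 [simp]: "simplex_count D T 0 = 0"
  by (induction T) auto

lemma card_simplex:
  assumes "D \<ge> 1"
  shows "finite (simplex D T y) \<and> card (simplex D T y) = simplex_count D T y"
proof (induction T arbitrary: y)
  case 0
  have "bij_betw (\<lambda>x i. if i = 0 then x else 0) {..<y} (simplex D 0 y)"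
    by (rule bij_betw_byWitness[where f' = "\<lambda>k. k 0"]) (auto simp: simplex_def fun_eq_iff)
  then have "finite (simplex D 0 y)" "card (simplex D 0 y) = card {..<y}"
    using bij_betw_finite bij_betw_same_card by (metis finite_lessThan)+
  then show ?case by simp
next
  case (Suc T)
  define W where "W = D ^ Suc T"
  have W: "W \<ge> 1" using assms by (simp add: W_def)
  let ?S = "\<lambda>j. simplex D T (y - W * j)"
  have sum_upd: "(\<Sum>i\<le>T. (e(Suc T := j)) i * D ^ i) = (\<Sum>i\<le>T. e i * D ^ i)" for e :: "nat \<Rightarrow> nat" and j
    by (intro sum.cong) auto
  have eq: "simplex D (Suc T) y = (\<Union>j\<in>{..y}. (\<lambda>e. e(Suc T := j)) ` ?S j)"
  proof (intro equalityI subsetI)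
    fix e assume "e \<in> simplex D (Suc T) y"
    then have e: "\<And>i. i > Suc T \<Longrightarrow> e i = 0" "(\<Sum>i\<le>T. e i * D ^ i) + e (Suc T) * W < y"
      by (auto simp: simplex_def W_def)
    have "e (Suc T) * 1 \<le> e (Suc T) * W" using W by (intro mult_le_mono2)
    then have "e (Suc T) \<le> e (Suc T) * W" by simp
    then have "e (Suc T) \<le> y" using e(2) by linarith
    then have "e (Suc T) \<in> {..y}" by simp
    moreover have "e(Suc T := 0) \<in> ?S (e (Suc T))"
      using e unfolding simplex_def sum_upd mem_Collect_eq by (auto simp: less_diff_conv mult.commute)
    moreover have "e = (e(Suc T := 0))(Suc T := e (Suc T))" by simp
    ultimately show "e \<in> (\<Union>j\<in>{..y}. (\<lambda>e. e(Suc T := j)) ` ?S j)" by blast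
  next
    fix e assume "e \<in> (\<Union>j\<in>{..y}. (\<lambda>e. e(Suc T := j)) ` ?S j)"
    then obtain j e' where e: "e = e'(Suc T := j)" and e': "e' \<in> ?S j" by auto
    have "(\<Sum>i\<le>Suc T. e i * D ^ i) = (\<Sum>i\<le>T. e' i * D ^ i) + W * j"
      unfolding e by (simp add: sum_upd W_def)
    moreover have "(\<Sum>i\<le>T. e' i * D ^ i) < y - W * j" using e' by (simp add: simplex_def)
    moreover have "\<forall>i>Suc T. e i = 0" using e' by (auto simp: e simplex_def)
    ultimately show "e \<in> simplex D (Suc T) y" by (simp add: simplex_def)
  qed
  have inj: "inj_on (\<lambda>e. e(Suc T := j)) (?S j)" for j
    by (rule inj_onI) (metis (mono_tags, lifting) fun_upd_triv fun_upd_upd lessI mem_Collect_eq simplex_def)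
  have fin: "finite ((\<lambda>e. e(Suc T := j)) ` ?S j)" for j
    using Suc.IH by auto
  have "card (simplex D (Suc T) y) = (\<Sum>j\<in>{..y}. card ((\<lambda>e. e(Suc T := j)) ` ?S j))"
    unfolding eq by (rule card_UN_disjoint) (use fin in \<open>auto simp: fun_eq_iff\<close>, metis)
  also have "\<dots> = simplex_count D (Suc T) y"
  proof -
    have "card ((\<lambda>e. e(Suc T := j)) ` ?S j) = simplex_count D T (y - W * j)" for j
      using card_image[OF inj[of j]] Suc.IH[of "y - W * j"] by metis
    then show ?thesis by (simp only: simplex_count.simps W_def)
  qed
  finally show ?case using fin unfolding eq by auto
qed

lemma simplex_count_rec:
  assumes "D \<ge> 1" "y \<ge> D ^ Suc T"
  shows "simplex_count D (Suc T) y = simplex_count D T y + simplex_count D (Suc T) (y - D ^ Suc T)"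
proof -
  define W where "W = D ^ Suc T"
  have W: "W \<ge> 1" "y \<ge> W" using assms by (simp_all add: W_def)
  then obtain y' where y': "y = Suc y'" by (cases y) auto
  have "(\<Sum>j\<le>y. simplex_count D T (y - W * j)) = simplex_count D T y + (\<Sum>j\<le>y'. simplex_count D T (y - W * Suc j))"
    unfolding y' by (subst sum.atMost_Suc_shift) simp
  also have "(\<Sum>j\<le>y'. simplex_count D T (y - W * Suc j)) = (\<Sum>j\<le>y - W. simplex_count D T (y - W - W * j))"
  proof (rule sum.mono_neutral_cong_right)
    show "\<forall>j\<in>{..y'} - {..y - W}. simplex_count D T (y - W * Suc j) = 0"
    proof
      fix j assume "j \<in> {..y'} - {..y - W}"
      then have "y \<le> W + 1 * j" by auto
      also have "\<dots> \<le> W + W * j" using W by (intro add_left_mono mult_le_mono1)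
      finally show "simplex_count D T (y - W * Suc j) = 0" by simp
    qed
  qed (use W y' in auto)
  finally show ?thesis by (simp add: W_def)
qed

lemma simplex_count_small:
  assumes "y \<ge> 1" shows "simplex_count D T y \<le> simplex_count D (Suc T) y"
  using member_le_sum[of 0 "{..y}" "\<lambda>j. simplex_count D T (y - D ^ Suc T * j)"] by simp

text \<open>Rising factorials behave under backward differences as powers do under differentiation,
  and the bound is a rising factorial in n.\<close>

lemma rising_diff:
  fixes x :: real
  shows "(\<Prod>j<Suc k. x + real j) - (\<Prod>j<Suc k. (x - 1) + real j) = real (Suc k) * (\<Prod>j<k. x + real j)"
proof -
  have "(\<Prod>j<Suc k. (x - 1) + real j) = (x - 1) * (\<Prod>j<k. x + real j)"
    by (subst prod.lessThan_Suc_shift) simp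
  then show ?thesis by (simp add: algebra_simps)
qed

lemma rising_diff_le:
  assumes "W \<le> y"
  shows "(\<Prod>j<Suc k. real y + real j) - (\<Prod>j<Suc k. real (y - W) + real j)
    \<le> real (Suc k) * real W * (\<Prod>j<k. real y + real j)"
  using assms
proof (induction W)
  case (Suc W)
  have e: "real (y - Suc W) = real (y - W) - 1" using Suc.prems by (simp add: of_nat_diff)
  have "(\<Prod>j<Suc k. real (y - W) + real j) - (\<Prod>j<Suc k. real (y - Suc W) + real j)
     = real (Suc k) * (\<Prod>j<k. real (y - W) + real j)"
    unfolding e by (rule rising_diff)
  also have "\<dots> \<le> real (Suc k) * (\<Prod>j<k. real y + real j)"
    by (intro mult_left_mono prod_mono) auto
  finally have step: "(\<Prod>j<Suc k. real (y - W) + real j) - (\<Prod>j<Suc k. real (y - Suc W) + real j)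
     \<le> real (Suc k) * (\<Prod>j<k. real y + real j)" .
  have "real (Suc k) * real (Suc W) * (\<Prod>j<k. real y + real j)
    = real (Suc k) * real W * (\<Prod>j<k. real y + real j) + real (Suc k) * (\<Prod>j<k. real y + real j)"
    by (simp add: algebra_simps)
  with step Suc show ?case by linarith
qed simp

text \<open>No second-order correction is necessary here. The rising factorial satisfies the
  recursion \<open>simplex_count_rec\<close> as an inequality in the right direction, because each
  of the W unit differences is at most the one at y.\<close>

lemma simplex_count_ge:
  assumes "D \<ge> 1"
  shows "vol D (Suc T) * (\<Prod>j<Suc T. real y + real j) \<le> real (simplex_count D T y)"
proof (induction T arbitrary: y)
  case 0
  then show ?case by (simp add: vol_def)
next
  case (Suc T)
  define W where "W = D ^ Suc T"
  have W: "W \<ge> 1" using assms by (simp add: W_def)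
  define V where "V = vol D (Suc T)"
  have V: "V > 0" using vol_pos[OF assms] by (simp add: V_def)
  have vol: "vol D (Suc (Suc T)) = V / (real (Suc (Suc T)) * real W)"
    by (simp add: vol_Suc[of D "Suc T"] V_def W_def)
  show ?case
  proof (induction y rule: less_induct)
    case (less y)
    let ?R = "\<lambda>k y. \<Prod>j<k. real y + real j"
    show ?case
    proof (cases "y < W")
      case True
      show ?thesis
      proof (cases "y = 0")
        case False
        have "V / (real (Suc (Suc T)) * real W) * ?R (Suc (Suc T)) y
          = V * ?R (Suc T) y * ((real y + real (Suc T)) / (real (Suc (Suc T)) * real W))"
          by simp
        also have "\<dots> \<le> V * ?R (Suc T) y * 1"
        proof (rule mult_left_mono)
          have "real y + real (Suc T) \<le> real W + real (Suc T) * real W"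
            using True W by (intro add_mono) (auto simp: mult_ge1_I)
          also have "\<dots> = real (Suc (Suc T)) * real W" by (simp add: algebra_simps)
          finally show "(real y + real (Suc T)) / (real (Suc (Suc T)) * real W) \<le> 1" using W by (simp add: field_simps)
          show "0 \<le> V * ?R (Suc T) y" using V by (intro mult_nonneg_nonneg prod_nonneg) auto
        qed
        also have "\<dots> \<le> real (simplex_count D T y)" using Suc.IH[of y] by (simp add: V_def)
        also have "\<dots> \<le> real (simplex_count D (Suc T) y)"
          using simplex_count_small False by (intro of_nat_mono) auto
        finally show ?thesis unfolding vol .
      qed (simp add: prod.lessThan_Suc_shift del: prod.lessThan_Suc)
    next
      case False
      then have Wy: "W \<le> y" by simp
      have "V / (real (Suc (Suc T)) * real W) * (?R (Suc (Suc T)) y - ?R (Suc (Suc T)) (y - W))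
        \<le> V / (real (Suc (Suc T)) * real W) * (real (Suc (Suc T)) * real W * ?R (Suc T) y)"
        using rising_diff_le[OF Wy, of "Suc T"] V by (intro mult_left_mono) auto
      also have "\<dots> = V * ?R (Suc T) y" using W by simp
      also have "\<dots> \<le> real (simplex_count D T y)" using Suc.IH[of y] by (simp add: V_def)
      finally have 1: "V / (real (Suc (Suc T)) * real W) * ?R (Suc (Suc T)) y
          - V / (real (Suc (Suc T)) * real W) * ?R (Suc (Suc T)) (y - W) \<le> real (simplex_count D T y)"
        by (simp only: right_diff_distrib)
      have "V / (real (Suc (Suc T)) * real W) * ?R (Suc (Suc T)) (y - W) \<le> real (simplex_count D (Suc T) (y - W))"
        using less.IH[of "y - W"] W Wy unfolding vol by simp
      with 1 show ?thesis unfolding vol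
        using simplex_count_rec[OF assms, of T y] Wy by (simp add: W_def)
    qed
  qed
qed

lemma order_bound_le_simplex_count:
  assumes "D \<ge> 1" "n \<ge> 1"
  shows "order_bound n (Suc T) D \<le> real (simplex_count D T n)"
  using simplex_count_ge[OF assms(1), of T n] unfolding order_bound_eq[OF assms(2)] by (simp only: of_nat_add)

lemma order_bound_antimono:
  assumes "1 \<le> D" "D \<le> d" shows "order_bound n t d \<le> order_bound n t D"
  unfolding order_bound_def
  using assms by (intro mult_left_mono prod_mono) (auto intro!: divide_left_mono power_mono mult_pos_pos)

section \<open>Multiplicative independence of iterates\<close>

text \<open>The homogenization of P to degree N, evaluated at (g, h); as a rational function it is h^N P(g/h).\<close>
definition homog :: "nat \<Rightarrow> 'a::field poly \<Rightarrow> 'a poly \<Rightarrow> 'a poly \<Rightarrow> 'a poly" where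
  "homog N P g h = (\<Sum>i\<le>N. smult (coeff P i) (g ^ i * h ^ (N - i)))"

lemma homog_0: "homog 0 P g h = [:coeff P 0:]"
  by (simp add: homog_def)

lemma homog_pCons:
  "homog (Suc N) (pCons a P) g h = smult a (h ^ Suc N) + g * homog N P g h"
  unfolding homog_def
  by (subst sum.atMost_Suc_shift) (simp add: sum_distrib_left mult.assoc)

lemma homog_add: "homog N (P + Q) g h = homog N P g h + homog N Q g h"
  by (simp add: homog_def smult_add_left sum.distrib)

lemma homog_smult: "homog N (smult c P) g h = smult c (homog N P g h)"
  by (rule poly_eqI) (simp add: homog_def coeff_sum sum_distrib_left mult.assoc)

lemma homog_diff: "homog N (P - Q) g h = homog N P g h - homog N Q g h"
  by (simp add: homog_def smult_diff_left sum_subtractf)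

lemma homog_raise:
  assumes "degree P \<le> N"
  shows "homog (M + N) P g h = h ^ M * homog N P g h"
proof -
  have "homog (M + N) P g h = (\<Sum>i\<le>N. smult (coeff P i) (g ^ i * h ^ (M + N - i)))"
    unfolding homog_def by (rule sum.mono_neutral_right) (use assms in \<open>auto simp: coeff_eq_0\<close>)
  also have "\<dots> = h ^ M * homog N P g h"
    unfolding homog_def sum_distrib_left
    by (rule sum.cong) (auto simp: power_add mult_ac simp flip: Nat.add_diff_assoc)
  finally show ?thesis .
qed

lemma homog_mult:
  assumes "degree P \<le> M" "degree Q \<le> N"
  shows "homog (M + N) (P * Q) g h = homog M P g h * homog N Q g h"
  using assms(1)
proof (induction M arbitrary: P)
  case 0
  then obtain c where "P = [:c:]" by (metis degree_eq_zeroE le_zero_eq)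
  then show ?case by (simp add: homog_0 homog_smult)
next
  case (Suc M)
  obtain a P' where P: "P = pCons a P'" by (metis pCons_cases)
  have P': "degree P' \<le> M" using Suc.prems P by (cases "P' = 0") auto
  have "homog (Suc M + N) (P * Q) g h
      = smult a (homog (Suc M + N) Q g h) + homog (Suc (M + N)) (pCons 0 (P' * Q)) g h"
    by (simp add: P homog_add homog_smult)
  also have "\<dots> = smult a (h ^ Suc M * homog N Q g h) + g * (homog M P' g h * homog N Q g h)"
    unfolding homog_pCons homog_raise[OF assms(2)] Suc.IH[OF P'] by simp
  also have "\<dots> = homog (Suc M) P g h * homog N Q g h"
    unfolding P homog_pCons by (simp add: algebra_simps)
  finally show ?case .
qed

lemma homog_one: "homog N 1 g h = h ^ N"
  using homog_raise[of 1 0 N g h] by (simp add: homog_0)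

lemma homog_power:
  assumes "degree P \<le> M"
  shows "homog (M * k) (P ^ k) g h = homog M P g h ^ k"
proof (induction k)
  case (Suc k)
  have "degree (P ^ k) \<le> M * k"
    using degree_power_le[of P k] assms by (meson le_trans mult_le_mono1)
  from homog_mult[OF assms this, of g h] Suc show ?case by simp
qed (simp add: homog_0)

lemma homog_prod:
  assumes "finite A" "\<And>i. i \<in> A \<Longrightarrow> degree (P i) \<le> M i"
  shows "homog (\<Sum>i\<in>A. M i) (\<Prod>i\<in>A. P i) g h = (\<Prod>i\<in>A. homog (M i) (P i) g h)"
  using assms
proof (induction A rule: finite_induct)
  case (insert x A)
  have "degree (\<Prod>i\<in>A. P i) \<le> (\<Sum>i\<in>A. M i)"
    using degree_prod_sum_le[OF insert.hyps(1), of P] sum_mono[of A "\<lambda>i. degree (P i)" M] insert.prems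
    by (force simp: o_def)
  then show ?case using insert by (simp add: homog_mult)
qed (simp add: homog_0)

lemma degree_homog_le:
  assumes "degree g \<le> D" "degree h \<le> D"
  shows "degree (homog N P g h) \<le> N * D"
  unfolding homog_def
proof (rule degree_sum_le)
  fix i assume i: "i \<in> {..N}"
  have "degree (g ^ i * h ^ (N - i)) \<le> degree g * i + degree h * (N - i)"
    by (meson add_mono degree_mult_le degree_power_le le_trans)
  also have "\<dots> \<le> D * i + D * (N - i)"
    using assms by (intro add_mono mult_le_mono1)
  also have "\<dots> = N * D"
    using i by (simp flip: add_mult_distrib2)
  finally show "degree (smult (coeff P i) (g ^ i * h ^ (N - i))) \<le> N * D"
    using degree_smult_le le_trans by blast
qed auto

lemma poly_homog:
  "poly (homog N P g h) x = (\<Sum>i\<le>N. coeff P i * (poly g x ^ i * poly h x ^ (N - i)))"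
  by (simp add: homog_def poly_sum)

lemma poly_homog_nz:
  assumes "degree P \<le> N" "poly h x \<noteq> 0"
  shows "poly (homog N P g h) x = poly h x ^ N * poly P (poly g x / poly h x)"
proof -
  have "poly P (poly g x / poly h x) = (\<Sum>i\<le>N. coeff P i * (poly g x / poly h x) ^ i)"
    unfolding poly_altdef by (rule sum.mono_neutral_left) (use assms in \<open>auto simp: coeff_eq_0\<close>)
  then show ?thesis
    unfolding poly_homog using assms(2)
    by (auto simp: sum_distrib_left power_divide power_diff intro!: sum.cong)
qed

lemma poly_homog_z:
  assumes "poly h x = 0"
  shows "poly (homog N P g h) x = coeff P N * poly g x ^ N"
proof -
  have "poly (homog N P g h) x = (\<Sum>i\<in>{N}. coeff P i * (poly g x ^ i * poly h x ^ (N - i)))"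
    unfolding poly_homog by (rule sum.mono_neutral_right) (use assms in auto)
  then show ?thesis by simp
qed

text \<open>Composing P/Q with g/h does not create common factors. At a zero of h only the
  coefficients of index K survive; since K is the larger of the two degrees, they are not both 0,
  which is the statement at infinity.\<close>

lemma homog_no_common_zero:
  assumes "coprime g h" "coprime P Q" "K = max (degree P) (degree Q)"
    and "poly (homog K P g h) x = 0"
  shows "poly (homog K Q g h) x \<noteq> 0"
proof (cases "poly h x = 0")
  case True
  then have "poly g x \<noteq> 0" using assms(1) by (metis coprime_poly_0)
  with True assms(4) have "coeff P K = 0" by (simp add: poly_homog_z)
  moreover have "\<not> (P = 0 \<and> Q = 0)" using assms(2) by auto
  ultimately have "coeff Q K \<noteq> 0"
    using assms(3) by (metis coprime_0_left_iff degree_0 is_unit_iff_degree leading_coeff_0_iff max.commute max_0L max_def)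
  with True \<open>poly g x \<noteq> 0\<close> show ?thesis by (simp add: poly_homog_z)
next
  case False
  with assms have "poly P (poly g x / poly h x) = 0" by (simp add: poly_homog_nz)
  with assms(2) have "poly Q (poly g x / poly h x) \<noteq> 0" by (metis coprime_poly_0)
  with False assms(3) show ?thesis by (simp add: poly_homog_nz)
qed

lemma homog_linear: "homog (Suc 0) [:t, s:] g h = smult s g + smult t h"
  using homog_pCons[of 0 t "[:s:]" g h] by (simp add: homog_0)

lemma homog_dvd:
  assumes "poly P \<rho> = 0" "degree P \<le> N" "P \<noteq> 0"
  shows "g - smult \<rho> h dvd homog N P g h"
proof -
  from assms(1) obtain P' where P': "P = [:-\<rho>, 1:] * P'" by (metis dvdE poly_eq_0_iff_dvd)
  with assms(3) have "P' \<noteq> 0" by auto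
  with P' have "degree P = Suc (degree P')" by (simp add: degree_mult_eq del: mult_pCons_left)
  with assms(2) have "degree P' \<le> N - 1" "1 + (N - 1) = N" by auto
  then have "homog N P g h = homog 1 [:-\<rho>, 1:] g h * homog (N - 1) P' g h"
    unfolding P' by (metis One_nat_def degree_pCons_eq_if homog_mult le_refl one_neq_zero degree_0 pCons_eq_0_iff)
  then show ?thesis by (simp add: homog_linear)
qed

locale coprime_pair =
  fixes g h :: "'a::{alg_closed_field,factorial_ring_gcd,semiring_gcd_mult_normalize} poly" and D :: nat
  assumes cop: "coprime g h" and D_def: "D = max (degree g) (degree h)" and D_pos: "D \<ge> 1"
begin

lemma h_nz: "h \<noteq> 0" and g_nz: "g \<noteq> 0"
  using cop D_def D_pos by (auto dest: is_unit_polyE simp: is_unit_poly_iff)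

lemma lin_eq:
  assumes "smult s g = smult t h" shows "s = 0" "t = 0"
proof -
  have *: False if "smult s g = smult t h" "coprime g h" "g \<noteq> 0" "h \<noteq> 0" "max (degree g) (degree h) \<ge> 1" "s \<noteq> 0"
    for s t :: 'a and g h
  proof -
    have "t \<noteq> 0" using that by auto
    have "g dvd h" "h dvd g"
      using that(1) \<open>t \<noteq> 0\<close> \<open>s \<noteq> 0\<close> by (metis dvd_refl smult_dvd_cancel dvd_smult dvd_smult_cancel)+
    with that show False
      by (metis coprime_absorb_left coprime_absorb_right is_unit_iff_degree max_0L not_one_le_zero)
  qed
  show "s = 0" using * assms cop h_nz g_nz D_def D_pos by blast
  then show "t = 0" using assms h_nz by auto
qed

text \<open>P splits into linear factors, so its homogenization is, up to a constant, a product of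
  forms g - \<rho> h and a power of h, none of which is 0.\<close>

lemma homog_nonzero:
  assumes "P \<noteq> 0" "degree P \<le> N" shows "homog N P g h \<noteq> 0"
  using assms
proof (induction N arbitrary: P)
  case 0
  then show ?case by (auto simp: homog_0 elim: degree_eq_zeroE)
next
  case (Suc N)
  show ?case
  proof (cases "degree P = 0")
    case True
    then obtain c where "P = [:c:]" by (auto elim: degree_eq_zeroE)
    then have "homog (Suc N) P g h = smult c (h ^ Suc N)" "c \<noteq> 0"
      using Suc.prems homog_smult[of "Suc N" c 1] by (auto simp: homog_one)
    then show ?thesis using h_nz by simp
  next
    case False
    then obtain \<rho> where "poly P \<rho> = 0" using alg_closed_imp_poly_has_root by auto
    then obtain P' where P': "P = [:-\<rho>, 1:] * P'" by (metis dvdE poly_eq_0_iff_dvd)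
    with Suc.prems have P'0: "P' \<noteq> 0" by auto
    with P' have "degree P = Suc (degree P')" by (simp add: degree_mult_eq del: mult_pCons_left)
    with Suc.prems have "degree P' \<le> N" by auto
    then have "homog (1 + N) P g h = homog 1 [:-\<rho>, 1:] g h * homog N P' g h"
      unfolding P' by (intro homog_mult) auto
    moreover have "g - smult \<rho> h \<noteq> 0" using lin_eq[of 1 \<rho>] by auto
    ultimately show ?thesis using Suc.IH[OF P'0 \<open>degree P' \<le> N\<close>] by (simp add: homog_linear)
  qed
qed

lemma homog_inj:
  assumes "homog N P g h = homog N Q g h" "degree P \<le> N" "degree Q \<le> N"
  shows "P = Q"
  using homog_nonzero[of "P - Q" N] assms degree_diff_le[of P N Q] by (auto simp: homog_diff)

end

text \<open>Dividing by the gcd and lowering the degree of homogenization to K provides the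
  hypotheses of \<open>homog_no_common_zero\<close>.\<close>

lemma (in coprime_pair) homog_cancel:
  assumes "A * homog N P g h = B * homog N Q g h" "P \<noteq> 0" "Q \<noteq> 0" "degree P \<le> N" "degree Q \<le> N"
  obtains P' Q' K where "coprime P' Q'" "K = max (degree P') (degree Q')" "P * Q' = Q * P'"
    "A * homog K P' g h = B * homog K Q' g h" "P' \<noteq> 0" "Q' \<noteq> 0"
proof -
  define C where "C = gcd P Q"
  obtain P' Q' where PQ: "P = P' * C" "Q = Q' * C" "coprime P' Q'"
    using gcd_coprime_exists[of P Q] assms(2) unfolding C_def by auto
  have nz: "P' \<noteq> 0" "Q' \<noteq> 0" "C \<noteq> 0" using PQ assms by auto
  define K where "K = max (degree P') (degree Q')"
  have "degree P' + degree C \<le> N" "degree Q' + degree C \<le> N"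
    using assms PQ nz by (auto simp: degree_mult_eq)
  then have le: "degree P' \<le> K" "degree Q' \<le> K" "degree C \<le> N - K" "K + (N - K) = N"
    unfolding K_def by auto
  have "homog N P g h = homog K P' g h * homog (N - K) C g h"
    "homog N Q g h = homog K Q' g h * homog (N - K) C g h"
    using homog_mult[OF le(1,3), of g h] homog_mult[OF le(2,3), of g h] le(4) PQ by auto
  moreover have "homog (N - K) C g h \<noteq> 0" using homog_nonzero nz le by auto
  ultimately have "A * homog K P' g h = B * homog K Q' g h" using assms(1) by simp
  then show ?thesis using that[of P' Q' K] PQ nz K_def by simp
qed


section \<open>Total ramification over two points\<close>

lemma dvd_const_poly: "p dvd q \<Longrightarrow> q \<noteq> 0 \<Longrightarrow> degree q = 0 \<Longrightarrow> degree (p::'a::field poly) = 0"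
  by (metis dvd_imp_degree_le le_zero_eq)

lemma dvd_monom_imp_monom:
  assumes "(p::'a::field poly) dvd monom c k" "c \<noteq> 0"
  shows "\<exists>c'. c' \<noteq> 0 \<and> p = monom c' (degree p)"
  using assms
proof (induction k arbitrary: p c)
  case 0
  then have "degree p = 0" using dvd_const_poly[of p "monom c 0"] by (auto simp: degree_monom_eq)
  moreover have "p \<noteq> 0" using 0 by auto
  ultimately show ?case by (metis degree_eq_zeroE monom_0 pCons_0_0)
next
  case (Suc k)
  have eq: "monom c (Suc k) = [:0, 1:] * monom c k" by (simp add: monom_Suc)
  obtain s where s: "monom c (Suc k) = p * s" using Suc.prems by auto
  have "poly p 0 * poly s 0 = 0" using arg_cong[OF s, of "\<lambda>p. poly p 0"] by (simp add: poly_monom)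
  then consider "poly p 0 = 0" | "poly s 0 = 0" by auto
  then show ?case
  proof cases
    case 1
    then obtain p' where p': "p = [:0, 1:] * p'" by (metis dvdE minus_zero poly_eq_0_iff_dvd)
    have "[:0, 1:] * monom c k = [:0, 1:] * (p' * s)" using s p' unfolding eq by (simp only: mult.assoc)
    then have "monom c k = p' * s" by (subst (asm) mult_cancel_left) auto
    from Suc.IH[of p' c] this Suc.prems obtain c' where c': "c' \<noteq> 0" "p' = monom c' (degree p')" by auto
    then have "p' \<noteq> 0" by auto
    then have "degree p = Suc (degree p')" unfolding p' by simp
    moreover have "p = monom c' (Suc (degree p'))" unfolding p' using c'(2) by (simp add: monom_Suc)
    ultimately show ?thesis using c' by auto
  next
    case 2
    then obtain s' where s': "s = [:0, 1:] * s'" by (metis dvdE minus_zero poly_eq_0_iff_dvd)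
    have "[:0, 1:] * monom c k = [:0, 1:] * (p * s')" using s s' unfolding eq
      by (simp only: mult.left_commute)
    then have "monom c k = p * s'" by (subst (asm) mult_cancel_left) auto
    from Suc.IH[of p c] this Suc.prems show ?thesis by auto
  qed
qed

lemma no_other_root_imp_power:
  assumes "(P::'a::alg_closed_field poly) \<noteq> 0" "\<And>x. poly P x = 0 \<Longrightarrow> x = \<rho>"
  shows "\<exists>c. c \<noteq> 0 \<and> P = smult c ([:-\<rho>, 1:] ^ degree P)"
proof -
  obtain R where R: "P = [:-\<rho>, 1:] ^ order \<rho> P * R" "\<not> [:-\<rho>, 1:] dvd R"
    using order_decomp[OF assms(1)] by blast
  have "poly R x \<noteq> 0" for x
    using assms(2)[of x] R by (metis mult_zero_right poly_eq_0_iff_dvd poly_mult)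
  then have "degree R = 0" using alg_closed_imp_poly_has_root[of R] by auto
  then obtain c where c: "R = [:c:]" by (auto elim: degree_eq_zeroE)
  with assms(1) R have "c \<noteq> 0" by auto
  have P: "P = smult c ([:-\<rho>, 1:] ^ order \<rho> P)" using R(1) c by simp
  then have "degree P = order \<rho> P" using \<open>c \<noteq> 0\<close> by (metis degree_linear_power degree_smult_eq)
  with P \<open>c \<noteq> 0\<close> show ?thesis by metis
qed

lemma no_root_imp_const:
  assumes "\<And>x. poly P x \<noteq> 0" shows "\<exists>c. c \<noteq> 0 \<and> (P::'a::alg_closed_field poly) = [:c:]"
proof -
  have "degree P = 0" using alg_closed_imp_poly_has_root[of P] assms by auto
  then show ?thesis using assms[of 0] by (auto elim!: degree_eq_zeroE)
qed

context coprime_pair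
begin

lemma homog_h_dvd: "degree P < N \<Longrightarrow> h dvd homog N P g h"
  using homog_raise[of P "N - 1" 1 g h] by simp

lemma not_both_const:
  assumes "degree (smult s g + smult t h) = 0" "degree (smult s' g + smult t' h) = 0"
  shows "s * t' = s' * t"
proof (rule ccontr)
  assume ne: "s * t' \<noteq> s' * t"
  let ?u = "smult s g + smult t h" and ?v = "smult s' g + smult t' h"
  have "smult (s * t' - s' * t) g = smult t' ?u - smult t ?v"
    "smult (s * t' - s' * t) h = smult s ?v - smult s' ?u"
    by (simp_all add: smult_add_right smult_diff_left algebra_simps)
  moreover have "degree (smult a ?u - smult b ?v) = 0" "degree (smult a ?v - smult b ?u) = 0" for a b
    using assms degree_diff_le[of "smult a ?u" 0 "smult b ?v"] degree_diff_le[of "smult a ?v" 0 "smult b ?u"]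
      degree_smult_le[of a ?u] degree_smult_le[of b ?v] degree_smult_le[of a ?v] degree_smult_le[of b ?u]
    by auto
  ultimately have "degree (smult (s * t' - s' * t) g) = 0" "degree (smult (s * t' - s' * t) h) = 0"
    by metis+
  with ne have "degree g = 0" "degree h = 0" by auto
  then show False using D_def D_pos by auto
qed

text \<open>The fibre over the zeros and the fibre over the poles of P/Q each consist of a single point, so
  P/Q is a power of a fractional linear map; this turns g/h into a fractional linear image of X to the D.\<close>
lemma totally_ramified:
  assumes eq: "monom 1 k * homog N P g h = homog N Q g h" and "k > 0"
    and "P \<noteq> 0" "Q \<noteq> 0" "degree P \<le> N" "degree Q \<le> N"
  obtains s0 t0 s1 t1 \<gamma> M where "smult s0 g + smult t0 h = monom 1 D"
    "smult s1 g + smult t1 h = 1" "M \<ge> 1" "\<gamma> \<noteq> 0"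
    "P * [:t0, s0:] ^ M = smult \<gamma> (Q * [:t1, s1:] ^ M)"
proof -
  have "monom 1 k * homog N P g h = 1 * homog N Q g h" using eq by simp
  from homog_cancel[OF this assms(3-6)] obtain P' Q' M where
    PQ: "coprime P' Q'" "M = max (degree P') (degree Q')" "P * Q' = Q * P'"
    and eq': "monom 1 k * homog M P' g h = homog M Q' g h" and nz: "P' \<noteq> 0" "Q' \<noteq> 0" by auto
  define A where "A = homog M P' g h"
  have A_nz: "A \<noteq> 0" using homog_nonzero nz PQ(2) unfolding A_def by simp
  \<comment> \<open>A zero of A would be a common zero of both homogenizations. Hence A is constant,
    the other side is a multiple of X^k, and all their factors are constants or monomials.\<close>
  have "poly A x \<noteq> 0" for x
  proof
    assume A0: "poly A x = 0"
    then have "poly (homog M Q' g h) x = 0" using arg_cong[OF eq', of "\<lambda>p. poly p x"] by (simp add: A_def)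
    with A0 homog_no_common_zero[OF cop PQ(1,2)] show False unfolding A_def by blast
  qed
  then obtain \<gamma>0 where \<gamma>0: "\<gamma>0 \<noteq> 0" "A = [:\<gamma>0:]" using no_root_imp_const by blast
  then have B: "homog M Q' g h = monom \<gamma>0 k" using eq' by (simp add: A_def smult_monom)
  have M1: "M \<ge> 1"
  proof (rule ccontr)
    assume "\<not> M \<ge> 1"
    then have "M = 0" by simp
    then have "degree (homog M Q' g h) = 0" by (simp add: homog_0)
    with B \<gamma>0 \<open>k > 0\<close> show False by (simp add: degree_monom_eq)
  qed
  have constA: "degree L = 0" if "L dvd A" for L
    using that dvd_const_poly[of L A] A_nz \<gamma>0 by auto
  have monB: "\<exists>c'. c' \<noteq> 0 \<and> L = monom c' (degree L)" if "L dvd homog M Q' g h" for L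
    using dvd_monom_imp_monom that \<gamma>0 unfolding B by blast
  have degPQ: "degree P' \<le> M" "degree Q' \<le> M" using PQ by auto
  have rA: "degree (g - smult \<rho> h) = 0" if "poly P' \<rho> = 0" for \<rho>
    using constA homog_dvd[OF that degPQ(1) nz(1)] unfolding A_def by blast
  have rB: "\<exists>c'. c' \<noteq> 0 \<and> g - smult \<rho> h = monom c' (degree (g - smult \<rho> h))" if "poly Q' \<rho> = 0" for \<rho>
    using monB homog_dvd[OF that degPQ(2) nz(2)] by blast
  have two: "\<rho> = \<rho>'" if "degree (g - smult \<rho> h) = 0" "degree (g - smult \<rho>' h) = 0" for \<rho> \<rho>'
    using not_both_const[of 1 "-\<rho>" 1 "-\<rho>'"] that by simp
  have hg: False if "degree h = 0" "degree (g - smult \<rho> h) = 0" for \<rho>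
    using not_both_const[of 0 1 1 "-\<rho>"] that by simp

  \<comment> \<open>A point of the projective line is encoded by a linear form s g + t h. If
    \<open>degree P' < M\<close>, the point is infinity and its form a multiple of h; otherwise it
    is a root \<rho> of P' with the form g - \<rho> h. Two distinct constant forms would make g and
    h constant, so there is only one point.\<close>
  obtain s1 t1 \<gamma>1 where L1: "smult s1 g + smult t1 h = 1" "\<gamma>1 \<noteq> 0" "P' = smult \<gamma>1 ([:t1, s1:] ^ M)"
    and L1': "degree P' < M \<and> s1 = 0 \<and> degree h = 0 \<or> s1 \<noteq> 0 \<and> poly P' (- t1 / s1) = 0"
  proof (cases "degree P' < M")
    case True
    then have "degree h = 0" using constA homog_h_dvd unfolding A_def by blast
    then obtain c where c: "h = [:c:]" "c \<noteq> 0" using h_nz by (auto elim!: degree_eq_zeroE)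
    have "poly P' x \<noteq> 0" for x using rA hg \<open>degree h = 0\<close> by blast
    then obtain c' where c': "c' \<noteq> 0" "P' = [:c':]" using no_root_imp_const by blast
    have "P' = smult (c' * c ^ M) ([:1 / c, 0:] ^ M)"
      using c' c by (simp add: poly_const_pow power_divide)
    then show ?thesis using that[of 0 "1/c" "c' * c ^ M"] c c' True by (simp add: one_pCons)
  next
    case False
    then have dP: "degree P' = M" using degPQ by simp
    then obtain \<rho> where \<rho>: "poly P' \<rho> = 0" using alg_closed_imp_poly_has_root[of P'] M1 by auto
    then obtain c where c: "g - smult \<rho> h = [:c:]" using rA by (auto elim!: degree_eq_zeroE)
    have "c \<noteq> 0" using c lin_eq(1)[of 1 \<rho>] by auto
    obtain c' where c': "c' \<noteq> 0" "P' = smult c' ([:-\<rho>, 1:] ^ M)"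
      using no_other_root_imp_power[OF nz(1), of \<rho>] two rA \<rho> dP by metis
    have lin: "[:-\<rho>, 1:] = smult c [:-\<rho> / c, 1 / c:]" using \<open>c \<noteq> 0\<close> by simp
    have "P' = smult (c' * c ^ M) ([:-\<rho> / c, 1 / c:] ^ M)"
      unfolding c'(2) by (subst lin) (simp only: smult_power smult_smult)
    moreover have "smult (1 / c) g + smult (- \<rho> / c) h = smult (1 / c) (g - smult \<rho> h)"
      by (simp add: smult_diff_right)
    ultimately show ?thesis using that[of "1/c" "-\<rho>/c" "c' * c ^ M"] c c' \<open>c \<noteq> 0\<close> \<rho>
      by (simp add: one_pCons)
  qed

  \<comment> \<open>Together with the form equal to 1, an independent form spans g and h, so its
    degree cannot be below D.\<close>
  have deg_indep: "degree (smult s g + smult t h) = D" if ne: "s * t1 \<noteq> s1 * t" for s t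
  proof -
    let ?L = "smult s g + smult t h"
    have eqs: "smult (s * t1 - s1 * t) g = smult t1 ?L - smult t (smult s1 g + smult t1 h)"
      "smult (s * t1 - s1 * t) h = smult s (smult s1 g + smult t1 h) - smult s1 ?L"
      by (simp_all add: smult_add_right smult_diff_left algebra_simps)
    have le: "degree ?L \<le> D"
      by (rule degree_add_le) (use degree_smult_le[of s g] degree_smult_le[of t h] D_def in auto)
    have "degree g \<le> degree ?L" "degree h \<le> degree ?L"
    proof -
      have "degree (smult (s * t1 - s1 * t) g) \<le> degree ?L"
        unfolding eqs L1 by (rule degree_diff_le) (use degree_smult_le[of t1 ?L] in \<open>auto simp: one_pCons\<close>)
      then show "degree g \<le> degree ?L" using ne by simp
      have "degree (smult (s * t1 - s1 * t) h) \<le> degree ?L"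
        unfolding eqs L1 by (rule degree_diff_le) (use degree_smult_le[of s1 ?L] in \<open>auto simp: one_pCons\<close>)
      then show "degree h \<le> degree ?L" using ne by simp
    qed
    with le D_def show ?thesis by simp
  qed

  obtain s0 t0 \<gamma>2 where L0: "smult s0 g + smult t0 h = monom 1 D" "\<gamma>2 \<noteq> 0" "Q' = smult \<gamma>2 ([:t0, s0:] ^ M)"
  proof (cases "degree Q' < M")
    case True
    then have "degree P' = M" using PQ by auto
    with L1' have "s1 \<noteq> 0" by auto
    then have dh: "degree h = D" using deg_indep[of 0 1] by simp
    obtain c where c: "c \<noteq> 0" "h = monom c D" using monB[OF homog_h_dvd[OF True]] dh by auto
    \<comment> \<open>The forms belonging to Q' are monomials of degree D and vanish at 0. Two of
      them for different points would force g and h to vanish there together.\<close>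
    have "poly Q' \<rho> \<noteq> 0" for \<rho>
    proof
      assume \<rho>: "poly Q' \<rho> = 0"
      have "degree (g - smult \<rho> h) = D"
      proof -
        have "t1 \<noteq> s1 * - \<rho>"
        proof
          assume "t1 = s1 * - \<rho>"
          then have "poly P' \<rho> = 0" using L1' \<open>s1 \<noteq> 0\<close> by simp
          with \<rho> PQ(1) show False by (metis coprime_poly_0)
        qed
        then show ?thesis using deg_indep[of 1 "-\<rho>"] by simp
      qed
      then obtain c2 where "g - smult \<rho> h = monom c2 D" using rB[OF \<rho>] by auto
      then have "poly (g - smult \<rho> h) 0 = 0" "poly h 0 = 0"
        using c D_pos by (simp_all add: poly_monom)
      then have "poly g 0 = 0" "poly h 0 = 0" by auto
      with cop show False by (metis coprime_poly_0)
    qed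
    then obtain c' where c': "c' \<noteq> 0" "Q' = [:c':]" using no_root_imp_const by blast
    have "Q' = smult (c' * c ^ M) ([:1 / c, 0:] ^ M)"
      using c' c by (simp add: poly_const_pow power_divide)
    then show ?thesis using that[of 0 "1/c" "c' * c ^ M"] c c' by (simp add: smult_monom)
  next
    case False
    then have dQ: "degree Q' = M" using degPQ by simp
    then obtain \<rho> where \<rho>: "poly Q' \<rho> = 0" using alg_closed_imp_poly_has_root[of Q'] M1 by auto
    have deg: "degree (g - smult \<sigma> h) = D" if \<sigma>: "poly Q' \<sigma> = 0" for \<sigma>
    proof -
      have "t1 \<noteq> s1 * - \<sigma>"
      proof
        assume *: "t1 = s1 * - \<sigma>"
        show False
        proof (cases "s1 = 0")
          case True
          with * L1(1) show False by simp
        next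
          case False
          then have "poly P' \<sigma> = 0" using L1' * by simp
          with \<sigma> PQ(1) show False by (metis coprime_poly_0)
        qed
      qed
      then show ?thesis using deg_indep[of 1 "-\<sigma>"] by simp
    qed
    have mon: "\<exists>c. c \<noteq> 0 \<and> g - smult \<sigma> h = monom c D" if "poly Q' \<sigma> = 0" for \<sigma>
      using rB[OF that] deg[OF that] by auto
    obtain c where c: "c \<noteq> 0" "g - smult \<rho> h = monom c D" using mon[OF \<rho>] by auto
    have "\<sigma> = \<rho>" if \<sigma>: "poly Q' \<sigma> = 0" for \<sigma>
    proof (rule ccontr)
      assume "\<sigma> \<noteq> \<rho>"
      obtain c2 where c2: "g - smult \<sigma> h = monom c2 D" using mon[OF \<sigma>] by auto
      have "poly (g - smult \<sigma> h) 0 = 0" "poly (g - smult \<rho> h) 0 = 0"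
        unfolding c c2 using D_pos by (simp_all add: poly_monom)
      then have "(\<sigma> - \<rho>) * poly h 0 = 0" "poly g 0 = \<rho> * poly h 0" by (auto simp: algebra_simps)
      with \<open>\<sigma> \<noteq> \<rho>\<close> have "poly g 0 = 0" "poly h 0 = 0" by auto
      with cop show False by (metis coprime_poly_0)
    qed
    then obtain c' where c': "c' \<noteq> 0" "Q' = smult c' ([:-\<rho>, 1:] ^ M)"
      using no_other_root_imp_power[OF nz(2), of \<rho>] dQ by metis
    have lin: "[:-\<rho>, 1:] = smult c [:-\<rho> / c, 1 / c:]" using \<open>c \<noteq> 0\<close> by simp
    have "Q' = smult (c' * c ^ M) ([:-\<rho> / c, 1 / c:] ^ M)"
      unfolding c'(2) by (subst lin) (simp only: smult_power smult_smult)
    moreover have "smult (1 / c) g + smult (- \<rho> / c) h = smult (1 / c) (g - smult \<rho> h)"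
      by (simp add: smult_diff_right)
    ultimately show ?thesis using that[of "1/c" "-\<rho>/c" "c' * c ^ M"] c c'
      by (simp add: smult_monom)
  qed

  have "smult \<gamma>2 (P * [:t0, s0:] ^ M) = smult \<gamma>1 (Q * [:t1, s1:] ^ M)"
    using PQ(3) unfolding L0(3) L1(3) by simp
  then have "P * [:t0, s0:] ^ M = smult (\<gamma>1 / \<gamma>2) (Q * [:t1, s1:] ^ M)"
    using L0(2) by (metis (no_types, lifting) divide_inverse mult.commute right_inverse smult_1_left smult_smult)
  then show ?thesis using that[OF L0(1) L1(1) M1, of "\<gamma>1 / \<gamma>2"] L0(2) L1(2) by simp
qed

end


section \<open>Relations between numerators and denominators of iterates\<close>

primrec iter_num :: "'a::field poly \<Rightarrow> 'a poly \<Rightarrow> nat \<Rightarrow> nat \<Rightarrow> 'a poly" where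
  "iter_num g h D 0 = [:0, 1:]"
| "iter_num g h D (Suc j) = homog (D ^ j) (iter_num g h D j) g h"

primrec iter_den :: "'a::field poly \<Rightarrow> 'a poly \<Rightarrow> nat \<Rightarrow> nat \<Rightarrow> 'a poly" where
  "iter_den g h D 0 = 1"
| "iter_den g h D (Suc j) = homog (D ^ j) (iter_den g h D j) g h"

text \<open>The relation stating that the product of the f_j to the powers a j - b j is 1 becomes,
  after clearing denominators, the polynomial identity
  \<open>iter_prod g h D a b T = iter_prod g h D b a T\<close>.\<close>

definition iter_prod :: "'a::field poly \<Rightarrow> 'a poly \<Rightarrow> nat \<Rightarrow> (nat \<Rightarrow> nat) \<Rightarrow> (nat \<Rightarrow> nat) \<Rightarrow> nat \<Rightarrow> 'a poly" where
  "iter_prod g h D a b T = (\<Prod>j<T. iter_num g h D j ^ a j * iter_den g h D j ^ b j)"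

lemma degree_iter:
  assumes "degree g \<le> D" "degree h \<le> D"
  shows "degree (iter_num g h D j) \<le> D ^ j" "degree (iter_den g h D j) \<le> D ^ j"
proof -
  have "degree (iter_num g h D j) \<le> D ^ j \<and> degree (iter_den g h D j) \<le> D ^ j"
  proof (cases j)
    case (Suc i)
    then show ?thesis using degree_homog_le[OF assms, of "D ^ i"] by (simp add: mult.commute)
  qed auto
  then show "degree (iter_num g h D j) \<le> D ^ j" "degree (iter_den g h D j) \<le> D ^ j" by auto
qed

lemma degree_iter_prod:
  assumes "degree g \<le> D" "degree h \<le> D"
  shows "degree (iter_prod g h D a b T) \<le> (\<Sum>j<T. (a j + b j) * D ^ j)"
proof -
  have "degree (iter_num g h D j ^ a j * iter_den g h D j ^ b j) \<le> (a j + b j) * D ^ j" for j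
  proof -
    have "degree (iter_num g h D j ^ a j * iter_den g h D j ^ b j)
        \<le> degree (iter_num g h D j) * a j + degree (iter_den g h D j) * b j"
      by (meson add_mono degree_mult_le degree_power_le le_trans)
    also have "\<dots> \<le> D ^ j * a j + D ^ j * b j"
      using degree_iter[OF assms] by (intro add_mono mult_le_mono1)
    finally show ?thesis by (simp add: algebra_simps)
  qed
  then show ?thesis
    unfolding iter_prod_def
    by (intro order_trans[OF degree_prod_sum_le] sum_mono) simp_all
qed

text \<open>As f_(j+1) is f_j composed with f, everything but the power of X at j = 0 is a function
  of f. The induction over T runs on this shift.\<close>

lemma iter_prod_Suc:
  assumes "degree g \<le> D" "degree h \<le> D"
  shows "iter_prod g h D a b (Suc T) =
    monom 1 (a 0) * homog (\<Sum>j<T. (a (Suc j) + b (Suc j)) * D ^ j) (iter_prod g h D (a \<circ> Suc) (b \<circ> Suc) T) g h"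
proof -
  let ?f = "\<lambda>j. iter_num g h D j ^ a (Suc j) * iter_den g h D j ^ b (Suc j)"
  have pw: "degree (iter_num g h D j ^ k) \<le> D ^ j * k" "degree (iter_den g h D j ^ k) \<le> D ^ j * k" for j k
    using degree_iter[OF assms, of j] degree_power_le[of "iter_num g h D j" k] degree_power_le[of "iter_den g h D j" k]
    by (meson le_trans mult_le_mono1)+
  have deg: "degree (?f j) \<le> D ^ j * a (Suc j) + D ^ j * b (Suc j)" for j
    by (meson add_mono degree_mult_le le_trans pw)
  have "homog (\<Sum>j<T. D ^ j * a (Suc j) + D ^ j * b (Suc j)) (\<Prod>j<T. ?f j) g h =
      (\<Prod>j<T. homog (D ^ j * a (Suc j) + D ^ j * b (Suc j)) (?f j) g h)"
    by (rule homog_prod) (use deg in auto)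
  also have "\<dots> = (\<Prod>j<T. iter_num g h D (Suc j) ^ a (Suc j) * iter_den g h D (Suc j) ^ b (Suc j))"
    using degree_iter[OF assms] pw by (simp add: homog_mult homog_power)
  finally have "homog (\<Sum>j<T. (a (Suc j) + b (Suc j)) * D ^ j) (iter_prod g h D (a \<circ> Suc) (b \<circ> Suc) T) g h
      = (\<Prod>j<T. iter_num g h D (Suc j) ^ a (Suc j) * iter_den g h D (Suc j) ^ b (Suc j))"
    by (simp add: iter_prod_def algebra_simps)
  then show ?thesis
    unfolding iter_prod_def by (subst prod.lessThan_Suc_shift) (simp add: monom_altdef)
qed

text \<open>The part E of D prime to the characteristic is at least 2. A root of 1 + X + ... +
  X^(E-1) is an E-th root of unity, and it is not 1 since the value at 1 is E.\<close>

lemma ex_root_of_unity: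
  assumes "D \<ge> 1" "\<And>l. D \<noteq> CHAR('a::alg_closed_field) ^ l"
  shows "\<exists>\<zeta>::'a. \<zeta> \<noteq> 1 \<and> \<zeta> ^ D = 1"
proof -
  have "\<exists>E. E dvd D \<and> E \<ge> 2 \<and> \<not> CHAR('a) dvd E"
  proof (cases "CHAR('a) = 0")
    case True
    then show ?thesis using assms(1) assms(2)[of 0] by (intro exI[of _ D]) auto
  next
    case False
    then have p: "prime CHAR('a)" using prime_CHAR_semidom by blast
    obtain E where E: "D = CHAR('a) ^ multiplicity CHAR('a) D * E" "\<not> CHAR('a) dvd E"
      using multiplicity_decompose'[of D "CHAR('a)"] p assms(1)
      by (metis not_one_le_zero not_prime_unit)
    have "E \<noteq> 1" using E(1) assms(2) by (metis mult.right_neutral)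
    moreover have "E \<noteq> 0" using E(1) assms(1) by (metis mult_0_right not_one_le_zero)
    moreover have "E dvd D" using E(1) by (metis dvd_triv_right)
    ultimately show ?thesis using E(2) by (intro exI[of _ E]) auto
  qed
  then obtain E where E: "E dvd D" "E \<ge> 2" "\<not> CHAR('a) dvd E" by blast
  define P :: "'a poly" where "P = (\<Sum>i<E. monom 1 i)"
  have "coeff P 1 = 1" unfolding P_def coeff_sum using E(2) by simp
  then have "degree P \<ge> 1" by (intro le_degree) simp
  then have "degree P > 0" by simp
  then obtain \<zeta> where \<zeta>: "poly P \<zeta> = 0" using alg_closed_imp_poly_has_root by blast
  have val: "poly P x = (\<Sum>i<E. x ^ i)" for x by (simp add: P_def poly_sum poly_monom)
  have "\<zeta> \<noteq> 1" using \<zeta> E(3) val[of 1] by (auto simp: of_nat_eq_0_iff_char_dvd)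
  moreover have "\<zeta> ^ E = 1" using \<zeta> val[of \<zeta>] power_diff_1_eq[of \<zeta> E] by simp
  then have "\<zeta> ^ D = 1" using E(1) by (auto elim!: dvdE simp: power_mult)
  ultimately show ?thesis by blast
qed

context coprime_pair
begin

lemma iter_nonzero: "iter_num g h D j \<noteq> 0" "iter_den g h D j \<noteq> 0"
proof -
  have "degree g \<le> D" "degree h \<le> D" using D_def by auto
  then have "iter_num g h D j \<noteq> 0 \<and> iter_den g h D j \<noteq> 0"
    by (induction j) (simp_all add: homog_nonzero degree_iter)
  then show "iter_num g h D j \<noteq> 0" "iter_den g h D j \<noteq> 0" by auto
qed

lemma iter_prod_nonzero: "iter_prod g h D a b T \<noteq> 0"
  by (simp add: iter_prod_def iter_nonzero)

text \<open>If zeta is a root of unity fixing g and h, then a nonzero zero y of the left linear form would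
  force the different point zeta y to be a zero or pole as well.\<close>
lemma linear_form_degenerate:
  assumes fix\<zeta>: "\<And>y. poly g (\<zeta> * y) = poly g y \<and> poly h (\<zeta> * y) = poly h y" "\<zeta> \<noteq> 1" "\<zeta> \<noteq> 0"
    and det: "s0 * t1 \<noteq> s1 * t0" and "M \<ge> 1" "\<gamma> \<noteq> 0"
    and eq: "monom 1 a * homog N P g h * [:t0, s0:] ^ M = smult \<gamma> (monom 1 b * homog N Q g h * [:t1, s1:] ^ M)"
    and "P \<noteq> 0" "Q \<noteq> 0" "degree P \<le> N" "degree Q \<le> N"
  shows "s0 = 0 \<or> t0 = 0"
proof (rule ccontr)
  assume "\<not> (s0 = 0 \<or> t0 = 0)"
  then have st: "s0 \<noteq> 0" "t0 \<noteq> 0" by auto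
  define y where "y = - t0 / s0"
  have y: "y \<noteq> 0" "t0 + y * s0 = 0" using st by (auto simp: y_def)
  have "monom 1 a * [:t0, s0:] ^ M * homog N P g h = smult \<gamma> (monom 1 b * [:t1, s1:] ^ M) * homog N Q g h"
    using eq by (simp add: mult_ac)
  from homog_cancel[OF this assms(8-11)] obtain P' Q' K where
    PQ: "coprime P' Q'" "K = max (degree P') (degree Q')"
    and eq': "monom 1 a * [:t0, s0:] ^ M * homog K P' g h = smult \<gamma> (monom 1 b * [:t1, s1:] ^ M) * homog K Q' g h"
    by blast
  have ev: "x ^ a * (t0 + x * s0) ^ M * poly (homog K P' g h) x
      = \<gamma> * (x ^ b * (t1 + x * s1) ^ M) * poly (homog K Q' g h) x" for x
    using arg_cong[OF eq', of "\<lambda>p. poly p x"] by (simp add: poly_monom)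
  have t1: "t1 + y * s1 \<noteq> 0"
    using det y st by (auto simp: y_def field_simps)
  have "poly (homog K Q' g h) y = 0"
    using ev[of y] y t1 \<open>\<gamma> \<noteq> 0\<close> \<open>M \<ge> 1\<close> by (simp add: power_0_left)
  moreover have same: "poly (homog K R g h) (\<zeta> * y) = poly (homog K R g h) y" for R
    using fix\<zeta>(1) by (simp add: poly_homog)
  ultimately have Q0: "poly (homog K Q' g h) (\<zeta> * y) = 0" by simp
  then have "poly (homog K P' g h) (\<zeta> * y) \<noteq> 0"
    using homog_no_common_zero[OF cop PQ] by blast
  moreover have "t0 + \<zeta> * y * s0 \<noteq> 0"
  proof
    assume "t0 + \<zeta> * y * s0 = 0"
    with y have "(\<zeta> - 1) * (y * s0) = 0" by (simp add: algebra_simps add_eq_0_iff)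
    with fix\<zeta> y st show False by auto
  qed
  ultimately show False using ev[of "\<zeta> * y"] Q0 y fix\<zeta> by simp
qed

theorem iter_independent_step:
  assumes notfrob: "\<And>a b c e l. g = monom a D + [:b:] \<Longrightarrow> h = monom c D + [:e:] \<Longrightarrow> D \<noteq> CHAR('a) ^ l"
    and notmon: "\<And>a b. \<not> (g = monom a D \<and> h = [:b:])" "\<And>a b. \<not> (g = [:a:] \<and> h = monom b D)"
    and eq: "iter_prod g h D a b (Suc T) = iter_prod g h D b a (Suc T)" and less: "a 0 < b 0"
  shows False
proof -
  have dg: "degree g \<le> D" "degree h \<le> D" using D_def by auto
  let ?N = "\<lambda>a b. \<Sum>j<T. (a (Suc j) + b (Suc j)) * D ^ j"
  define N where "N = ?N a b"
  have N: "?N a b = N" "?N b a = N" by (simp_all add: N_def add.commute)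
  let ?P = "iter_prod g h D (b \<circ> Suc) (a \<circ> Suc) T" and ?Q = "iter_prod g h D (a \<circ> Suc) (b \<circ> Suc) T"
  have dP: "degree ?P \<le> N" using degree_iter_prod[OF dg, of "b \<circ> Suc" "a \<circ> Suc" T] N by simp
  have dQ: "degree ?Q \<le> N" using degree_iter_prod[OF dg, of "a \<circ> Suc" "b \<circ> Suc" T] N by simp
  have "monom 1 (a 0) * homog N ?Q g h = monom 1 (b 0) * homog N ?P g h"
    using eq unfolding iter_prod_Suc[OF dg] N .
  also have "monom 1 (b 0) = monom 1 (a 0) * monom (1::'a) (b 0 - a 0)"
    using less by (simp add: mult_monom)
  finally have "monom 1 (a 0) * homog N ?Q g h = monom 1 (a 0) * (monom 1 (b 0 - a 0) * homog N ?P g h)"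
    by (simp only: mult.assoc)
  then have eq1: "monom 1 (b 0 - a 0) * homog N ?P g h = homog N ?Q g h"
    by (subst (asm) mult_cancel_left) auto
  have "b 0 - a 0 > 0" using less by simp
  obtain s0 t0 s1 t1 \<gamma> M where L: "smult s0 g + smult t0 h = monom 1 D"
    "smult s1 g + smult t1 h = 1" "M \<ge> 1" "\<gamma> \<noteq> 0"
    "?P * [:t0, s0:] ^ M = smult \<gamma> (?Q * [:t1, s1:] ^ M)"
    by (rule totally_ramified[OF eq1 \<open>b 0 - a 0 > 0\<close> iter_prod_nonzero iter_prod_nonzero dP dQ])
      (rule that, assumption+)
  \<comment> \<open>By Cramer's rule g and h are combinations of X^D and 1, so both are invariant
    under X to \<zeta> X for any D-th root of unity \<zeta>. If D were a power of the
    characteristic, 1 would be the only one; \<open>notfrob\<close> prevents this.\<close>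
  define \<Delta> where "\<Delta> = s0 * t1 - s1 * t0"
  have gh: "smult \<Delta> g = smult t1 (monom 1 D) - smult t0 1" "smult \<Delta> h = smult s0 1 - smult s1 (monom 1 D)"
    unfolding L(1,2)[symmetric] \<Delta>_def by (simp_all add: smult_add_right smult_diff_left algebra_simps)
  have "\<Delta> \<noteq> 0"
  proof
    assume "\<Delta> = 0"
    then have "smult t1 (monom 1 D) = smult t0 1" "smult s0 1 = smult s1 (monom (1::'a) D)" using gh by auto
    then have "coeff (smult t1 (monom 1 D)) D = coeff (smult t0 1) D"
       "coeff (smult s1 (monom 1 D)) D = coeff (smult s0 1) D" by auto
    then have "t1 = 0" "s1 = 0" using D_pos by (auto simp: coeff_eq_0)
    with L(2) show False by simp
  qed
  have g: "g = monom (t1 / \<Delta>) D + [:- t0 / \<Delta>:]" and h: "h = monom (- s1 / \<Delta>) D + [:s0 / \<Delta>:]"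
    using arg_cong[OF gh(1), of "smult (1 / \<Delta>)"] arg_cong[OF gh(2), of "smult (1 / \<Delta>)"] \<open>\<Delta> \<noteq> 0\<close>
    by (simp_all add: smult_diff_right smult_monom minus_monom one_pCons)
  have "D \<noteq> CHAR('a) ^ l" for l using notfrob[OF g h] .
  from ex_root_of_unity[OF D_pos this] obtain \<zeta> :: 'a where \<zeta>: "\<zeta> \<noteq> 1" "\<zeta> ^ D = 1" by blast
  then have \<zeta>0: "\<zeta> \<noteq> 0" using D_pos by (auto simp: power_0_left)
  have fix\<zeta>: "poly g (\<zeta> * y) = poly g y \<and> poly h (\<zeta> * y) = poly h y" for y
  proof -
    have "poly g x = t1 / \<Delta> * x ^ D - t0 / \<Delta>" "poly h x = - s1 / \<Delta> * x ^ D + s0 / \<Delta>" for x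
      using arg_cong[OF g, of "\<lambda>p. poly p x"] arg_cong[OF h, of "\<lambda>p. poly p x"] by (simp_all add: poly_monom)
    then show ?thesis by (simp add: power_mult_distrib \<zeta>(2))
  qed
  have det: "s0 * t1 \<noteq> s1 * t0" using \<open>\<Delta> \<noteq> 0\<close> \<Delta>_def by auto
  have deg: "(s0 = 0 \<or> t0 = 0) \<and> (s1 = 0 \<or> t1 = 0)"
  proof (cases T)
    case 0
    then have *: "[:t0, s0:] ^ M = smult \<gamma> ([:t1, s1:] ^ M)" using L(5) by (simp add: iter_prod_def)
    have ev: "(t0 + x * s0) ^ M = \<gamma> * (t1 + x * s1) ^ M" for x
      using arg_cong[OF *, of "\<lambda>p. poly p x"] by simp
    have "False"
    proof (cases "s0 = 0")
      case True
      then have "s1 \<noteq> 0" using det by auto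
      then show False using ev[of "- t1 / s1"] L(3) True det by (auto simp: power_0_left)
    next
      case False
      have "(t1 + (- t0 / s0) * s1) ^ M = 0"
        using ev[of "- t0 / s0"] L(3,4) False by (simp add: power_0_left)
      then have "t1 + (- t0 / s0) * s1 = 0" by simp
      with det False show False by (simp add: field_simps)
    qed
    then show ?thesis ..
  next
    case (Suc T')
    let ?a = "a \<circ> Suc" and ?b = "b \<circ> Suc"
    define N2 where "N2 = (\<Sum>j<T'. (?a (Suc j) + ?b (Suc j)) * D ^ j)"
    have N2: "(\<Sum>j<T'. (?a (Suc j) + ?b (Suc j)) * D ^ j) = N2" "(\<Sum>j<T'. (?b (Suc j) + ?a (Suc j)) * D ^ j) = N2"
      by (simp_all add: N2_def add.commute)
    let ?P2 = "iter_prod g h D (?b \<circ> Suc) (?a \<circ> Suc) T'" and ?Q2 = "iter_prod g h D (?a \<circ> Suc) (?b \<circ> Suc) T'"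
    have d2: "degree ?P2 \<le> N2" "degree ?Q2 \<le> N2"
      using degree_iter_prod[OF dg, of "?b \<circ> Suc" "?a \<circ> Suc" T'] N2
        degree_iter_prod[OF dg, of "?a \<circ> Suc" "?b \<circ> Suc" T'] by simp_all
    \<comment> \<open>The identity returned by \<open>totally_ramified\<close> is again a relation
      between products of iterates, now with the two linear forms evaluated at X as additional
      factors. Splitting off X once more brings it into the shape of
      \<open>linear_form_degenerate\<close>.\<close>
    have E: "monom 1 (?b 0) * homog N2 ?P2 g h * [:t0, s0:] ^ M
        = smult \<gamma> (monom 1 (?a 0) * homog N2 ?Q2 g h * [:t1, s1:] ^ M)"
      using L(5) unfolding Suc iter_prod_Suc[OF dg] N2 .
    have "smult (1 / \<gamma>) (monom 1 (?b 0) * homog N2 ?P2 g h * [:t0, s0:] ^ M)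
        = monom 1 (?a 0) * homog N2 ?Q2 g h * [:t1, s1:] ^ M"
      unfolding E using L(4) by simp
    note E' = this[symmetric]
    have "s0 = 0 \<or> t0 = 0"
      using linear_form_degenerate[OF fix\<zeta> \<zeta>(1) \<zeta>0 det L(3,4) E iter_prod_nonzero iter_prod_nonzero d2] .
    moreover have "s1 = 0 \<or> t1 = 0"
      using linear_form_degenerate[OF fix\<zeta> \<zeta>(1) \<zeta>0 det[symmetric] L(3) _ E' iter_prod_nonzero iter_prod_nonzero d2(2,1)] L(4)
      by simp
    ultimately show ?thesis ..
  qed
  show False
  proof (cases "s0 = 0")
    case True
    with det deg have "t1 = 0" by auto
    with g h True have "g = [:- t0 / \<Delta>:]" "h = monom (- s1 / \<Delta>) D" by auto
    with notmon(2) show False by blast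
  next
    case False
    with det deg have "t0 = 0" "s1 = 0" by auto
    with g h have "g = monom (t1 / \<Delta>) D" "h = [:s0 / \<Delta>:]" by auto
    with notmon(1) show False by blast
  qed
qed

theorem iter_independent:
  assumes notfrob: "\<And>a b c e l. g = monom a D + [:b:] \<Longrightarrow> h = monom c D + [:e:] \<Longrightarrow> D \<noteq> CHAR('a) ^ l"
    and notmon: "\<And>a b. \<not> (g = monom a D \<and> h = [:b:])" "\<And>a b. \<not> (g = [:a:] \<and> h = monom b D)"
    and eq: "iter_prod g h D a b T = iter_prod g h D b a T" and "j < T"
  shows "a j = b j"
  using eq \<open>j < T\<close>
proof (induction T arbitrary: a b j)
  case (Suc T)
  have dg: "degree g \<le> D" "degree h \<le> D" using D_def by auto
  have "\<not> a 0 < b 0" "\<not> b 0 < a 0"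
    by (rule notI, rule iter_independent_step[OF _ notmon Suc.prems(1)], use notfrob in blast, assumption)
      (rule notI, rule iter_independent_step[OF _ notmon Suc.prems(1)[symmetric]], use notfrob in blast, assumption)
  then have 0: "a 0 = b 0" by simp
  show ?case
  proof (cases j)
    case (Suc i)
    define N where "N = (\<Sum>j<T. (a (Suc j) + b (Suc j)) * D ^ j)"
    have N: "(\<Sum>j<T. (a (Suc j) + b (Suc j)) * D ^ j) = N" "(\<Sum>j<T. (b (Suc j) + a (Suc j)) * D ^ j) = N"
      by (simp_all add: N_def add.commute)
    let ?P = "iter_prod g h D (b \<circ> Suc) (a \<circ> Suc) T" and ?Q = "iter_prod g h D (a \<circ> Suc) (b \<circ> Suc) T"
    have "monom 1 (a 0) * homog N ?Q g h = monom 1 (b 0) * homog N ?P g h"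
      using Suc.prems(1) unfolding iter_prod_Suc[OF dg] N .
    then have "homog N ?Q g h = homog N ?P g h" using 0 by simp
    then have "?Q = ?P"
      by (rule homog_inj)
        (use degree_iter_prod[OF dg, of "b \<circ> Suc" "a \<circ> Suc" T] degree_iter_prod[OF dg, of "a \<circ> Suc" "b \<circ> Suc" T] N in simp_all)
    from Suc.IH[OF this, of i] Suc Suc.prems(2) show ?thesis by simp
  qed (use 0 in simp)
qed simp

end

text \<open>A Bezout identity is preserved by field extension and carries coprimality over to the
  algebraic closure. It is found through an element of least degree in the ideal of g and h.\<close>

lemma coprime_poly_bezout:
  assumes "coprime g (h::'a::field poly)"
  obtains u v where "u * g + v * h = 1"
proof -
  define I where "I = {p. p \<noteq> 0 \<and> (\<exists>u v. p = u * g + v * h)}"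
  have "g \<noteq> 0 \<or> h \<noteq> 0" using assms by auto
  then have "\<exists>p. p \<in> I"
    unfolding I_def by (metis (mono_tags, lifting) add.left_neutral add.right_neutral mem_Collect_eq mult_1 mult_zero_left)
  then obtain p where p: "p \<in> I" and min: "\<And>p'. p' \<in> I \<Longrightarrow> degree p \<le> degree p'"
    using ex_has_least_nat[of "\<lambda>p. p \<in> I" _ degree] by blast
  obtain u v where uv: "p = u * g + v * h" and "p \<noteq> 0" using p by (auto simp: I_def)
  have dvd: "p dvd x" if "x = a * g + b * h" for x a b
  proof (rule ccontr)
    assume "\<not> p dvd x"
    then have "x mod p \<noteq> 0" by (simp add: dvd_eq_mod_eq_0)
    moreover have "x mod p = (a - (x div p) * u) * g + (b - (x div p) * v) * h"
    proof -
      have "x mod p = x - (x div p) * p" by (simp add: minus_div_mult_eq_mod)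
      also have "\<dots> = (a * g + b * h) - (x div p) * (u * g + v * h)" using that uv by metis
      finally show ?thesis by (simp add: algebra_simps)
    qed
    ultimately have "x mod p \<in> I" unfolding I_def by blast
    from min[OF this] show False
      using degree_mod_less[OF \<open>p \<noteq> 0\<close>, of x] \<open>x mod p \<noteq> 0\<close> by auto
  qed
  have "p dvd g" using dvd[of g 1 0] by simp
  moreover have "p dvd h" using dvd[of h 0 1] by simp
  ultimately have "p dvd 1" using assms coprime_common_divisor by blast
  then obtain w where "1 = p * w" by (auto elim: dvdE)
  then have "(w * u) * g + (w * v) * h = 1" unfolding uv by (simp add: algebra_simps)
  then show ?thesis using that by blast
qed

section \<open>Descent from the algebraic closure\<close>

abbreviation acp :: "'a::field poly \<Rightarrow> 'a alg_closure poly" where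
  "acp \<equiv> map_poly to_ac"

lemma coeff_acp [simp]: "coeff (acp p) i = to_ac (coeff p i)"
  by (simp add: coeff_map_poly)

lemma acp_add: "acp (p + q) = acp p + acp q"
  by (rule poly_eqI) simp

lemma acp_mult: "acp (p * q) = acp p * acp q"
  by (rule poly_eqI) (simp add: coeff_mult to_ac_sum)

lemma acp_power: "acp (p ^ k) = acp p ^ k"
  by (induction k) (simp_all add: acp_mult)

lemma acp_smult: "acp (smult c p) = smult (to_ac c) (acp p)"
  by (rule poly_eqI) simp

lemma acp_sum: "acp (\<Sum>i\<in>A. f i) = (\<Sum>i\<in>A. acp (f i))"
  by (rule poly_eqI) (simp add: coeff_sum to_ac_sum)

lemma acp_prod: "acp (\<Prod>i\<in>A. f i) = (\<Prod>i\<in>A. acp (f i))"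
  by (induction A rule: infinite_finite_induct) (simp_all add: acp_mult)

lemma degree_acp [simp]: "degree (acp p) = degree p"
  by (rule degree_map_poly) simp

lemma acp_homog: "acp (homog N P g h) = homog N (acp P) (acp g) (acp h)"
  by (simp add: homog_def acp_sum acp_smult acp_mult acp_power)

lemma acp_iter: "acp (iter_num g h D j) = iter_num (acp g) (acp h) D j"
  "acp (iter_den g h D j) = iter_den (acp g) (acp h) D j"
  by (induction j) (simp_all add: acp_homog map_poly_pCons)

lemma acp_iter_prod: "acp (iter_prod g h D a b T) = iter_prod (acp g) (acp h) D a b T"
  by (simp add: iter_prod_def acp_prod acp_mult acp_power acp_iter)

lemma acp_eq_binomialD:
  assumes "acp p = monom a D + [:b:]" "D > 0"
  shows "p = monom (coeff p D) D + [:coeff p 0:]"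
proof (rule poly_eqI)
  fix i
  have "to_ac (coeff p i) = coeff (monom a D + [:b:]) i" by (simp flip: assms(1))
  then show "coeff p i = coeff (monom (coeff p D) D + [:coeff p 0:]) i"
    using assms(2) by (cases "i = 0"; cases "i = D") (auto simp: coeff_pCons split: nat.splits)
qed

theorem iter_independent_field:
  fixes g h :: "'a::field poly"
  assumes cop: "coprime g h" and D: "D = max (degree g) (degree h)" "D \<ge> 1"
    and notfrob: "\<And>a b c e l. g = monom a D + [:b:] \<Longrightarrow> h = monom c D + [:e:] \<Longrightarrow> D \<noteq> CHAR('a) ^ l"
    and notmon: "\<And>a b. \<not> (g = monom a D \<and> h = [:b:])" "\<And>a b. \<not> (g = [:a:] \<and> h = monom b D)"
    and eq: "iter_prod g h D a b T = iter_prod g h D b a T" and "j < T"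
  shows "a j = b j"
proof -
  obtain u v where "u * g + v * h = 1" using coprime_poly_bezout[OF cop] .
  from arg_cong[OF this, of acp] have uv: "acp u * acp g + acp v * acp h = 1"
    by (simp add: acp_add acp_mult)
  interpret coprime_pair "acp g" "acp h" D
  proof
    show "coprime (acp g) (acp h)"
    proof (rule coprimeI)
      fix c assume "c dvd acp g" "c dvd acp h"
      then have "c dvd acp u * acp g + acp v * acp h" by simp
      then show "is_unit c" unfolding uv .
    qed
  qed (use D in simp_all)
  have const: "p = [:coeff p 0:]" if "acp p = [:b:]" for p :: "'a poly" and b
    using that by (metis degree_acp degree_pCons_0 degree_0_id)
  have bino: "p = monom (coeff p D) D + [:coeff p 0:]" if "acp p = monom a D + [:b:]" for p :: "'a poly" and a b
    using acp_eq_binomialD[OF that] D(2) by simp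
  have mon: "p = monom (coeff p D) D" if "acp p = monom a D" for p :: "'a poly" and a
  proof -
    have "coeff p 0 = 0" using arg_cong[OF that, of "\<lambda>p. coeff p 0"] D(2) by simp
    then show ?thesis using bino[of p a 0] that by simp
  qed
  show ?thesis
  proof (rule iter_independent[OF _ _ _ _ \<open>j < T\<close>])
    show "D \<noteq> CHAR('a alg_closure) ^ l"
      if "acp g = monom a D + [:b:]" "acp h = monom c D + [:e:]" for a b c e l
      using notfrob[OF bino[OF that(1)] bino[OF that(2)]] by simp
    show "\<not> (acp g = monom a D \<and> acp h = [:b:])" for a b
      using notmon(1) mon const by metis
    show "\<not> (acp g = [:a:] \<and> acp h = monom b D)" for a b
      using notmon(2) mon const by metis
    show "iter_prod (acp g) (acp h) D a b T = iter_prod (acp g) (acp h) D b a T"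
      using arg_cong[OF eq, of acp] by (simp add: acp_iter_prod)
  qed
qed

section \<open>The order of a generator of a finite field extension\<close>

lemma power_card_UNIV: "(x::'a::{field,finite}) ^ card (UNIV :: 'a set) = x"
proof (cases "x = 0")
  case False
  have "x * (\<Prod>y\<in>UNIV-{0}. x * y) = x * x ^ (card (UNIV :: 'a set) - 1) * \<Prod>(UNIV-{0})"
    by (simp add: prod.distrib mult_ac)
  also have "x * x ^ (card (UNIV :: 'a set) - 1) = x ^ Suc (card (UNIV :: 'a set) - 1)"
    by (subst power_Suc) auto
  also have "Suc (card (UNIV :: 'a set) - 1) = card (UNIV :: 'a set)"
    using finite_UNIV_card_ge_0[where ?'a = 'a] by simp
  also have "(\<Prod>y\<in>UNIV-{0}. x * y) = (\<Prod>y\<in>UNIV-{0}. y)"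
    by (rule prod.reindex_bij_witness[of _ "\<lambda>y. y / x" "\<lambda>y. x * y"]) (use False in auto)
  finally show ?thesis by simp
qed (use finite_UNIV_card_ge_0[where ?'a = 'a] in auto)

lemma mult_order_props:
  fixes x :: "'a::{field,finite}"
  assumes "x \<noteq> 0"
  shows "mult_order x > 0" "x ^ mult_order x = 1"
    "x ^ i = 1 \<longleftrightarrow> mult_order x dvd i"
proof -
  have card: "card (UNIV :: 'a set) \<ge> 2"
    using card_mono[of UNIV "{0::'a, 1}"] by auto
  have "x * x ^ (card (UNIV :: 'a set) - 1) = x * 1"
    using power_card_UNIV[of x] card by (simp flip: power_Suc)
  then have "x ^ (card (UNIV :: 'a set) - 1) = 1" using assms by simp
  then have ex: "0 < card (UNIV :: 'a set) - 1 \<and> x ^ (card (UNIV :: 'a set) - 1) = 1"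
    using card by simp
  have r: "0 < mult_order x \<and> x ^ mult_order x = 1"
    unfolding mult_order_def by (rule LeastI[where P = "\<lambda>k. 0 < k \<and> x ^ k = 1", OF ex])
  then show "mult_order x > 0" "x ^ mult_order x = 1" by auto
  show "x ^ i = 1 \<longleftrightarrow> mult_order x dvd i"
  proof
    assume "x ^ i = 1"
    have "x ^ i = (x ^ mult_order x) ^ (i div mult_order x) * x ^ (i mod mult_order x)"
      by (simp flip: power_mult power_add)
    with \<open>x ^ i = 1\<close> r have "x ^ (i mod mult_order x) = 1" by simp
    then have "\<not> 0 < i mod mult_order x"
      using not_less_Least[of "i mod mult_order x" "\<lambda>k. 0 < k \<and> x ^ k = 1"] r
      unfolding mult_order_def[symmetric] by auto
    then show "mult_order x dvd i" by auto
  next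
    assume "mult_order x dvd i"
    then show "x ^ i = 1" using r by (auto elim!: dvdE simp: power_mult)
  qed
qed

lemma power_eq_iff_mult_order:
  fixes x :: "'a::{field,finite}"
  assumes "x \<noteq> 0"
  shows "x ^ i = x ^ j \<longleftrightarrow> int (mult_order x) dvd int i - int j"
proof -
  have *: "x ^ i = x ^ j \<longleftrightarrow> int (mult_order x) dvd int i - int j" if "j \<le> i" for i j
  proof -
    have "x ^ i = x ^ j \<longleftrightarrow> x ^ (i - j) = 1"
      using assms that by (metis le_add_diff_inverse mult_cancel_left2 power_add power_not_zero)
    also have "\<dots> \<longleftrightarrow> int (mult_order x) dvd int (i - j)"
      by (simp add: mult_order_props(3)[OF assms])
    finally show ?thesis using that by (simp add: of_nat_diff)
  qed
  show ?thesis
    using *[of j i] *[of i j] by (metis dvd_diff_commute nat_le_linear)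
qed

locale extension_field =
  fixes q n :: nat and F :: "'a::{field,finite} set"
  assumes q: "primepow q" and card_UNIV: "card (UNIV :: 'a set) = q ^ n" and n: "n \<ge> 1"
    and F_def: "F = {x. x ^ q = x}"
begin

lemma q_CHAR: obtains k where "k \<ge> 1" "q = CHAR('a) ^ k" "prime CHAR('a)"
proof -
  have pr: "prime CHAR('a)"
    using finite_imp_CHAR_pos[where 'a = 'a] prime_CHAR_semidom[where 'a = 'a] by simp
  obtain p k where pk: "prime p" "k > 0" "q = p ^ k" using q by (auto simp: primepow_def)
  \<comment> \<open>Translation by 1 permutes the field, so its cardinality is 0 in it and the
    characteristic divides q^n.\<close>
  have "(\<Sum>x\<in>UNIV. x + 1 :: 'a) = (\<Sum>x\<in>UNIV. x)"
    by (rule sum.reindex_bij_witness[of _ "\<lambda>x. x - 1" "\<lambda>x. x + 1"]) auto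
  then have "of_nat (card (UNIV :: 'a set)) = (0 :: 'a)" by (simp add: sum.distrib)
  then have "CHAR('a) dvd q ^ n" using card_UNIV of_nat_eq_0_iff_char_dvd by metis
  then have "CHAR('a) dvd p" using pk pr by (metis prime_dvd_power)
  then have "CHAR('a) = p" using pk pr by (simp add: primes_dvd_imp_eq)
  then show ?thesis using that[of k] pk pr by simp
qed

lemma q_ge_2: "q \<ge> 2"
  using primepow_gt_Suc_0[OF q] by simp

lemma add_power_q: "(x + y :: 'a) ^ q = x ^ q + y ^ q"
  using freshmans_dream'[of q] q_CHAR by metis

lemma sum_power_q: "(\<Sum>i\<in>A. f i :: 'a) ^ q = (\<Sum>i\<in>A. f i ^ q)"
  using freshmans_dream_sum'[where 'a = 'a and m = q] q_CHAR by metis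

lemma F_closed: "0 \<in> F" "1 \<in> F" "x \<in> F \<Longrightarrow> y \<in> F \<Longrightarrow> x + y \<in> F" "x \<in> F \<Longrightarrow> y \<in> F \<Longrightarrow> x * y \<in> F"
  "x \<in> F \<Longrightarrow> - x \<in> F" "x \<in> F \<Longrightarrow> y \<in> F \<Longrightarrow> x - y \<in> F" "x \<in> F \<Longrightarrow> y \<in> F \<Longrightarrow> x / y \<in> F"
proof -
  have neg: "- x \<in> F" if "x \<in> F" for x
  proof -
    have "x ^ q + (- x) ^ q = 0" using add_power_q[of x "-x"] q_ge_2 by (simp add: power_0_left)
    then show ?thesis using that by (simp add: F_def add_eq_0_iff)
  qed
  show "0 \<in> F" "1 \<in> F" using q_ge_2 by (auto simp: F_def power_0_left)
  show add: "x \<in> F \<Longrightarrow> y \<in> F \<Longrightarrow> x + y \<in> F" for x y by (simp add: F_def add_power_q)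
  show "x \<in> F \<Longrightarrow> y \<in> F \<Longrightarrow> x * y \<in> F" by (simp add: F_def power_mult_distrib)
  show "x \<in> F \<Longrightarrow> - x \<in> F" using neg .
  show "x \<in> F \<Longrightarrow> y \<in> F \<Longrightarrow> x - y \<in> F" using add[of x "-y"] neg[of y] by simp
  show "x \<in> F \<Longrightarrow> y \<in> F \<Longrightarrow> x / y \<in> F" by (simp add: F_def power_divide)
qed

lemma F_power_q: "x \<in> F \<Longrightarrow> x ^ q ^ e = x"
  by (induction e) (auto simp: F_def power_mult)

definition F_poly :: "'a poly \<Rightarrow> bool" where "F_poly P \<longleftrightarrow> (\<forall>i. coeff P i \<in> F)"

lemma F_sum: "(\<And>i. i \<in> A \<Longrightarrow> f i \<in> F) \<Longrightarrow> sum f A \<in> F"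
  by (induction A rule: infinite_finite_induct) (auto simp: F_closed)

lemma F_poly_add: "F_poly P \<Longrightarrow> F_poly Q \<Longrightarrow> F_poly (P + Q)"
  and F_poly_diff: "F_poly P \<Longrightarrow> F_poly Q \<Longrightarrow> F_poly (P - Q)"
  and F_poly_smult: "c \<in> F \<Longrightarrow> F_poly P \<Longrightarrow> F_poly (smult c P)"
  and F_poly_mult: "F_poly P \<Longrightarrow> F_poly Q \<Longrightarrow> F_poly (P * Q)"
  and F_poly_1: "F_poly 1" and F_poly_0: "F_poly 0"
  and F_poly_pCons: "c \<in> F \<Longrightarrow> F_poly P \<Longrightarrow> F_poly (pCons c P)"
  and F_poly_monom: "c \<in> F \<Longrightarrow> F_poly (monom c i)"
  by (auto simp: F_poly_def F_closed coeff_mult coeff_pCons intro!: F_sum split: nat.splits)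

lemma F_poly_X: "F_poly [:0, 1:]"
  by (auto simp: F_poly_def coeff_pCons F_closed split: nat.splits)

lemma F_poly_power: "F_poly P \<Longrightarrow> F_poly (P ^ k)"
  by (induction k) (auto intro: F_poly_mult F_poly_1)

lemma F_poly_prod: "(\<And>i. i \<in> A \<Longrightarrow> F_poly (f i)) \<Longrightarrow> F_poly (prod f A)"
  by (induction A rule: infinite_finite_induct) (auto simp: F_poly_1 intro: F_poly_mult)

lemma F_poly_sum: "(\<And>i. i \<in> A \<Longrightarrow> F_poly (f i)) \<Longrightarrow> F_poly (sum f A)"
  by (induction A rule: infinite_finite_induct) (auto simp: F_poly_0 intro: F_poly_add)

lemma F_poly_homog: "F_poly P \<Longrightarrow> F_poly g \<Longrightarrow> F_poly h \<Longrightarrow> F_poly (homog N P g h)"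
  unfolding homog_def by (intro F_poly_sum F_poly_smult F_poly_mult F_poly_power) (auto simp: F_poly_def)

lemma F_poly_iter:
  assumes "F_poly g" "F_poly h"
  shows "F_poly (iter_num g h D j)" "F_poly (iter_den g h D j)"
  by (induction j) (simp_all add: F_poly_homog assms F_poly_1 F_poly_X)

lemma F_poly_iter_prod: "F_poly g \<Longrightarrow> F_poly h \<Longrightarrow> F_poly (iter_prod g h D a b T)"
  unfolding iter_prod_def by (intro F_poly_prod F_poly_mult F_poly_power F_poly_iter)

lemma poly_power_q:
  assumes "F_poly P" shows "poly P (x ^ q) = poly P x ^ q"
proof -
  have c: "coeff P i ^ q = coeff P i" for i
  proof -
    have "coeff P i \<in> F" using assms by (simp add: F_poly_def)
    then show ?thesis by (simp add: F_def)
  qed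
  have "poly P x ^ q = (\<Sum>i\<le>degree P. (coeff P i * x ^ i) ^ q)"
    by (simp add: poly_altdef sum_power_q)
  also have "\<dots> = poly P (x ^ q)"
    unfolding poly_altdef
    by (intro sum.cong) (simp_all add: c power_mult_distrib mult.commute flip: power_mult)
  finally show ?thesis ..
qed

lemma poly_power_q_power:
  assumes "F_poly P" shows "poly P (x ^ q ^ e) = poly P x ^ q ^ e"
proof (induction e)
  case (Suc e)
  have step: "y ^ q ^ Suc e = (y ^ q ^ e) ^ q" for y :: 'a
    by (simp add: mult.commute flip: power_mult)
  show ?case unfolding step using Suc assms by (simp add: poly_power_q)
qed simp

lemma alg_degree_le:
  assumes "F_poly P" "P \<noteq> 0" "poly P x = 0" shows "alg_degree F x \<le> degree P"
  unfolding alg_degree_def using assms by (intro Least_le) (auto simp: F_poly_def)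

lemma power_qn: "(x::'a) ^ q ^ n = x"
  using power_card_UNIV[of x] card_UNIV by simp

text \<open>The product of X - y over an orbit of the Frobenius map has coefficients in F.\<close>
lemma alg_degree_le_period:
  assumes "x ^ q ^ j = x" "j \<ge> 1" shows "alg_degree F x \<le> j"
proof -
  define P where "P = (\<Prod>i<j. [:- (x ^ q ^ i), 1:])"
  have frob: "map_poly (\<lambda>c. c ^ q) [:- y, 1:] = [:- (y ^ q), 1:]" for y :: 'a
    using add_power_q[of y "-y"] q_ge_2 by (simp add: map_poly_pCons power_0_left add_eq_0_iff)
  have mult: "map_poly (\<lambda>c. c ^ q) (A * B) = map_poly (\<lambda>c. c ^ q) A * map_poly (\<lambda>c. c ^ q) B" for A B :: "'a poly"
    using q_ge_2 by (intro poly_eqI) (simp add: coeff_map_poly coeff_mult sum_power_q power_mult_distrib power_0_left)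
  have prod: "map_poly (\<lambda>c. c ^ q) (prod f A) = (\<Prod>i\<in>A. map_poly (\<lambda>c. c ^ q) (f i))" for f :: "nat \<Rightarrow> 'a poly" and A
    by (induction A rule: infinite_finite_induct) (simp_all add: mult)
  have "map_poly (\<lambda>c. c ^ q) P = (\<Prod>i<j. [:- (x ^ q ^ Suc i), 1:])"
    unfolding P_def prod frob by (simp add: mult.commute flip: power_mult)
  also have "\<dots> = P"
  proof -
    obtain j' where j: "j = Suc j'" using assms by (cases j) auto
    have "(\<Prod>i<Suc j'. [:- (x ^ q ^ Suc i), 1:]) = (\<Prod>i<j'. [:- (x ^ q ^ Suc i), 1:]) * [:- x, 1:]"
      using assms(1) unfolding j by simp
    also have "\<dots> = (\<Prod>i<Suc j'. [:- (x ^ q ^ i), 1:])"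
      by (subst prod.lessThan_Suc_shift) (simp add: mult.commute del: mult_pCons_left mult_pCons_right)
    finally show ?thesis unfolding P_def j .
  qed
  finally have "coeff P i ^ q = coeff P i" for i
    using q_ge_2 by (metis coeff_map_poly power_0_left not_numeral_le_zero)
  then have "coeff P i \<in> F" for i by (simp add: F_def)
  then have "F_poly P" by (simp add: F_poly_def)
  moreover have "P \<noteq> 0" by (simp add: P_def)
  moreover have "poly P x = 0"
    using assms(2) unfolding P_def poly_prod by (intro prod_zero) (auto intro!: bexI[of _ 0])
  moreover have "degree P = j" unfolding P_def by (subst degree_prod_eq_sum_degree) auto
  ultimately show ?thesis using alg_degree_le by metis
qed

lemma degree_dvd_period:
  assumes "alg_degree F x = n" "x ^ q ^ j = x" shows "n dvd j"
proof -
  have iter: "x ^ q ^ (n * i) = x" for i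
    by (induction i) (simp_all add: power_add power_mult power_qn)
  have "x ^ q ^ (j mod n) = (x ^ q ^ (n * (j div n))) ^ q ^ (j mod n)" by (simp add: iter)
  also have "\<dots> = x ^ q ^ j"
    by (simp flip: power_mult power_add)
  finally have "x ^ q ^ (j mod n) = x" using assms(2) by simp
  then have "\<not> j mod n \<ge> 1"
    using alg_degree_le_period[of x "j mod n"] assms(1) n by (metis linorder_not_le mod_less_divisor less_le_trans zero_less_one)
  then show ?thesis by (simp add: dvd_eq_mod_eq_0)
qed

end

section \<open>Relations at \<alpha> and relations between functions\<close>

locale generator = extension_field q n F for q n and F :: "'a::{field,finite} set" +
  fixes g h :: "'a poly" and \<alpha> :: 'a and D e m :: nat
  assumes g: "F_poly g" and h: "F_poly h" and cop: "coprime g h"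
    and D: "D = max (degree g) (degree h)" "D \<ge> 2"
    and deg: "alg_degree F \<alpha> = n" and n2: "n \<ge> 2"
    and m: "m = q ^ e" and root: "poly (monom 1 m * h - g) \<alpha> = 0"
begin

lemma alpha_nz: "\<alpha> \<noteq> 0"
proof
  assume "\<alpha> = 0"
  then have "n \<le> degree [:0, 1 :: 'a:]" using alg_degree_le[of "[:0, 1:]" \<alpha>] deg
    by (auto simp: F_poly_X)
  then show False using n2 by simp
qed

lemma alpha_notin_F: "\<alpha> \<notin> F"
proof
  assume "\<alpha> \<in> F"
  then have "F_poly [:- \<alpha>, 1:]" by (auto simp: F_poly_def coeff_pCons F_closed split: nat.splits)
  from alg_degree_le[OF this, of \<alpha>] show False using deg n2 by simp
qed

abbreviation "r \<equiv> mult_order \<alpha>"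

lemmas r_pos = mult_order_props(1)[OF alpha_nz]

lemma h_alpha: "poly h \<alpha> \<noteq> 0" and g_alpha: "poly g \<alpha> = \<alpha> ^ m * poly h \<alpha>"
proof -
  show *: "poly g \<alpha> = \<alpha> ^ m * poly h \<alpha>" using root by (simp add: poly_monom)
  show "poly h \<alpha> \<noteq> 0" using coprime_poly_0[OF cop, of \<alpha>] * by auto
qed

lemma iter_alpha:
  "poly (iter_den g h D j) \<alpha> \<noteq> 0 \<and> poly (iter_num g h D j) \<alpha> = \<alpha> ^ m ^ j * poly (iter_den g h D j) \<alpha>"
proof (induction j)
  case (Suc j)
  have hom: "poly (homog (D ^ j) P g h) \<alpha> = poly h \<alpha> ^ D ^ j * poly P \<alpha> ^ m" if "F_poly P" "degree P \<le> D ^ j" for P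
    using poly_homog_nz[OF that(2) h_alpha, of g] g_alpha h_alpha poly_power_q_power[OF that(1), of \<alpha> e]
    by (simp add: m)
  have "degree g \<le> D" "degree h \<le> D" using D by auto
  note * = hom[OF F_poly_iter(1)[OF g h] degree_iter(1)[OF this]] hom[OF F_poly_iter(2)[OF g h] degree_iter(2)[OF this]]
  show ?case using Suc h_alpha by (simp add: * power_mult_distrib mult_ac flip: power_mult)
qed simp

lemma iter_prod_alpha:
  "poly (iter_prod g h D a b T) \<alpha> = \<alpha> ^ (\<Sum>j<T. a j * m ^ j) * (\<Prod>j<T. poly (iter_den g h D j) \<alpha> ^ (a j + b j))"
  unfolding iter_prod_def
  by (simp add: poly_prod iter_alpha power_mult_distrib power_add prod.distrib power_sum mult_ac flip: power_mult)

text \<open>The difference of the two sides vanishes at \<alpha>, which has degree n over F.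
  Numerators and denominators both contribute to the degree, so it is governed by a j + b j; this
  makes the weighted L1-norm the right measure of a relation.\<close>

lemma relation_lift:
  assumes "\<alpha> ^ (\<Sum>j<T. a j * m ^ j) = \<alpha> ^ (\<Sum>j<T. b j * m ^ j)" "(\<Sum>j<T. (a j + b j) * D ^ j) < n"
  shows "iter_prod g h D a b T = iter_prod g h D b a T"
proof (rule ccontr)
  assume ne: "iter_prod g h D a b T \<noteq> iter_prod g h D b a T"
  have dg: "degree g \<le> D" "degree h \<le> D" using D by auto
  let ?R = "iter_prod g h D a b T - iter_prod g h D b a T"
  have "poly ?R \<alpha> = 0"
    using assms(1) by (simp add: iter_prod_alpha add.commute)
  moreover have "F_poly ?R" by (intro F_poly_diff F_poly_iter_prod g h)
  ultimately have "n \<le> degree ?R" using alg_degree_le ne deg by force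
  moreover have "degree ?R \<le> (\<Sum>j<T. (a j + b j) * D ^ j)"
    using degree_iter_prod[OF dg, of a b T] degree_iter_prod[OF dg, of b a T]
    by (intro degree_diff_le) (simp_all add: add.commute)
  ultimately show False using assms(2) by simp
qed

end

context generator
begin

lemma lattice_min_if_independent:
  assumes ind: "\<And>a b j. iter_prod g h D a b T = iter_prod g h D b a T \<Longrightarrow> j < T \<Longrightarrow> a j = b j"
  shows "lattice_min D m r n T"
  unfolding lattice_min_def
proof (intro allI impI)
  fix k :: "nat \<Rightarrow> int" and j
  assume small: "(\<Sum>j<T. \<bar>k j\<bar> * int D ^ j) < int n" and dvd: "int r dvd (\<Sum>j<T. k j * int m ^ j)" and "j < T"
  \<comment> \<open>Positive and negative parts, so that a j + b j is the absolute value of k j and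
    not more.\<close>
  define a b where "a = (\<lambda>j. nat (k j))" and "b = (\<lambda>j. nat (- k j))"
  have ab: "int (a j) - int (b j) = k j" "int (a j) + int (b j) = \<bar>k j\<bar>" for j
    by (auto simp: a_def b_def)
  have "int (\<Sum>j<T. a j * m ^ j) - int (\<Sum>j<T. b j * m ^ j) = (\<Sum>j<T. k j * int m ^ j)"
    by (simp flip: sum_subtractf ab add: left_diff_distrib)
  with dvd have "\<alpha> ^ (\<Sum>j<T. a j * m ^ j) = \<alpha> ^ (\<Sum>j<T. b j * m ^ j)"
    using power_eq_iff_mult_order[OF alpha_nz] by metis
  moreover have "int (\<Sum>j<T. (a j + b j) * D ^ j) = (\<Sum>j<T. \<bar>k j\<bar> * int D ^ j)"
    by (simp only: of_nat_sum of_nat_mult of_nat_add of_nat_power ab(2))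
  then have "(\<Sum>j<T. (a j + b j) * D ^ j) < n" using small by linarith
  ultimately have "a j = b j" using relation_lift ind \<open>j < T\<close> by blast
  then show "k j = 0" using ab[of j] by simp
qed

end

context generator
begin

text \<open>(X^r - 1)/(X - 1) has coefficients in F and degree r - 1, and it vanishes at \<alpha>
  because \<alpha> is not 1.\<close>

lemma order_gt_degree: "r \<ge> n + 1"
proof (rule ccontr)
  assume "\<not> r \<ge> n + 1"
  then have rn: "r \<le> n" by simp
  define P :: "'a poly" where "P = (\<Sum>i<r. monom 1 i)"
  have "coeff P 0 = 1" unfolding P_def coeff_sum using r_pos by simp
  then have "P \<noteq> 0" by auto
  have "poly P \<alpha> = (\<Sum>i<r. \<alpha> ^ i)" by (simp add: P_def poly_sum poly_monom)
  moreover have "(\<alpha> - 1) * (\<Sum>i<r. \<alpha> ^ i) = 0"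
    using power_diff_1_eq[of \<alpha> r] mult_order_props(2)[OF alpha_nz] by simp
  moreover have "\<alpha> \<noteq> 1" using alpha_notin_F F_closed(2) by auto
  ultimately have "poly P \<alpha> = 0" by simp
  moreover have "F_poly P" unfolding P_def by (intro F_poly_sum F_poly_monom F_closed)
  ultimately have "n \<le> degree P" using alg_degree_le[of P \<alpha>] \<open>P \<noteq> 0\<close> deg by simp
  moreover have "degree P \<le> r - 1"
    unfolding P_def by (rule degree_sum_le) (auto intro: order_trans[OF degree_monom_le])
  ultimately show False using rn r_pos n2 by simp
qed

lemma q_power_mod_order: "q ^ n mod r = 1"
proof -
  have "q ^ n \<ge> 1" using q_ge_2 by simp
  then have "Suc (q ^ n - 1) = q ^ n" by simp
  then have "\<alpha> * \<alpha> ^ (q ^ n - 1) = \<alpha> * 1"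
    using power_qn[of \<alpha>] by (metis mult.right_neutral power_Suc)
  then have "\<alpha> ^ (q ^ n - 1) = 1" using alpha_nz by simp
  then have "r dvd q ^ n - 1" using mult_order_props(3)[OF alpha_nz] by blast
  then have "q ^ n mod r = 1 mod r"
    using \<open>q ^ n \<ge> 1\<close> by (metis mod_eq_dvd_iff_nat)
  then show ?thesis using order_gt_degree n2 by simp
qed

end


section \<open>Iterates of a / (X^(p^l) + b)\<close>

locale frobenius_generator = generator q n F g h \<alpha> D e m
  for q n :: nat and F :: "'a::{field,finite} set" and g h \<alpha> D e m +
  fixes A B c :: 'a and l :: nat
  assumes g_eq: "g = [:A:]" and h_eq: "h = monom c D + [:B:]" and D_eq: "D = CHAR('a) ^ l"
    and nz: "A \<noteq> 0" "B \<noteq> 0" "c \<noteq> 0"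
begin

definition "a = A / c"
definition "b = B / c"

lemma F_abc: "a \<in> F" "b \<in> F" and ab_nz: "a \<noteq> 0" "b \<noteq> 0"
proof -
  have "coeff g 0 \<in> F" "coeff h D \<in> F" "coeff h 0 \<in> F" using g h by (simp_all add: F_poly_def)
  then have "A \<in> F" "c \<in> F" "B \<in> F" using D(2) by (simp_all add: g_eq h_eq coeff_pCons split: nat.splits)
  then show "a \<in> F" "b \<in> F" by (auto simp: a_def b_def intro: F_closed)
  show "a \<noteq> 0" "b \<noteq> 0" using nz by (simp_all add: a_def b_def)
qed

lemma alpha_m: "\<alpha> ^ m * (\<alpha> ^ D + b) = a"
proof -
  have "A = \<alpha> ^ m * (c * \<alpha> ^ D + B)" using g_alpha by (simp add: g_eq h_eq poly_monom)
  then have "a = \<alpha> ^ m * (c * \<alpha> ^ D + B) / c" unfolding a_def by (rule arg_cong)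
  also have "\<dots> = \<alpha> ^ m * (\<alpha> ^ D + b)" using nz by (simp add: b_def field_simps)
  finally show ?thesis ..
qed

lemma prime_CHAR: "prime CHAR('a)"
  using q_CHAR by metis

lemma diff_power_CHAR: "(x - y :: 'a) ^ (CHAR('a) ^ k) = x ^ (CHAR('a) ^ k) - y ^ (CHAR('a) ^ k)"
proof -
  have "x ^ (CHAR('a) ^ k) = ((x - y) + y) ^ (CHAR('a) ^ k)" by simp
  also have "\<dots> = (x - y) ^ (CHAR('a) ^ k) + y ^ (CHAR('a) ^ k)"
    by (rule freshmans_dream'[OF prime_CHAR refl])
  finally show ?thesis by simp
qed

lemma m_CHAR: obtains k where "m = CHAR('a) ^ k"
proof -
  obtain k where "q = CHAR('a) ^ k" using q_CHAR by metis
  then have "m = CHAR('a) ^ (k * e)" by (simp add: m power_mult)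
  then show ?thesis using that by blast
qed

lemma diff_power_m: "(x - y :: 'a) ^ m = x ^ m - y ^ m"
  and diff_power_mk: "(x - y :: 'a) ^ m ^ k = x ^ m ^ k - y ^ m ^ k"
  and diff_power_Dk: "(x - y :: 'a) ^ D ^ k = x ^ D ^ k - y ^ D ^ k"
  and diff_power_D: "(x - y :: 'a) ^ D = x ^ D - y ^ D"
proof -
  obtain j where j: "m = CHAR('a) ^ j" using m_CHAR .
  show "(x - y) ^ m = x ^ m - y ^ m" unfolding j by (rule diff_power_CHAR)
  show "(x - y) ^ m ^ k = x ^ m ^ k - y ^ m ^ k"
    unfolding j power_mult[symmetric] by (rule diff_power_CHAR)
  show "(x - y) ^ D ^ k = x ^ D ^ k - y ^ D ^ k"
    unfolding D_eq power_mult[symmetric] by (rule diff_power_CHAR)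
  show "(x - y) ^ D = x ^ D - y ^ D" unfolding D_eq by (rule diff_power_CHAR)
qed

lemma power_Dk_inj: "(x :: 'a) ^ D ^ k = y ^ D ^ k \<Longrightarrow> x = y"
  using diff_power_Dk[of x y k] by simp

lemma power_D_inj: "(x :: 'a) ^ D = y ^ D \<Longrightarrow> x = y"
  using power_Dk_inj[of x 1 y] by simp

definition D_root :: "'a \<Rightarrow> 'a" where "D_root = inv_into UNIV (\<lambda>x. x ^ D)"

lemma D_root_power [simp]: "D_root x ^ D = x"
proof -
  have "inj (\<lambda>x :: 'a. x ^ D)" using power_D_inj by (auto intro: injI)
  then have "surj (\<lambda>x :: 'a. x ^ D)" by (rule finite_UNIV_inj_surj[OF finite])
  then show ?thesis unfolding D_root_def by (rule surj_f_inv_f)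
qed

lemma D_root_F: "x \<in> F \<Longrightarrow> D_root x \<in> F"
proof -
  assume "x \<in> F"
  then have "(D_root x ^ q) ^ D = D_root x ^ D"
    by (metis (mono_tags, lifting) F_def mem_Collect_eq mult.commute power_mult D_root_power)
  then have "D_root x ^ q = D_root x" by (rule power_D_inj)
  then show "D_root x \<in> F" by (simp add: F_def)
qed

lemma F_power: "x \<in> F \<Longrightarrow> x ^ k \<in> F"
  by (induction k) (auto simp: F_closed)

lemma F_power_m: "x \<in> F \<Longrightarrow> x ^ m = x"
  by (simp add: m F_power_q)

lemma F_power_mk: "x \<in> F \<Longrightarrow> x ^ m ^ k = x"
  by (induction k) (simp_all add: F_power_m power_mult)

text \<open>The backward orbit of infinity under g/h; having reached 0 it starts again, because a / 0 = 0.\<close>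
primrec zeta :: "nat \<Rightarrow> 'a" where
  "zeta 0 = D_root (- b)"
| "zeta (Suc i) = D_root (a / zeta i - b)"

lemma zeta_F: "zeta i \<in> F"
  by (induction i) (auto intro!: D_root_F F_closed F_abc)

text \<open>The differences of \<alpha> and the points of the backward orbit of 0, which is 0,
  infinity, \<open>zeta 0\<close>, \<open>zeta 1\<close> and so on; the factor belonging to infinity
  is 1.\<close>

definition orbit_diff :: "nat \<Rightarrow> 'a" where
  "orbit_diff j = (if j = 0 then \<alpha> else if j = 1 then 1 else \<alpha> - zeta (j - 2))"

definition step_coeff :: "nat \<Rightarrow> 'a" where
  "step_coeff j = (if j = 0 then a else if j = 1 then 1 else - zeta (j - 2))"

lemma orbit_diff_nz: "orbit_diff j \<noteq> 0"
  using alpha_nz alpha_notin_F zeta_F by (auto simp: orbit_diff_def)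

lemma step_coeff_F: "step_coeff j \<in> F"
  using zeta_F F_abc by (auto simp: step_coeff_def intro: F_closed)

lemma step_coeff_nz: "(j \<ge> 2 \<Longrightarrow> zeta (j - 2) \<noteq> 0) \<Longrightarrow> step_coeff j \<noteq> 0"
  using ab_nz by (auto simp: step_coeff_def)

text \<open>For a finite point P with a finite preimage, \<alpha>^m - P = f(\<alpha>) - P, and f - P
  has a zero of order D at the only preimage of P and a pole of order D at \<open>zeta 0\<close>.
  The same formula holds for 0 and infinity, with \<open>step_coeff\<close> as the constant.\<close>

lemma orbit_diff_step:
  assumes "j \<ge> 2 \<Longrightarrow> zeta (j - 2) \<noteq> 0"
  shows "orbit_diff j ^ m = step_coeff j * orbit_diff (Suc j) ^ D / orbit_diff 2 ^ D"
proof -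
  have u2: "orbit_diff 2 ^ D = \<alpha> ^ D + b" by (simp add: orbit_diff_def diff_power_D)
  have nz2: "\<alpha> ^ D + b \<noteq> 0" using orbit_diff_nz[of 2] u2 by (metis power_not_zero)
  have am: "\<alpha> ^ m = a / (\<alpha> ^ D + b)" using alpha_m nz2 by (simp add: eq_divide_eq)
  consider "j = 0" | "j = 1" | i where "j = Suc (Suc i)" by (metis One_nat_def not0_implies_Suc)
  then show ?thesis
  proof cases
    case 1
    then show ?thesis unfolding u2 using am by (simp add: orbit_diff_def step_coeff_def)
  next
    case 2
    then show ?thesis using orbit_diff_nz[of 2] by (simp add: step_coeff_def orbit_diff_def flip: numeral_2_eq_2)
  next
    case 3
    then have z: "zeta i \<noteq> 0" using assms by simp
    have "orbit_diff j ^ m = \<alpha> ^ m - zeta i"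
      using 3 zeta_F F_power_m by (simp add: orbit_diff_def diff_power_m)
    moreover have "orbit_diff (Suc j) ^ D = \<alpha> ^ D - (a / zeta i - b)" using 3 by (simp add: orbit_diff_def diff_power_D)
    moreover have "a / (\<alpha> ^ D + b) - zeta i = - zeta i * (\<alpha> ^ D - (a / zeta i - b)) / (\<alpha> ^ D + b)"
      using z nz2 by (simp add: divide_simps) (simp add: algebra_simps)
    ultimately show ?thesis unfolding u2 using 3 am by (simp add: step_coeff_def)
  qed
qed

text \<open>The sum of m^k D^(i-k) over k \<le> i, so that \<alpha> to this power is the product of
  the f_k(\<alpha>) to the powers D^(i-k).\<close>

primrec tele_exp :: "nat \<Rightarrow> nat" where
  "tele_exp 0 = 1"
| "tele_exp (Suc i) = D ^ Suc i + m * tele_exp i"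

primrec tele_coeff :: "nat \<Rightarrow> 'a" where
  "tele_coeff 0 = 1"
| "tele_coeff (Suc i) = tele_coeff i * (a / step_coeff (Suc i)) ^ D ^ i"

lemma tele_coeff_F: "tele_coeff i \<in> F"
  by (induction i) (auto intro!: F_closed F_power F_abc step_coeff_F)

text \<open>The products of the iterates of g/h weighted by powers of D telescope.\<close>
lemma alpha_tele_exp:
  assumes "\<And>k. k + 2 \<le> i \<Longrightarrow> zeta k \<noteq> 0"
  shows "\<alpha> ^ tele_exp i = tele_coeff i * (\<alpha> / orbit_diff (Suc i)) ^ D ^ i \<and> tele_coeff i \<noteq> 0"
  using assms
proof (induction i)
  case 0
  then show ?case by (simp add: orbit_diff_def)
next
  case (Suc i)
  then have IH: "\<alpha> ^ tele_exp i = tele_coeff i * (\<alpha> / orbit_diff (Suc i)) ^ D ^ i" "tele_coeff i \<noteq> 0" by auto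
  have ccn: "step_coeff (Suc i) \<noteq> 0"
    using Suc.prems by (intro step_coeff_nz) (metis add_2_eq_Suc' le_add_diff_inverse2 order_refl)
  have st: "orbit_diff (Suc i) ^ m = step_coeff (Suc i) * orbit_diff (Suc (Suc i)) ^ D / orbit_diff 2 ^ D"
    using Suc.prems by (intro orbit_diff_step) (metis add_2_eq_Suc' le_add_diff_inverse2 order_refl)
  have "\<alpha> ^ m = a / orbit_diff 2 ^ D"
    using orbit_diff_step[of 0] by (simp add: orbit_diff_def[of 0] orbit_diff_def[of "Suc 0"] step_coeff_def[of 0])
  then have "(\<alpha> / orbit_diff (Suc i)) ^ m = (a / step_coeff (Suc i)) * (1 / orbit_diff (Suc (Suc i))) ^ D"
    unfolding power_divide st using orbit_diff_nz[of 2] by (simp add: power_divide)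
  then have st': "((\<alpha> / orbit_diff (Suc i)) ^ m) ^ D ^ i = (a / step_coeff (Suc i)) ^ D ^ i * (1 / orbit_diff (Suc (Suc i))) ^ (D * D ^ i)"
    by (simp only: power_mult_distrib power_mult)
  have "(\<alpha> ^ tele_exp i) ^ m = tele_coeff i * ((\<alpha> / orbit_diff (Suc i)) ^ m) ^ D ^ i"
    unfolding IH(1) power_mult_distrib F_power_m[OF tele_coeff_F] by (simp add: mult.commute flip: power_mult)
  then have "(\<alpha> ^ tele_exp i) ^ m = tele_coeff i * ((a / step_coeff (Suc i)) ^ D ^ i * (1 / orbit_diff (Suc (Suc i))) ^ (D * D ^ i))"
    unfolding st' .
  then have "\<alpha> ^ tele_exp (Suc i) = tele_coeff (Suc i) * (\<alpha> / orbit_diff (Suc (Suc i))) ^ D ^ Suc i"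
    by (simp add: power_add power_divide mult.commute[of m] power_mult)
  moreover have "tele_coeff (Suc i) \<noteq> 0" using IH(2) ccn ab_nz by simp
  ultimately show ?case by blast
qed

text \<open>Applying f to equal points of the orbit leads back to \<open>zeta 0\<close> equal to a
  later point, which is impossible: the former is mapped to infinity, the latter to a finite
  point.\<close>

lemma zeta_distinct:
  assumes "\<And>k. k < j \<Longrightarrow> zeta k \<noteq> 0" "i < j" shows "zeta i \<noteq> zeta j"
  using assms
proof (induction i arbitrary: j)
  case 0
  then obtain k where k: "j = Suc k" by (cases j) auto
  then have zk: "zeta k \<noteq> 0" using 0 by simp
  show ?case
  proof
    assume "zeta 0 = zeta j"
    then have "zeta 0 ^ D = zeta j ^ D" by simp
    then have "a / zeta k = 0" by (simp add: k)
    with zk ab_nz show False by simp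
  qed
next
  case (Suc i)
  then obtain k where k: "j = Suc k" by (cases j) auto
  have "zeta i \<noteq> zeta k" using Suc k by simp
  moreover have "zeta i \<noteq> 0" "zeta k \<noteq> 0" using Suc k by simp_all
  ultimately have "a / zeta i \<noteq> a / zeta k" using ab_nz by (simp add: field_simps)
  moreover have "zeta (Suc i) ^ D = a / zeta i - b" "zeta (Suc k) ^ D = a / zeta k - b" by simp_all
  ultimately show ?case unfolding k by (metis diff_add_cancel)
qed

text \<open>The i-th telescoped product is (X / \<open>pole_factor i\<close>)^(D^i) up to a
  constant. For i = 0 it is X itself, whose only pole is infinity, so the points of the orbit are
  shifted by one.\<close>

definition pole_factor :: "nat \<Rightarrow> 'a poly" where
  "pole_factor i = (if i = 0 then 1 else [:- zeta (i - 1), 1:])"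

definition pole_prod :: "nat \<Rightarrow> (nat \<Rightarrow> nat) \<Rightarrow> 'a poly" where
  "pole_prod T x = (\<Prod>i\<le>T. pole_factor i ^ (D ^ i * x i))"

lemma poly_pole_factor: "poly (pole_factor i) \<alpha> = orbit_diff (Suc i)"
  by (simp add: pole_factor_def orbit_diff_def)

lemma F_poly_pole_prod: "F_poly (pole_prod T x)"
proof -
  have "F_poly (pole_factor i)" for i
    using zeta_F[of "i - 1"] by (auto simp: pole_factor_def F_poly_1 F_poly_def coeff_pCons F_closed split: nat.splits)
  then show ?thesis unfolding pole_prod_def by (intro F_poly_prod F_poly_power)
qed

lemma degree_pole_prod: "degree (pole_prod T x) \<le> (\<Sum>i\<le>T. x i * D ^ i)"
proof -
  have "degree (pole_factor i ^ k) \<le> k" for i k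
    using degree_power_le[of "pole_factor i" k] by (auto simp: pole_factor_def)
  then show ?thesis unfolding pole_prod_def
    by (intro order_trans[OF degree_prod_sum_le] sum_mono) (simp_all add: mult.commute)
qed

lemma pole_prod_nz: "pole_prod T x \<noteq> 0"
  by (simp add: pole_prod_def pole_factor_def)

lemma order_pole_prod:
  assumes "\<And>k. k < T \<Longrightarrow> zeta k \<noteq> 0" "i \<ge> 1" "i \<le> T"
  shows "order (zeta (i - 1)) (pole_prod T x) = D ^ i * x i"
proof -
  let ?z = "zeta (i - 1)"
  have other: "poly (pole_factor j) ?z \<noteq> 0" if "j \<noteq> i" "j \<le> T" for j
  proof (cases "j = 0")
    case False
    have "zeta (j - 1) \<noteq> ?z"
    proof (cases "j < i")
      case True
      show ?thesis by (rule zeta_distinct) (use assms True False in auto)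
    next
      case False
      have "?z \<noteq> zeta (j - 1)"
        by (rule zeta_distinct) (use assms(1,2) that False in auto)
      then show ?thesis ..
    qed
    then show ?thesis using False by (simp add: pole_factor_def)
  qed (simp add: pole_factor_def)
  have "pole_prod T x = pole_factor i ^ (D ^ i * x i) * (\<Prod>j\<in>{..T} - {i}. pole_factor j ^ (D ^ j * x j))"
    unfolding pole_prod_def using assms by (subst prod.remove[of _ i]) auto
  moreover have "poly (\<Prod>j\<in>{..T} - {i}. pole_factor j ^ (D ^ j * x j)) ?z \<noteq> 0"
    using other by (auto simp: poly_prod)
  then have "order ?z (\<Prod>j\<in>{..T} - {i}. pole_factor j ^ (D ^ j * x j)) = 0" by (rule order_0I)
  moreover have "pole_factor i = [:- ?z, 1:]" using assms by (simp add: pole_factor_def)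
  ultimately show ?thesis
    using pole_prod_nz[of T x] by (simp add: order_mult order_power_n_n)
qed

text \<open>The i-th telescoped product has a power of X as numerator, so in an equality between two
  products only X^(S x - S y) has to be cleared besides the poles. The degree is then at most the
  larger of S x and S y, not their sum, and the entire simplex of size n injects into the residues
  modulo r.\<close>

lemma simplex_count_le:
  assumes zn: "\<And>k. k < T \<Longrightarrow> zeta k \<noteq> 0"
  shows "simplex_count D T n \<le> r"
proof -
  define E where "E = (\<lambda>x. \<Prod>i\<le>T. tele_coeff i ^ x i)"
  define S where "S = (\<lambda>x. \<Sum>i\<le>T. x i * D ^ i)"
  have w: "\<alpha> ^ tele_exp i = tele_coeff i * (\<alpha> / orbit_diff (Suc i)) ^ D ^ i" "tele_coeff i \<noteq> 0" if "i \<le> T" for i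
    using alpha_tele_exp[of i] zn that by auto
  have E: "E x \<in> F" "E x \<noteq> 0" for x
  proof -
    have prodF: "prod f I \<in> F" if "\<And>i. i \<in> I \<Longrightarrow> f i \<in> F" for f :: "nat \<Rightarrow> 'a" and I
      using that by (induction I rule: infinite_finite_induct) (auto simp: F_closed)
    show "E x \<in> F" unfolding E_def by (rule prodF) (intro F_power tele_coeff_F)
    show "E x \<noteq> 0" unfolding E_def using w by auto
  qed
  have val: "\<alpha> ^ (\<Sum>i\<le>T. tele_exp i * x i) * poly (pole_prod T x) \<alpha> = E x * \<alpha> ^ S x" for x
  proof -
    have "\<alpha> ^ (\<Sum>i\<le>T. tele_exp i * x i) = (\<Prod>i\<le>T. (\<alpha> ^ tele_exp i) ^ x i)"
      by (simp add: power_sum power_mult)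
    also have "\<dots> = (\<Prod>i\<le>T. tele_coeff i ^ x i * (\<alpha> / orbit_diff (Suc i)) ^ (D ^ i * x i))"
      by (intro prod.cong) (simp_all add: w power_mult_distrib power_mult)
    finally have "\<alpha> ^ (\<Sum>i\<le>T. tele_exp i * x i) * poly (pole_prod T x) \<alpha>
      = (\<Prod>i\<le>T. tele_coeff i ^ x i * (\<alpha> / orbit_diff (Suc i)) ^ (D ^ i * x i) * orbit_diff (Suc i) ^ (D ^ i * x i))"
      by (simp add: pole_prod_def poly_prod poly_pole_factor prod.distrib)
    also have "\<dots> = (\<Prod>i\<le>T. tele_coeff i ^ x i * \<alpha> ^ (D ^ i * x i))"
      using orbit_diff_nz by (intro prod.cong) (simp_all add: power_divide)
    also have "\<dots> = E x * \<alpha> ^ S x"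
      by (simp add: E_def S_def prod.distrib power_sum mult.commute)
    finally show ?thesis .
  qed
  have main: "x = y" if xy: "x \<in> simplex D T n" "y \<in> simplex D T n" "S y \<le> S x"
    and eq: "\<alpha> ^ (\<Sum>i\<le>T. tele_exp i * x i) = \<alpha> ^ (\<Sum>i\<le>T. tele_exp i * y i)" for x y
  proof -
    have Sx: "S x < n" using xy by (simp add: S_def simplex_def)
    let ?P = "smult (E x) (monom 1 (S x - S y) * pole_prod T y)" and ?Q = "smult (E y) (pole_prod T x)"
    have "\<alpha> ^ (\<Sum>i\<le>T. tele_exp i * x i) * poly (pole_prod T x) \<alpha> * (E y * \<alpha> ^ S y)
       = E x * \<alpha> ^ S x * (\<alpha> ^ (\<Sum>i\<le>T. tele_exp i * y i) * poly (pole_prod T y) \<alpha>)"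
      unfolding val by (simp add: mult_ac)
    then have "poly (pole_prod T x) \<alpha> * (E y * \<alpha> ^ S y) = E x * \<alpha> ^ S x * poly (pole_prod T y) \<alpha>"
      unfolding eq using alpha_nz by (simp add: mult_ac)
    moreover have "\<alpha> ^ S x = \<alpha> ^ (S x - S y) * \<alpha> ^ S y" using xy(3) by (simp flip: power_add)
    ultimately have "poly (?P - ?Q) \<alpha> = 0"
      using alpha_nz by (simp add: poly_monom mult_ac)
    moreover have "F_poly (?P - ?Q)"
      by (intro F_poly_diff F_poly_smult F_poly_mult F_poly_monom F_poly_pole_prod E) (simp add: F_closed)
    moreover have "degree (?P - ?Q) < n"
    proof -
      have "degree (monom 1 (S x - S y) * pole_prod T y) \<le> (S x - S y) + S y"
        using degree_pole_prod[of T y] degree_monom_le[of "1::'a" "S x - S y"] unfolding S_def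
        by (intro order_trans[OF degree_mult_le] add_mono) auto
      then have "degree ?P \<le> S x" using xy(3) E by simp
      moreover have "degree ?Q \<le> S x" using degree_pole_prod[of T x] E by (simp add: S_def)
      ultimately have "degree (?P - ?Q) \<le> S x" by (rule degree_diff_le)
      then show ?thesis using Sx by simp
    qed
    ultimately have PQ: "?P = ?Q" using alg_degree_le[of "?P - ?Q" \<alpha>] deg by force
    \<comment> \<open>Since 0 is not a pole, evaluating at 0 gives S x = S y. The pole orders then
      yield x i for i \<ge> 1, and x 0 follows from S x = S y.\<close>
    have V0: "poly (pole_prod T z) 0 \<noteq> 0" for z
      using zn by (auto simp: pole_prod_def poly_prod pole_factor_def)
    have SS: "S x = S y"
    proof (rule ccontr)
      assume "S x \<noteq> S y"
      then have "poly ?P 0 = 0" using xy(3) by (simp add: poly_monom power_0_left)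
      with PQ V0[of x] E show False by simp
    qed
    have "smult (E x) (pole_prod T y) = smult (E y) (pole_prod T x)" using PQ SS by simp
    then have ord: "order z (pole_prod T x) = order z (pole_prod T y)" for z
      using E by (metis order_smult)
    have pos: "x i = y i" if "1 \<le> i" "i \<le> T" for i
      using order_pole_prod[OF zn that, of x] order_pole_prod[OF zn that, of y] ord D(2) by simp
    have S0: "S z = z 0 + (\<Sum>i=1..T. z i * D ^ i)" for z
      unfolding S_def by (simp add: sum.atMost_shift sum.atLeast1_atMost_eq)
    have "(\<Sum>i=1..T. x i * D ^ i) = (\<Sum>i=1..T. y i * D ^ i)" using pos by (intro sum.cong) auto
    with SS have "x 0 = y 0" unfolding S0 by simp
    show "x = y"
    proof
      fix i
      show "x i = y i"
        using pos[of i] \<open>x 0 = y 0\<close> xy by (cases "i = 0"; cases "i \<le> T") (auto simp: simplex_def)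
    qed
  qed
  let ?f = "\<lambda>x. (\<Sum>i\<le>T. tele_exp i * x i) mod r"
  have "inj_on ?f (simplex D T n)"
  proof (rule inj_onI)
    fix x y assume xy: "x \<in> simplex D T n" "y \<in> simplex D T n" "?f x = ?f y"
    then have "int r dvd int (\<Sum>i\<le>T. tele_exp i * x i) - int (\<Sum>i\<le>T. tele_exp i * y i)"
      by (metis mod_eq_dvd_iff of_nat_mod)
    then have eq: "\<alpha> ^ (\<Sum>i\<le>T. tele_exp i * x i) = \<alpha> ^ (\<Sum>i\<le>T. tele_exp i * y i)"
      using power_eq_iff_mult_order[OF alpha_nz] by blast
    show "x = y"
      using main[of x y] main[of y x] xy eq by (metis nat_le_linear)
  qed
  moreover have "?f ` simplex D T n \<subseteq> {..<r}" using r_pos by auto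
  ultimately have "card (simplex D T n) \<le> card {..<r}" by (rule card_inj_on_le) auto
  then show ?thesis using card_simplex[of D T n] D(2) by simp
qed

text \<open>When the orbit returns to 0, numerator and denominator of the telescoped product
  coincide at index N + 1, so this power of \<alpha> is a constant of F, and its (q - 1)-st power is
  1.\<close>

lemma periodic_order:
  assumes zn: "\<And>k. k < N \<Longrightarrow> zeta k \<noteq> 0" and z0: "zeta N = 0" and N: "N \<ge> 1"
  shows "r dvd (q - 1) * tele_exp (N + 1)"
proof -
  have "\<alpha> ^ tele_exp (N + 1) = tele_coeff (N + 1)"
    using alpha_tele_exp[of "N + 1"] zn z0 alpha_nz by (simp add: orbit_diff_def)
  then have "(\<alpha> ^ tele_exp (N + 1)) ^ q = \<alpha> ^ tele_exp (N + 1)" using tele_coeff_F[of "N + 1"] by (simp add: F_def)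
  then have "\<alpha> ^ tele_exp (N + 1) * (\<alpha> ^ tele_exp (N + 1)) ^ (q - 1) = \<alpha> ^ tele_exp (N + 1) * 1"
    using q_ge_2 by (simp flip: power_Suc)
  then have "\<alpha> ^ ((q - 1) * tele_exp (N + 1)) = 1" using alpha_nz by (simp flip: power_mult add: mult.commute)
  then show ?thesis using mult_order_props(3)[OF alpha_nz] by blast
qed

text \<open>After a full period both tau and 1 - tau are mapped to constant multiples of their D^P-th powers
  by the m^P-th power map; as tau is not in F, both constants are 1.\<close>
lemma periodic_degree:
  assumes zn: "\<And>k. k < N \<Longrightarrow> zeta k \<noteq> 0" and z0: "zeta N = 0" and N: "N \<ge> 1" and Dm: "D \<le> m"
  obtains s where "CHAR('a) ^ s * D = m" "n dvd s * (N + 2)"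
proof -
  \<comment> \<open>The cycle consists of 0, infinity and \<open>zeta 0\<close> to
    \<open>zeta (N - 1)\<close>; the next point \<open>zeta N\<close> is 0 again.\<close>
  define P where "P = N + 2"
  have P: "P \<ge> 3" using N by (simp add: P_def)
  have step: "orbit_diff j ^ m = step_coeff j * orbit_diff ((j + 1) mod P) ^ D / orbit_diff 2 ^ D" "step_coeff j \<noteq> 0" if "j < P" for j
  proof -
    have *: "zeta (j - 2) \<noteq> 0" if "j \<ge> 2" using zn that \<open>j < P\<close> by (simp add: P_def)
    then show "step_coeff j \<noteq> 0" by (rule step_coeff_nz)
    have "orbit_diff (Suc j) = orbit_diff ((j + 1) mod P)"
    proof (cases "j + 1 = P")
      case True
      then have "j = N + 1" by (simp add: P_def)
      then have "orbit_diff (Suc j) = \<alpha>" using z0 by (simp add: orbit_diff_def)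
      moreover have "orbit_diff ((j + 1) mod P) = \<alpha>" unfolding True by (simp add: orbit_diff_def)
      ultimately show ?thesis by simp
    qed (use that in simp)
    then show "orbit_diff j ^ m = step_coeff j * orbit_diff ((j + 1) mod P) ^ D / orbit_diff 2 ^ D" using orbit_diff_step[of j] * by simp
  qed
  \<comment> \<open>Quotients are taken because the factor \<open>orbit_diff 2 ^ D\<close> is common
    to all steps and cancels.\<close>
  have ratio: "\<exists>C\<in>F. (orbit_diff j / orbit_diff j') ^ m ^ k = C * (orbit_diff ((j + k) mod P) / orbit_diff ((j' + k) mod P)) ^ D ^ k"
    if "j < P" "j' < P" for j j' k
  proof (induction k)
    case 0
    then show ?case using that by (intro bexI[of _ 1]) (auto simp: F_closed)
  next
    case (Suc k)
    then obtain C where C: "C \<in> F" "(orbit_diff j / orbit_diff j') ^ m ^ k = C * (orbit_diff ((j + k) mod P) / orbit_diff ((j' + k) mod P)) ^ D ^ k" by blast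
    let ?i = "(j + k) mod P" and ?i' = "(j' + k) mod P"
    have lt: "?i < P" "?i' < P" using P by auto
    have idx: "(?i + 1) mod P = (j + Suc k) mod P" "(?i' + 1) mod P = (j' + Suc k) mod P"
      by (simp_all add: mod_Suc_eq)
    have st: "(orbit_diff ?i / orbit_diff ?i') ^ m = step_coeff ?i / step_coeff ?i' * (orbit_diff ((j + Suc k) mod P) / orbit_diff ((j' + Suc k) mod P)) ^ D"
      unfolding power_divide step(1)[OF lt(1)] step(1)[OF lt(2)] idx using orbit_diff_nz[of 2] by simp
    have "(orbit_diff j / orbit_diff j') ^ m ^ Suc k = ((orbit_diff j / orbit_diff j') ^ m ^ k) ^ m" by (simp add: mult.commute flip: power_mult)
    also have "\<dots> = C * ((orbit_diff ?i / orbit_diff ?i') ^ m) ^ D ^ k"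
      unfolding C(2) power_mult_distrib F_power_m[OF C(1)]
      by (simp add: mult.commute flip: power_mult)
    also have "\<dots> = (C * (step_coeff ?i / step_coeff ?i') ^ D ^ k) * (orbit_diff ((j + Suc k) mod P) / orbit_diff ((j' + Suc k) mod P)) ^ D ^ Suc k"
      unfolding st power_mult_distrib by (simp add: power_mult mult.assoc)
    finally show ?case using C(1) by (intro bexI[of _ "C * (step_coeff ?i / step_coeff ?i') ^ D ^ k"])
        (auto intro!: F_closed F_power step_coeff_F)
  qed
  have ratioP: "\<exists>C\<in>F. (orbit_diff j / orbit_diff j') ^ m ^ P = C * (orbit_diff j / orbit_diff j') ^ D ^ P" if "j < P" "j' < P" for j j'
    using ratio[OF that, of P] that by simp
  define z where "z = zeta (N - 1)"
  have z: "z \<in> F" "z \<noteq> 0" using zeta_F zn N by (simp_all add: z_def)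
  \<comment> \<open>Up to a factor in F, \<tau> is \<open>orbit_diff 1 / orbit_diff 0\<close>, while
    1 - \<tau> is \<open>orbit_diff (N + 1) / orbit_diff 0\<close>. Both are quotients of the cycle,
    and they are linked by an additive relation that the power maps respect.\<close>
  define \<tau> where "\<tau> = z / \<alpha>"
  have \<tau>F: "\<tau> \<notin> F"
  proof
    assume "\<tau> \<in> F"
    then have "z / \<tau> \<in> F" by (rule F_closed(7)[OF z(1)])
    moreover have "z / \<tau> = \<alpha>" using z alpha_nz by (simp add: \<tau>_def)
    ultimately show False using alpha_notin_F by simp
  qed
  obtain C where C: "C \<in> F" "(orbit_diff 1 / orbit_diff 0) ^ m ^ P = C * (orbit_diff 1 / orbit_diff 0) ^ D ^ P"
    using ratioP[of 1 0] P by (metis less_le_trans one_less_numeral_iff semiring_norm(77) zero_less_numeral)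
  obtain k2 where k2: "k2 \<in> F" "(orbit_diff (N + 1) / orbit_diff 0) ^ m ^ P = k2 * (orbit_diff (N + 1) / orbit_diff 0) ^ D ^ P"
    using ratioP[of "N + 1" 0] by (metis P_def add_2_eq_Suc' add_less_cancel_left one_less_numeral_iff semiring_norm(76) zero_less_Suc)
  define k1 where "k1 = z * C / z ^ D ^ P"
  have k1: "k1 \<in> F" using C z unfolding k1_def by (intro F_closed F_power)
  have t1: "\<tau> ^ m ^ P = k1 * \<tau> ^ D ^ P"
  proof -
    have "\<tau> ^ m ^ P = z ^ m ^ P * (orbit_diff 1 / orbit_diff 0) ^ m ^ P" by (simp add: \<tau>_def orbit_diff_def power_divide)
    also have "\<dots> = z * C * (orbit_diff 1 / orbit_diff 0) ^ D ^ P" using F_power_mk[OF z(1)] C(2) by simp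
    also have "\<dots> = k1 * \<tau> ^ D ^ P" using z by (simp add: k1_def \<tau>_def orbit_diff_def power_divide)
    finally show ?thesis .
  qed
  have "orbit_diff (N + 1) / orbit_diff 0 = 1 - \<tau>" using N alpha_nz by (auto simp: orbit_diff_def \<tau>_def z_def diff_divide_distrib)
  then have "(1 - \<tau>) ^ m ^ P = k2 * (1 - \<tau>) ^ D ^ P" using k2(2) by simp
  then have "1 - k1 * \<tau> ^ D ^ P = k2 * (1 - \<tau> ^ D ^ P)"
    unfolding diff_power_mk diff_power_Dk t1 by simp
  then have lin: "(k2 - k1) * \<tau> ^ D ^ P = k2 - 1" by (simp add: algebra_simps)
  have "k2 = k1"
  proof (rule ccontr)
    assume ne: "k2 \<noteq> k1"
    then have "\<tau> ^ D ^ P = (k2 - 1) / (k2 - k1)" using lin by (simp add: field_simps)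
    moreover have "(k2 - 1) / (k2 - k1) \<in> F" using k1 k2(1) by (intro F_closed)
    ultimately have "(\<tau> ^ D ^ P) ^ q = \<tau> ^ D ^ P" by (simp add: F_def)
    then have "(\<tau> ^ q) ^ D ^ P = \<tau> ^ D ^ P" by (simp add: mult.commute flip: power_mult)
    then have "\<tau> ^ q = \<tau>" by (rule power_Dk_inj)
    then show False using \<tau>F by (simp add: F_def)
  qed
  with lin have "k1 = 1" by simp
  with t1 have fixed: "\<tau> ^ m ^ P = \<tau> ^ D ^ P" by simp
  obtain k where k: "m = CHAR('a) ^ k" using m_CHAR .
  have CH: "CHAR('a) \<ge> 2" using prime_CHAR by (rule prime_ge_2_nat)
  have "l \<le> k" using Dm CH unfolding k D_eq by simp
  define s where "s = k - l"
  have s: "CHAR('a) ^ s * D = m" unfolding s_def k D_eq using \<open>l \<le> k\<close> by (simp flip: power_add)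
  have "(\<tau> ^ (CHAR('a) ^ s) ^ P) ^ D ^ P = \<tau> ^ D ^ P"
    unfolding fixed[symmetric] s[symmetric] by (simp add: power_mult_distrib flip: power_mult)
  then have base: "\<tau> ^ CHAR('a) ^ (s * P) = \<tau>" by (metis power_Dk_inj power_mult)
  \<comment> \<open>The exponent p^(s P) fixes \<tau>; iterating it kq times replaces p by q, so
    that the degree of \<alpha> over F applies.\<close>
  obtain kq where kq: "q = CHAR('a) ^ kq" using q_CHAR by metis
  have it: "\<tau> ^ CHAR('a) ^ (s * P * i) = \<tau>" for i
    by (induction i) (simp_all add: power_add power_mult base[unfolded power_mult])
  have "\<tau> ^ q ^ (s * P) = \<tau>" using it[of kq] unfolding kq by (simp add: mult.commute flip: power_mult)
  then have "z / \<alpha> ^ q ^ (s * P) = z / \<alpha>" unfolding \<tau>_def power_divide using F_power_q[OF z(1)] by simp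
  then have "\<alpha> ^ q ^ (s * P) = \<alpha>" using z alpha_nz by (simp add: field_simps)
  then have "n dvd s * P" using degree_dvd_period[OF deg] by blast
  then show ?thesis using that s by (simp add: P_def)
qed

end

section \<open>Numerical restrictions on a short period\<close>

lemma Suc_power_4_le: "12 \<le> k \<Longrightarrow> Suc k ^ 4 \<le> 2 * k ^ 4"
proof -
  assume "12 \<le> k"
  then have "(12 * Suc k) ^ 4 \<le> (13 * k) ^ 4" by (intro power_mono) auto
  then have "20736 * Suc k ^ 4 \<le> 28561 * k ^ 4" by (simp only: power_mult_distrib) simp
  then show ?thesis by linarith
qed

lemma power_4_le: "12 \<le> s \<Longrightarrow> s ^ 4 \<le> 2 ^ (s + 3)" for s :: nat
proof (induction s rule: dec_induct)
  case (step k)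
  have "Suc k ^ 4 \<le> 2 * k ^ 4" using step by (intro Suc_power_4_le) simp
  also have "\<dots> \<le> 2 * 2 ^ (k + 3)" using step.IH by simp
  finally show ?case by (simp only: add_Suc power_Suc)
qed simp

lemma power_4_le': "17 \<le> s \<Longrightarrow> s ^ 4 \<le> 2 ^ (s + 1)" for s :: nat
proof (induction s rule: dec_induct)
  case (step k)
  have "Suc k ^ 4 \<le> 2 * k ^ 4" using step by (intro Suc_power_4_le) simp
  also have "\<dots> \<le> 2 * 2 ^ (k + 1)" using step.IH by simp
  finally show ?case by (simp only: add_Suc power_Suc)
qed simp

text \<open>For d \<ge> 3: 3^t \<le> n \<le> s t makes s at least 3^t/t, and then 2^(s+1) is no
  longer below the square of s t.\<close>

lemma period_bound_large:
  assumes "3 \<le> t" "3 ^ t \<le> s * t" "2 ^ (s + 1) < (s * t) ^ (2::nat)"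
  shows False
proof (cases "t = 3")
  case True
  then have "9 \<le> s" using assms by simp
  then have "9 * s ^ 2 \<le> 2 ^ (s + 1)"
  proof (induction s rule: dec_induct)
    case (step k)
    then obtain l where "k = 9 + l" using le_Suc_ex by blast
    then have "9 * Suc k ^ 2 \<le> 2 * (9 * k ^ 2)" by (simp add: power2_eq_square algebra_simps)
    then show ?case using step.IH by simp
  qed simp
  then show False using assms(3) True by (simp add: power_mult_distrib)
next
  case False
  then have t4: "4 \<le> t" using assms by simp
  have "16 * t < 3 ^ t"
    using t4
  proof (induction t rule: dec_induct)
    case (step k)
    have "16 * Suc k \<le> 3 * (16 * k)" using step by simp
    then show ?case using step.IH by simp
  qed simp
  then have "16 * t < s * t" using assms(2) by linarith
  then have s: "17 \<le> s" by simp
  have "t * t \<le> 3 ^ t"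
    using t4
  proof (induction t rule: dec_induct)
    case (step k)
    then obtain l where "k = 4 + l" using le_Suc_ex by blast
    then have "Suc k * Suc k \<le> 3 * (k * k)" by (simp add: algebra_simps)
    then show ?case using step.IH by simp
  qed simp
  then have "t * t \<le> s * t" using assms(2) by linarith
  then have "t \<le> s" using t4 by simp
  then have "(s * t) ^ 2 \<le> (s * s) ^ 2" by (intro power_mono mult_le_mono2) auto
  also have "\<dots> = s ^ 4" by (simp add: eval_nat_numeral)
  also have "\<dots> \<le> 2 ^ (s + 1)"
    by (rule power_4_le'[OF s])
  finally show False using assms(3) by simp
qed

lemma two_squares_le_power: "7 \<le> (P::nat) \<Longrightarrow> 2 * (P * P) \<le> 2 ^ P"
proof (induction P rule: dec_induct)
  case (step k)
  then obtain l where "k = 7 + l" using le_Suc_ex by blast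
  then have "Suc k * Suc k \<le> 2 * (k * k)" by (simp add: algebra_simps)
  then show ?case using step.IH by simp
qed simp

text \<open>For d = 2 the analogous conditions confine s and P to a finite range. If 2 P \<le> s,
  then (2 s P)^2 \<le> s^4 is compared with 2^(s+3); if 2 P > s, then 2^P exceeds s P once P \<ge>
  7.\<close>

lemma period_bound_small:
  assumes "3 \<le> P" "2 ^ P \<le> s * P" "2 ^ (s + 1) < (s * P) ^ (2::nat)"
  shows "s \<le> 11" "P \<le> 6"
proof -
  show s: "s \<le> 11"
  proof (rule ccontr)
    assume "\<not> s \<le> 11"
    then have s12: "12 \<le> s" by simp
    show False
    proof (cases "2 * P \<le> s")
      case True
      then have "(2 * (s * P)) ^ 2 \<le> (s * s) ^ 2" by (intro power_mono) auto
      also have "\<dots> = s ^ 4" by (simp add: eval_nat_numeral)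
      also have "\<dots> \<le> 4 * 2 ^ (s + 1)"
        using power_4_le[OF s12] by (simp add: power_add)
      finally have "4 * (s * P) ^ 2 \<le> 4 * 2 ^ (s + 1)" by (simp add: power_mult_distrib mult.commute)
      then show False using assms(3) by linarith
    next
      case False
      then have "7 \<le> P" using s12 by simp
      from two_squares_le_power[OF this] have "2 * (P * P) \<le> s * P" using assms(2) by linarith
      then have "2 * P \<le> s" using \<open>7 \<le> P\<close> by simp
      then show False using False by simp
    qed
  qed
  show "P \<le> 6"
  proof (rule ccontr)
    assume "\<not> P \<le> 6"
    then have "7 \<le> P" by simp
    from two_squares_le_power[OF this] have "2 * (P * P) \<le> s * P" using assms(2) by linarith
    then have "2 * P \<le> s" using \<open>7 \<le> P\<close> by simp
    then show False using s \<open>7 \<le> P\<close> by simp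
  qed
qed

text \<open>Numerator and denominator of the bound for d = 2, as integers for evaluation.\<close>

primrec bnum :: "int \<Rightarrow> nat \<Rightarrow> int" where
  "bnum n 0 = 1"
| "bnum n (Suc j) = bnum n j * (n + int j)"

primrec bden :: "nat \<Rightarrow> int" where
  "bden 0 = 1"
| "bden (Suc j) = bden j * int (Suc j) * 2 ^ j"

lemma bden_pos: "bden j > 0"
  by (induction j) auto

lemma order_bound_bnum:
  assumes "n \<ge> 1"
  shows "order_bound n j 2 = real_of_int (bnum (int n) j) / real_of_int (bden j)"
proof -
  have "real_of_int (bnum (int n) j) = (\<Prod>i<j. real (n + i))" by (induction j) auto
  moreover have "real_of_int (bden j) = fact j * (\<Prod>i<j. real 2 ^ i)" by (induction j) (auto simp: algebra_simps)
  ultimately show ?thesis unfolding order_bound_eq[OF assms] vol_def by simp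
qed

text \<open>The simplex supplies P - 1 coordinates before the orbit closes. For P \<ge> 4 the bound
  with t = P - 1 is already the stronger one. For P = 3 it gives only n (n + 1)/4, and the values of
  r above that are tested against short vectors and against \<open>periodic_order\<close>, where
  \<open>tele_exp 2\<close> is q^2 + 2 q + 4 because D = 2 and m = q.\<close>

definition check_period :: "int \<Rightarrow> nat \<Rightarrow> int \<Rightarrow> nat \<Rightarrow> bool" where
  "check_period q P n t \<longleftrightarrow>
     (if P = 3 then list_all (\<lambda>r. excluded_2 2 n q q r \<or> (q - 1) * (q * q + 2 * q + 4) mod r \<noteq> 0)
         [(n * (n + 1) + 3) div 4..(bnum n t - 1) div bden t]
      else bnum n t * bden (P - 1) \<le> bnum n (P - 1) * bden t)"

lemma check_period_all:
  "list_all (\<lambda>s. list_all (\<lambda>P. list_all (\<lambda>n. s * int P mod n \<noteq> 0 \<or> n * n \<le> 2 ^ nat (s + 1) \<or>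
      list_all (\<lambda>t. n < 2 ^ t \<or> n \<ge> 2 ^ (t + 1) \<or> check_period (2 ^ nat (s + 1)) P n t) [3, 4, 5, 6])
    [2 ^ P..s * int P]) [3, 4, 5, 6]) [1..11]"
  by code_simp

context frobenius_generator
begin

text \<open>X and A/h are independent even here: h does not vanish at 0, so the order at 0
  determines the exponent of X, and the degree determines the other one.\<close>

lemma lattice_min_2: "lattice_min D m r n 2"
proof (rule lattice_min_if_independent)
  fix x y :: "nat \<Rightarrow> nat" and j
  assume eq: "iter_prod g h D x y 2 = iter_prod g h D y x 2" and j: "j < (2::nat)"
  have 1: "homog (Suc 0) [:0, 1:] g h = g" using homog_linear[of 0 1 g h] by simp
  have prod: "iter_prod g h D x y 2 = smult (A ^ x 1) (monom 1 (x 0) * h ^ y 1)" for x y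
    by (simp add: iter_prod_def eval_nat_numeral 1 homog_one)
      (simp add: g_eq monom_altdef poly_const_pow mult_ac)
  have h0: "poly h 0 \<noteq> 0" using nz D(2) by (simp add: h_eq poly_monom power_0_left)
  then have hz: "h \<noteq> 0" by auto
  have ord: "Polynomial.order 0 (smult (A ^ i) (monom 1 k * h ^ l)) = k" for i k l
  proof -
    have "Polynomial.order 0 (h ^ l) = 0" using h0 by (intro order_0I) simp
    moreover have "Polynomial.order 0 (monom (1::'a) k) = k" using order_power_n_n[of 0 k] by (simp add: monom_altdef)
    ultimately show ?thesis using nz hz by (simp add: order_smult order_mult)
  qed
  have 0: "x 0 = y 0" using arg_cong[OF eq, of "Polynomial.order 0"] unfolding prod ord .
  have dh: "degree h = D"
    using nz D(2) by (simp add: h_eq degree_add_eq_left degree_monom_eq)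
  have "degree (smult (A ^ i) (monom 1 k * h ^ l)) = k + D * l" for i k l
    using nz hz dh by (simp add: degree_mult_eq degree_monom_eq degree_power_eq)
  then have "D * y 1 = D * x 1" using arg_cong[OF eq, of degree] 0 unfolding prod by simp
  then have "x 1 = y 1" using D(2) by simp
  with 0 j show "x j = y j" by (auto simp: less_2_cases_iff)
qed

theorem frobenius_bound:
  assumes d: "2 \<le> d" "D \<le> d" and t: "t \<ge> 1" "d ^ t \<le> n" "n < d ^ (t + 1)"
    and qd: "q ^ (d - 1) < n ^ 2" "n ^ 2 \<le> q ^ d" and m_eq: "m = q ^ ((d + 1) div 2)"
  shows "order_bound n t d \<le> real r"
proof (cases "\<forall>k<t - 1. zeta k \<noteq> 0")
  case True
  have "order_bound n t d \<le> order_bound n (Suc (t - 1)) D"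
    using order_bound_antimono[of D d n t] d t D(2) by simp
  also have "\<dots> \<le> real (simplex_count D (t - 1) n)"
    using order_bound_le_simplex_count[of D n "t - 1"] D(2) n by simp
  also have "\<dots> \<le> real r" using simplex_count_le[of "t - 1"] True by simp
  finally show ?thesis .
next
  case False
  then obtain k where k: "k < t - 1" "zeta k = 0" by blast
  define N where "N = (LEAST k. zeta k = 0)"
  have zN: "zeta N = 0" unfolding N_def by (rule LeastI[of "\<lambda>k. zeta k = 0", OF k(2)])
  have zn: "zeta k \<noteq> 0" if "k < N" for k using not_less_Least[of k "\<lambda>k. zeta k = 0"] that unfolding N_def by blast
  have "N \<le> k" unfolding N_def by (rule Least_le) (rule k(2))
  then have Nt: "N + 2 \<le> t" using k by simp
  have "zeta 0 \<noteq> 0"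
  proof
    assume "zeta 0 = 0"
    then have "D_root (- b) ^ D = 0" using D(2) by (simp add: power_0_left)
    then show False using ab_nz by simp
  qed
  then have N1: "N \<ge> 1" using zN by (cases N) auto
  define P where "P = N + 2"
  have P: "3 \<le> P" "P \<le> t" using N1 Nt by (simp_all add: P_def)
  have rP: "order_bound n (P - 1) D \<le> real r"
    using order_bound_le_simplex_count[of D n N] simplex_count_le[of N] zn D(2) n by (simp add: P_def)
  have nm: "n \<le> m"
  proof -
    have "n ^ 2 \<le> q ^ d" using qd by simp
    also have "\<dots> \<le> q ^ (((d + 1) div 2) * 2)" using q_ge_2 by (intro power_increasing) auto
    also have "\<dots> = m ^ 2" by (simp add: m_eq power_mult)
    finally show ?thesis using power2_nat_le_imp_le power2_le_imp_le by blast
  qed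
  have "d ^ 1 < d ^ t" using d P by (intro power_strict_increasing) auto
  then have Dm: "D < m" using d t nm by simp
  obtain s where s: "CHAR('a) ^ s * D = m" "n dvd s * P"
    using periodic_degree[OF zn zN N1] Dm unfolding P_def by auto
  have s1: "s \<ge> 1" using s(1) Dm by (cases s) auto
  have nsP: "n \<le> s * P" using s(2) s1 P by (intro dvd_imp_le) auto
  have CH: "CHAR('a) \<ge> 2" using prime_CHAR by (rule prime_ge_2_nat)
  have "2 ^ s * 2 \<le> CHAR('a) ^ s * D" using CH D(2) by (intro mult_mono power_mono) auto
  then have sm: "2 ^ (s + 1) \<le> m" using s(1) by simp
  show ?thesis
  proof (cases "d = 2")
    case False
    then have d3: "d \<ge> 3" using d by simp
    \<comment> \<open>For d \<ge> 3 both q and q^i are below n, so m < n^2; this limits s by log n,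
      while n \<le> s P forces s to be large.\<close>
    define i where "i = (d + 1) div 2 - 1"
    have "(q ^ i) ^ 2 \<le> q ^ (d - 1)"
      unfolding power_mult[symmetric] using q_ge_2 by (intro power_increasing) (auto simp: i_def)
    also have "\<dots> < n ^ 2" by (rule qd)
    finally have "q ^ i < n" by (rule power2_less_imp_less) simp
    moreover have "q ^ 2 \<le> q ^ (d - 1)" using q_ge_2 d3 by (intro power_increasing) auto
    then have "q ^ 2 < n ^ 2" using qd by simp
    then have "q < n" by (rule power2_less_imp_less) simp
    moreover have "m = q * q ^ i" using d3 by (simp add: m_eq i_def flip: power_Suc)
    ultimately have "m < n * n" by (simp add: mult_strict_mono)
    then have "2 ^ (s + 1) < n ^ 2" using sm by (simp add: power2_eq_square)
    also have nst: "n \<le> s * t" using nsP P by (meson le_trans mult_le_mono2)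
    then have "n ^ 2 \<le> (s * t) ^ 2" by (intro power_mono) auto
    finally have "2 ^ (s + 1) < (s * t) ^ 2" .
    moreover have "3 ^ t \<le> d ^ t" using d3 by (intro power_mono) auto
    then have "3 ^ t \<le> s * t" using t nst by linarith
    ultimately have False using period_bound_large[of t s] P by simp
    then show ?thesis ..
  next
    case True
    then have D2: "D = 2" using d D(2) by simp
    have "CHAR('a) dvd 2" using D2 D_eq prime_CHAR D(2)
      by (metis dvd_power gr0I numeral_1_eq_Suc_0 numerals(1) one_neq_zero power_0 semiring_norm(85) numeral_eq_iff numeral_One)
    then have "CHAR('a) = 2" using CH by (simp add: dvd_imp_le le_antisym)
    moreover have mq: "m = q" using True m_eq by simp
    \<comment> \<open>Here D = 2 forces characteristic 2, so q is determined by s, and n divides s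
      P: finitely many triples remain.\<close>
    ultimately have qs: "q = 2 ^ (s + 1)" using s(1) D2 by simp
    have lt: "2 ^ (s + 1) < n ^ 2" using qd True qs by simp
    also have "\<dots> \<le> (s * P) ^ 2" using nsP by (intro power_mono) auto
    finally have lt2: "2 ^ (s + 1) < (s * P) ^ 2" .
    have "2 ^ P \<le> (2::nat) ^ t" using P by (intro power_increasing) auto
    moreover have "2 ^ t \<le> n" using t True by simp
    ultimately have Pn: "2 ^ P \<le> n" by linarith
    then have "2 ^ P \<le> s * P" using nsP by simp
    with lt2 have s11: "s \<le> 11" and P6: "P \<le> 6" using period_bound_small[of P s] P by blast+
    have "s * P \<le> 11 * 6" using s11 P6 by (intro mult_mono) auto
    then have "2 ^ t < (2::nat) ^ 7" using nsP t True by simp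
    then have t6: "t \<le> 6" using power_less_imp_less_exp[of "2::nat" t 7] by simp
    have sS: "int s \<in> set [1..11]" unfolding set_upto using s1 s11 by simp
    have PS: "P \<in> set [3, 4, 5, 6]" using P P6 by auto
    have nS: "int n \<in> set [2 ^ P..int s * int P]"
    proof -
      have "int (2 ^ P) \<le> int n" "int n \<le> int (s * P)" using Pn nsP by (simp_all only: of_nat_le_iff)
      then show ?thesis unfolding set_upto by simp
    qed
    have "int s * int P mod int n \<noteq> 0 \<or> int n * int n \<le> 2 ^ nat (int s + 1) \<or>
      (\<forall>t\<in>set [3, 4, 5, 6]. int n < 2 ^ t \<or> int n \<ge> 2 ^ (t + 1) \<or> check_period (2 ^ nat (int s + 1)) P (int n) t)"
      by (rule check_period_all[unfolded list_all_iff, THEN bspec, OF sS, THEN bspec, OF PS, THEN bspec, OF nS])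
    moreover have "int s * int P mod int n = 0" using s(2) by (metis dvd_eq_mod_eq_0 of_nat_dvd_iff of_nat_mult)
    moreover have nat_s: "nat (int s + 1) = s + 1" by simp
    moreover have "\<not> int n * int n \<le> 2 ^ (s + 1)"
    proof -
      have "int (2 ^ (s + 1)) < int (n ^ 2)" using lt by (simp only: of_nat_less_iff)
      then show ?thesis by (simp add: power2_eq_square)
    qed
    moreover have "t \<in> set [3, 4, 5, 6]" using P t6 by auto
    moreover have "\<not> int n < 2 ^ t" "\<not> int n \<ge> 2 ^ (t + 1)"
    proof -
      have "int (2 ^ t) \<le> int n" "int n < int (2 ^ (t + 1))" using t True by (simp_all only: of_nat_le_iff of_nat_less_iff)
      then show "\<not> int n < 2 ^ t" "\<not> int n \<ge> 2 ^ (t + 1)" by simp_all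
    qed
    ultimately have ck: "check_period (2 ^ (s + 1)) P (int n) t"
      unfolding list_all_iff by metis
    have qi: "int q = 2 ^ (s + 1)" by (simp add: qs)
    show ?thesis
    proof (cases "P = 3")
      case False
      then have "bnum (int n) t * bden (P - 1) \<le> bnum (int n) (P - 1) * bden t"
        using ck by (simp add: check_period_def)
      then have "real_of_int (bnum (int n) t * bden (P - 1)) \<le> real_of_int (bnum (int n) (P - 1) * bden t)"
        by (simp only: of_int_le_iff)
      then have "order_bound n t 2 \<le> order_bound n (P - 1) 2"
        unfolding order_bound_bnum[OF n] using bden_pos[of t] bden_pos[of "P - 1"]
        by (simp add: divide_simps)
      then show ?thesis using rP True D2 by simp
    next
      case P3: True
      show ?thesis
      proof (rule ccontr)
        assume "\<not> ?thesis"
        then have "real r < real_of_int (bnum (int n) t) / real_of_int (bden t)"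
          using True order_bound_bnum[OF n] by simp
        then have "real_of_int (int r * bden t) < real_of_int (bnum (int n) t)"
          using bden_pos[of t] by (simp add: field_simps)
        then have "int r * bden t < bnum (int n) t" by (simp only: of_int_less_iff)
        then have "int r \<le> (bnum (int n) t - 1) div bden t"
          using bden_pos[of t] by (metis zdiv_mono1 zle_diff1_eq nonzero_mult_div_cancel_right less_irrefl)
        moreover have lo: "(int n * (int n + 1) + 3) div 4 \<le> int r"
        proof -
        have "n * (n + 1) \<le> 4 * r"
          using rP order_bound_2_eq[OF n, of 2 r] P3 D2 by simp
        then have "int (n * (n + 1)) \<le> int (4 * r)" by (simp only: of_nat_le_iff)
        then have "int n * (int n + 1) \<le> 4 * int r" by (simp add: algebra_simps)
        moreover have "(w + 3) div 4 \<le> y" if "w \<le> 4 * y" for w y :: int using that by presburger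
        ultimately show ?thesis by blast
        qed
        ultimately have "int r \<in> set [(int n * (int n + 1) + 3) div 4..(bnum (int n) t - 1) div bden t]"
          unfolding set_upto by simp
        then have "excluded_2 2 (int n) (int q) (int q) (int r) \<or> (int q - 1) * (int q * int q + 2 * int q + 4) mod int r \<noteq> 0"
          using ck P3 unfolding check_period_def list_all_iff qi by simp
        moreover have "\<not> excluded_2 2 (int n) (int q) (int q) (int r)"
          using not_excluded_2[of 2 q r n q] lattice_min_2 D2 mq r_pos q_power_mod_order by simp
        moreover have "(int q - 1) * (int q * int q + 2 * int q + 4) mod int r = 0"
        proof -
          have "N = 1" using P3 by (simp add: P_def)
          then have "tele_exp (N + 1) = D ^ 2 + m * (D + m)" by (simp add: numeral_2_eq_2)
          also have "\<dots> = q * q + 2 * q + 4" by (simp add: D2 mq algebra_simps)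
          finally have "r dvd (q - 1) * (q * q + 2 * q + 4)"
            using periodic_order[OF zn zN N1] by simp
          then have "int r dvd int ((q - 1) * (q * q + 2 * q + 4))" by (simp only: of_nat_dvd_iff)
          then show ?thesis using q_ge_2 by (simp add: of_nat_diff)
        qed
        ultimately show False by blast
      qed
    qed
  qed
qed

end

section \<open>The lower bound\<close>

text \<open>The ceiling of L is half the ceiling of 2 L, rounded up, so m is determined by q and
  d.\<close>

lemma log_ceil_bounds:
  fixes q n d :: nat
  assumes q: "2 \<le> q" and n: "2 \<le> n" and d: "d = nat \<lceil>2 * log (real q) (real n)\<rceil>"
  shows "q ^ (d - 1) < n ^ 2" "n ^ 2 \<le> q ^ d" "nat \<lceil>log (real q) (real n)\<rceil> = (d + 1) div 2" "d \<ge> 1"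
proof -
  define L where "L = log (real q) (real n)"
  have L: "L > 0" using q n by (simp add: L_def)
  have nL: "real n = real q powr L" using q n by (simp add: L_def)
  then have n2: "real (n ^ 2) = real q powr (2 * L)"
    using q by (simp add: powr_powr[symmetric] power2_eq_square powr_add[symmetric])
  have pos: "\<lceil>2 * L\<rceil> \<ge> 1" using L by (simp add: one_le_ceiling)
  then have dr: "real_of_int \<lceil>2 * L\<rceil> = real d" using d by (simp add: L_def)
  have d1: "d \<ge> 1" using pos d unfolding L_def by linarith
  then show "d \<ge> 1" by simp
  have lo: "real d - 1 < 2 * L" and hi: "2 * L \<le> real d"
    unfolding dr[symmetric] by linarith+
  have "real (q ^ (d - 1)) = real q powr (real d - 1)"
    using q d1 by (simp add: powr_realpow[symmetric] of_nat_diff)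
  also have "\<dots> < real (n ^ 2)" unfolding n2 using lo q by (intro powr_less_mono) auto
  finally show "q ^ (d - 1) < n ^ 2" by (simp only: of_nat_less_iff)
  have "real (n ^ 2) \<le> real q powr real d" unfolding n2 using hi q by (intro powr_mono) auto
  also have "\<dots> = real (q ^ d)" using q by (simp add: powr_realpow)
  finally show "n ^ 2 \<le> q ^ d" by (simp only: of_nat_le_iff)
  have "\<lceil>L\<rceil> = int ((d + 1) div 2)"
  proof (rule ceiling_unique)
    have "2 * ((d + 1) div 2) \<le> d + 1" by simp
    then have "real (2 * ((d + 1) div 2)) \<le> real (d + 1)" by (simp only: of_nat_le_iff)
    then have "2 * real ((d + 1) div 2) \<le> real d + 1"
      by (simp only: of_nat_mult of_nat_add of_nat_numeral of_nat_1)
    then show "of_int (int ((d + 1) div 2)) - 1 < L" using lo unfolding of_int_of_nat_eq by linarith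
    have "d \<le> 2 * ((d + 1) div 2)" by simp
    then have "real d \<le> real (2 * ((d + 1) div 2))" by (simp only: of_nat_le_iff)
    then have "real d \<le> 2 * real ((d + 1) div 2)" by (simp only: of_nat_mult of_nat_numeral)
    then show "L \<le> of_int (int ((d + 1) div 2))" using hi unfolding of_int_of_nat_eq by linarith
  qed
  then show "nat \<lceil>log (real q) (real n)\<rceil> = (d + 1) div 2" by (simp add: L_def)
qed

lemma log_floor_bounds:
  fixes d n t :: nat
  assumes d: "2 \<le> d" and n: "1 \<le> n" and t: "t = nat \<lfloor>log (real d) (real n)\<rfloor>"
  shows "d ^ t \<le> n" "n < d ^ (t + 1)"
proof -
  define L where "L = log (real d) (real n)"
  have L: "L \<ge> 0" using d n by (simp add: L_def)
  have nL: "real n = real d powr L" using d n by (simp add: L_def)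
  have tr: "real_of_int \<lfloor>L\<rfloor> = real t" using t L by (simp add: L_def)
  have lo: "real t \<le> L" and hi: "L < real t + 1" unfolding tr[symmetric] by linarith+
  have "real (d ^ t) = real d powr real t" using d by (simp add: powr_realpow)
  also have "\<dots> \<le> real n" unfolding nL using lo d by (intro powr_mono) auto
  finally show "d ^ t \<le> n" by (simp only: of_nat_le_iff)
  have "real n < real d powr (real t + 1)" unfolding nL using hi d by (intro powr_less_mono) auto
  also have "\<dots> = real (d ^ (t + 1))" using d by (simp add: powr_realpow[symmetric] powr_add)
  finally show "n < d ^ (t + 1)" by (simp only: of_nat_less_iff)
qed

text \<open>From d = 21 on, even q = 2 violates q^(d-1) < n^2 for n \<le> 2 d^2 + d + 1; hence the
  table \<open>q_bounds\<close> ends at 20.\<close>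

lemma power_of_two_beats_quartic: "21 \<le> d \<Longrightarrow> (2 * d ^ 2 + d + 2) ^ 2 \<le> (2::nat) ^ (d - 1)"
proof (induction d rule: dec_induct)
  case (step k)
  define x where "x = 2 * k ^ 2 + k + 2"
  have "5 * (2 * Suc k ^ 2 + Suc k + 2) \<le> 6 * x"
  proof -
    from step obtain l where "k = 21 + l" using le_Suc_ex by blast
    then show ?thesis unfolding x_def by (simp add: power2_eq_square algebra_simps)
  qed
  then have "(5 * (2 * Suc k ^ 2 + Suc k + 2)) ^ 2 \<le> (6 * x) ^ 2" by (intro power_mono) auto
  then have "25 * (2 * Suc k ^ 2 + Suc k + 2) ^ 2 \<le> 36 * x ^ 2" by (simp only: power_mult_distrib) simp
  then have "(2 * Suc k ^ 2 + Suc k + 2) ^ 2 \<le> 2 * x ^ 2" by linarith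
  also have "\<dots> \<le> 2 * 2 ^ (k - 1)" using step.IH by (simp add: x_def)
  also have "\<dots> = 2 ^ (Suc k - 1)" using step by (simp flip: power_Suc)
  finally show ?case .
qed simp

context generator
begin

theorem generic_bound:
  assumes ind: "\<And>T. lattice_min D m r n T"
    and d: "2 \<le> d" "D \<le> d" and t: "d ^ t \<le> n" "n < d ^ (t + 1)"
    and qd: "q ^ (d - 1) < n ^ 2" "n ^ 2 \<le> q ^ d" and m_eq: "m = q ^ ((d + 1) div 2)"
  shows "order_bound n t d \<le> real r"
proof -
  have count: "ball_count D T n \<le> r" for T
    using ball_count_le[OF ind _ r_pos n] D(2) by simp
  have D1: "1 \<le> D" using D(2) by simp
  consider "t = 0" | "t \<ge> 1" "D < d" | "t = 1" "D = d" | "t = 2" "D = d" | "t = 3" "D = d" | "t \<ge> 4" "D = d"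
    using d by linarith
  then show ?thesis
  proof cases
    case 1
    then show ?thesis using r_pos by (simp add: order_bound_def)
  next
    case 2
    then have "d ^ 1 \<le> d ^ t" using d by (intro power_increasing) auto
    then have "d \<le> n" using t by simp
    then have "order_bound n t d \<le> vol D t * real n ^ t"
      using order_bound_smaller_degree[of D d n t] 2 D1 by simp
    also have "\<dots> \<le> real (ball_count D (t - 1) n)"
      using ball_count_ge_vol[OF D1, of "t - 1" n] 2 by simp
    also have "\<dots> \<le> real r" using count by simp
    finally show ?thesis .
  next
    case 3
    then show ?thesis using count[of 0] n by (simp add: order_bound_def)
  next
    case 4
    have small: "order_bound n 2 d \<le> real r" if "n \<le> 2 * d ^ 2 + d + 1"
    proof -
      have "d \<le> 20"
      proof (rule ccontr)
        assume "\<not> d \<le> 20"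
        then have "(2 * d ^ 2 + d + 2) ^ 2 \<le> (2::nat) ^ (d - 1)" by (intro power_of_two_beats_quartic) simp
        also have "\<dots> \<le> q ^ (d - 1)" using q_ge_2 by (intro power_mono) auto
        also have "\<dots> < n ^ 2" by (rule qd)
        also have "\<dots> \<le> (2 * d ^ 2 + d + 2) ^ 2" using that by (intro power_mono) auto
        finally show False by simp
      qed
      then show ?thesis
        using order_bound_2_small[of d n q m r] d t qd m_eq that q_ge_2 ind order_gt_degree q_power_mod_order 4
        by (simp add: numeral_3_eq_3)
    qed
    show ?thesis
    proof (cases "n \<le> 2 * d ^ 2 + d + 1")
      case True
      then show ?thesis using small 4 by simp
    next
      case False
      then have "order_bound n 2 d \<le> real (ball_count d 2 n)" using d by (intro order_bound_2) auto
      then show ?thesis using count[of 2] 4 by simp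
    qed
  next
    case 5
    show ?thesis
    proof (cases "d \<ge> 4")
      case True
      then have "order_bound n 3 d \<le> real (ball_count d 2 n) \<or> order_bound n 3 d \<le> real (ball_count d 3 n)"
        using order_bound_3[of d n] t 5 by simp
      then show ?thesis using count[of 2] count[of 3] 5 by auto
    next
      case False
      then have "d = 2 \<or> d = 3" using d by auto
      then show ?thesis
        using order_bound_3_small[of d n q m r] t qd m_eq ind r_pos q_power_mod_order 5 by simp
    qed
  next
    case 6
    then have "order_bound n t d \<le> real (ball_count d (t - 1) n)"
      using order_bound_ge_4 d t by blast
    then show ?thesis using count[of "t - 1"] 6 by simp
  qed
qed

end

lemma Fract_monom_eq: "Fract (monom (c::'a::field) k) 1 = rconst c * rX ^ k"
proof -
  have "rX ^ k = Fract (monom 1 k) (1::'a poly)"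
    by (induction k) (simp_all add: rX_def One_fract_def monom_Suc)
  then show ?thesis by (simp add: rconst_def smult_monom)
qed

theorem theorem3:
  fixes q n :: nat and g h :: "'a::{field,finite} poly" and \<alpha> :: 'a
  assumes "primepow q" and "n \<ge> 1"
    and "card (UNIV::'a set) = q ^ n"
    and "F = {x::'a. x ^ q = x}"
    and "d = nat \<lceil>2 * log (real q) (real n)\<rceil>"
    and "m = q ^ nat \<lceil>log (real q) (real n)\<rceil>"
    and "t = nat \<lfloor>log (real d) (real n)\<rfloor>"
    and "\<forall>i. coeff g i \<in> F" and "\<forall>i. coeff h i \<in> F"
    and "h \<noteq> 0" and "coprime g h"
    and "degree g \<le> d" and "degree h \<le> d"
    and "max (degree g) (degree h) \<ge> 2"
    and "\<not> is_monomial_rat F g h"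
    and "\<not> is_frob_binomial F g h"
    and "\<not> lin_conj_inv_power F g h (max (degree g) (degree h))"
    and "degree g \<noteq> degree h \<or> separable_rat g h \<or> \<not> is_L_of_frob F g h"
    and "alg_degree F \<alpha> = n"
    and "poly (monom 1 m * h - g) \<alpha> = 0"
  shows "real (n + t - 1 choose t) * (\<Prod>i<t. 1 / real d ^ i) \<le> real (mult_order \<alpha>)"
proof -
  define D where "D = max (degree g) (degree h)"
  have D2: "D \<ge> 2" and Dd: "D \<le> d" using assms(12-14) by (simp_all add: D_def)
  have D1: "D \<ge> 1" using D2 by simp
  have n2: "n \<ge> 2"
  proof (rule ccontr)
    assume "\<not> n \<ge> 2"
    then have "n = 1" using assms(2) by simp
    \<comment> \<open>For n = 1 the logarithm is 0, whereas the degree of f is between 2 and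
      d.\<close>
    then have "d = 0" using assms(5) by simp
    then show False using D2 Dd by simp
  qed
  interpret E: extension_field q n F
    by unfold_locales (use assms(1-4) in auto)
  note bounds = log_ceil_bounds[OF E.q_ge_2 n2 assms(5)]
  define e where "e = (d + 1) div 2"
  have m: "m = q ^ e" using assms(6) bounds(3) by (simp add: e_def)
  interpret G: generator q n F g h \<alpha> D e m
    by unfold_locales (use assms(8,9,11,19,20) D_def D2 n2 m in \<open>auto simp: E.F_poly_def\<close>)
  have d2: "2 \<le> d" using D2 Dd by simp
  note t = log_floor_bounds[OF d2 assms(2) assms(7)]
  have gF: "coeff g i \<in> F" and hF: "coeff h i \<in> F" for i using assms(8,9) by auto
  have notmon1: False if "g = monom x D" "h = [:y:]" for x y
  proof -
    have xy: "x \<noteq> 0" "y \<noteq> 0" using assms(10) that D2 D_def by (auto simp: monom_0)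
    have "x \<in> F" "y \<in> F" using gF[of D] hF[of 0] that by simp_all
    then have "x / y \<in> F" "x / y \<noteq> 0" using xy E.F_closed(7) by auto
    moreover have "ratf g h = rconst (x / y) * rX powi int D"
    proof -
      have "ratf g h = Fract (monom (x / y) D) 1"
        using xy by (simp add: ratf_def that eq_fract smult_monom)
      then show ?thesis by (simp add: Fract_monom_eq)
    qed
    ultimately show False using assms(15) unfolding is_monomial_rat_def by blast
  qed
  have notmon2: False if "g = [:x:]" "h = monom y D" for x y
  proof -
    have y: "y \<noteq> 0" using assms(10) that by auto
    moreover have "x \<noteq> 0"
    proof
      assume "x = 0"
      then have "is_unit h" using assms(11) that by simp
      then have "degree h = 0" using assms(10) by (simp add: is_unit_iff_degree)
      then show False using that y D2 by (simp add: degree_monom_eq)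
    qed
    ultimately have xy: "x \<noteq> 0" "y \<noteq> 0" by auto
    have "x \<in> F" "y \<in> F" using gF[of 0] hF[of D] that by simp_all
    then have "x / y \<in> F" "x / y \<noteq> 0" using xy E.F_closed(7) by auto
    moreover have "ratf g h = rconst (x / y) * rX powi (- int D)"
    proof -
      have "Fract (monom (1::'a) D) 1 = rX ^ D" using Fract_monom_eq[of 1 D] by (simp add: rconst_def One_fract_def[symmetric] flip: one_pCons)
      from this[symmetric] have "rX powi (- int D) = Fract 1 (monom (1::'a) D)" by (simp add: power_int_minus inverse_fract)
      then show ?thesis using xy by (simp add: ratf_def that rconst_def eq_fract smult_monom)
    qed
    ultimately show False using assms(15) unfolding is_monomial_rat_def by blast
  qed
  have "order_bound n t d \<le> real (mult_order \<alpha>)"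
  proof (cases "\<exists>x y z w l. g = monom x D + [:y:] \<and> h = monom z D + [:w:] \<and> D = CHAR('a) ^ l")
    case False
    have "lattice_min D m (mult_order \<alpha>) n T" for T
    proof (rule G.lattice_min_if_independent)
      fix a b :: "nat \<Rightarrow> nat" and j
      assume eq: "iter_prod g h D a b T = iter_prod g h D b a T" and j: "j < T"
      show "a j = b j"
        by (rule iter_independent_field[OF assms(11) D_def D1 _ _ _ eq j])
          (use False notmon1 notmon2 in blast)+
    qed
    then show ?thesis
      using G.generic_bound d2 Dd t bounds(1,2) m e_def by blast
  next
    case True
    then obtain x y z w l where g: "g = monom x D + [:y:]" and h: "h = monom z D + [:w:]" and D: "D = CHAR('a) ^ l"
      by blast
    have l: "l \<ge> 1" using D D2 by (cases l) auto
    have D0: "D > 0" using D2 by simp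
    have cF: "x \<in> F" "y \<in> F" "z \<in> F" "w \<in> F"
      using gF[of D] gF[of 0] hF[of D] hF[of 0] D0 unfolding g h
      by (simp_all add: coeff_pCons split: nat.splits)
    have bin: "rconst u * rX ^ D + rconst v = Fract (monom u D + [:v:]) 1" for u v :: 'a
      unfolding Fract_monom_eq[symmetric] by (simp add: rconst_def)
    have rat: "ratf g h = moeb x y z w (rX ^ (CHAR('a) ^ l))"
      unfolding moeb_def D[symmetric] bin g[symmetric] h[symmetric] ratf_def using assms(10) by simp
    have det: "x * w - y * z \<noteq> 0"
    proof
      assume *: "x * w - y * z = 0"
      have eq: "smult z g = smult x h"
        unfolding g h using * by (simp add: smult_add_right smult_monom mult.commute)
      show False
      proof (cases "z = 0")
        case True
        then have "x = 0" using eq assms(10) by simp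
        then show False using D_def D2 True by (simp add: g h)
      next
        case False
        then have "h dvd g" using eq by (metis dvd_refl dvd_smult dvd_smult_cancel)
        then have "is_unit h" using assms(11) by (metis coprime_common_divisor dvd_refl)
        then have dh: "degree h = 0" using assms(10) by (simp add: is_unit_iff_degree)
        have "degree g = degree (smult x h)" using False by (simp flip: eq)
        then have "degree g = 0" using dh degree_smult_le[of x h] by simp
        then show False using D_def D2 dh by simp
      qed
    qed
    have insep: "\<not> separable_rat g h"
    proof -
      have "of_nat D = (0 :: 'a)" using l by (simp add: D)
      then have "pderiv g = 0" "pderiv h = 0" by (simp_all add: g h pderiv_add pderiv_monom pderiv_pCons)
      then show ?thesis by (simp add: separable_rat_def)
    qed
    \<comment> \<open>Here f is inseparable and of the form L(X^(p^l)), so only the first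
      alternative of the hypothesis is left. Then z = 0 would give an excluded binomial, and z
      \<noteq> 0 forces x = 0, that is, f = y / (z X^D + w).\<close>
    have "degree g \<noteq> degree h"
    proof -
      have "is_L_of_frob F g h" unfolding is_L_of_frob_def using cF l det rat by blast
      then show ?thesis using assms(18) insep by blast
    qed
    have deg_mon: "degree (monom u D + [:v:]) = D" if "u \<noteq> 0" for u v :: 'a
      using that D0 by (simp add: degree_add_eq_left degree_monom_eq)
    have z: "z \<noteq> 0"
    proof
      assume z0: "z = 0"
      then have h': "h = [:w:]" "w \<noteq> 0" using h assms(10) by auto
      have "x \<noteq> 0" using D_def D2 g h' by auto
      then have "x / w \<noteq> 0" using h' by simp
      moreover have "ratf g h = rconst (x / w) * rX ^ (CHAR('a) ^ l) + rconst (y / w)"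
        unfolding D[symmetric] bin ratf_def h'(1) using h'(2)
        by (simp add: eq_fract g smult_add_right smult_monom)
      moreover have "x / w \<in> F" "y / w \<in> F" using cF E.F_closed(7) by auto
      ultimately show False using assms(16) unfolding is_frob_binomial_def by blast
    qed
    then have "degree h = D" using deg_mon h by simp
    then have x: "x = 0" using deg_mon[of x y] g \<open>degree g \<noteq> degree h\<close> by auto
    then have g': "g = [:y:]" using g by simp
    have "y \<noteq> 0"
    proof
      assume "y = 0"
      then have "is_unit h" using assms(11) g' by simp
      then have "degree h = 0" using assms(10) by (simp add: is_unit_iff_degree)
      then show False using \<open>degree h = D\<close> D0 by simp
    qed
    moreover have "w \<noteq> 0" using notmon2[OF g', of z] h by auto
    ultimately interpret frobenius_generator q n F g h \<alpha> D e m y w z l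
      by unfold_locales (use g' h D z in auto)
    show ?thesis
    proof (cases "t = 0")
      case True
      then show ?thesis using G.r_pos by (simp add: order_bound_def)
    next
      case False
      then show ?thesis using frobenius_bound[OF d2 Dd _ t bounds(1,2)] m e_def by simp
    qed
  qed
  then show ?thesis by (simp add: order_bound_def)
qed

end
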